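(* Let $d\in\mathbb{N}$, $d\ge 1$, let $v\in\mathbb{R}^d$ with $|v|<1$, and let $1<q<p<1+\frac{2}{d}$. Then there exists a strictly positive number $\rho_0^v>0$ such that: (i) $I_{\rho^2}=0$ for all $\rho\in(0,\rho_0^v]$; (ii) $I_{\rho^2}<0$ for all $\rho\in(\rho_0^v,\infty)$. Moreover, for every $\rho$ with $0<\rho<\rho_0^v$ there are no constrained minimizers, i.e. there is no $u\in S_\rho$ with $E_v(u)=I_{\rho^2}$; and for every $\rho\in[\rho_0^v,\infty)$ there exists $u_\rho\in S_\rho$ such that $I_{\rho^2}=E_v(u_\rho)$.
   Context: $H^{1/2}=H^{1/2}(\mathbb{R}^d)$ is the usual Sobolev space of complex-valued functions on $\mathbb{R}^d$. The operator $\sqrt{-\Delta}$ is the Fourier multiplier with symbol $|\xi|$. For $u\in H^{1/2}(\mathbb{R}^d)$ and $v\in\mathbb{R}^d$ with $|v|<1$ define $$T_v(u)=\int_{\mathbb{R}^d}\bar u(x)\,(\sqrt{-\Delta}+iv\cdot\nabla)u(x)\,dx=\int_{\mathbb{R}^d}(|\xi|-v\cdot\xi)\,|\mathcal{F}(u)(\xi)|^2\,d\xi,$$ where $\mathcal{F}$ is the unitary Fourier transform (the first integral being understood through the second), and $$E_v(u)=\frac12T_v(u)+\frac{1}{q+1}\int_{\mathbb{R}^d}|u|^{q+1}dx-\frac{1}{p+1}\int_{\mathbb{R}^d}|u|^{p+1}dx.$$ For $\rho>0$ let $S_\rho=\{u\in H^{1/2}(\mathbb{R}^d):\ \|u\|_{L^2}=\rho\}$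 and $I_{\rho^2}=\inf_{u\in S_\rho}E_v(u)$. *)

theory Defs
  imports "HOL-Analysis.Analysis"
begin

text \<open>
  Elements of \<open>L\<^sup>2\<close> are represented by Borel functions rather than by classes modulo null sets;
  everything below is invariant under changing a function on a null set.
\<close>

definition L2 :: "('a::euclidean_space \<Rightarrow> complex) set" where
  "L2 = {u \<in> borel_measurable lborel. integrable lborel (\<lambda>x. (norm (u x))\<^sup>2)}"

definition L2_norm :: "('a::euclidean_space \<Rightarrow> complex) \<Rightarrow> real" where
  "L2_norm u = sqrt (LINT x|lborel. (norm (u x))\<^sup>2)"

definition fourier_L1 :: "('a::euclidean_space \<Rightarrow> complex) \<Rightarrow> 'a \<Rightarrow> complex" where
  "fourier_L1 f \<xi> =
     of_real ((2 * pi) powr (- real DIM('a) / 2)) * (LINT x|lborel. cis (- (\<xi> \<bullet> x)) * f x)"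

text \<open>
  The unitary Fourier transform on \<open>L\<^sup>2\<close>: by Plancherel's theorem, the transforms of the
  truncations of \<open>u\<close> to balls (which are in \<open>L\<^sup>1 \<inter> L\<^sup>2\<close>) converge in \<open>L\<^sup>2\<close> as the radius tends to
  infinity, and the transform of \<open>u\<close> is their limit. It is determined only almost everywhere, so
  \<open>fourier_L2\<close> selects a representative. The distance is an extended nonnegative integral because
  the Bochner integral would be 0 for a non-integrable difference.
\<close>

definition is_fourier_L2 ::
    "('a::euclidean_space \<Rightarrow> complex) \<Rightarrow> ('a \<Rightarrow> complex) \<Rightarrow> bool" where
  "is_fourier_L2 u g \<longleftrightarrow> g \<in> L2 \<and>
     ((\<lambda>R::real. \<integral>\<^sup>+ \<xi>. ennreal ((norm (fourier_L1 (\<lambda>x. indicator (cball 0 R) x * u x) \<xi> - g \<xi>))\<^sup>2)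
         \<partial>lborel) \<longlongrightarrow> 0) at_top"

definition fourier_L2 :: "('a::euclidean_space \<Rightarrow> complex) \<Rightarrow> 'a \<Rightarrow> complex" where
  "fourier_L2 u = (SOME g. is_fourier_L2 u g)"

text \<open>\<open>H\<^sup>s\<close> for \<open>s \<ge> 0\<close> (for negative \<open>s\<close> the space would contain non-\<open>L\<^sup>2\<close> distributions).\<close>

definition sobolev :: "real \<Rightarrow> ('a::euclidean_space \<Rightarrow> complex) set" where
  "sobolev s =
     {u \<in> L2. integrable lborel (\<lambda>\<xi>. (1 + (norm \<xi>)\<^sup>2) powr s * (norm (fourier_L2 u \<xi>))\<^sup>2)}"

definition kinetic :: "'a::euclidean_space \<Rightarrow> ('a \<Rightarrow> complex) \<Rightarrow> real" where
  "kinetic v u = (LINT \<xi>|lborel. (norm \<xi> - v \<bullet> \<xi>) * (norm (fourier_L2 u \<xi>))\<^sup>2)"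

definition energy :: "'a::euclidean_space \<Rightarrow> real \<Rightarrow> real \<Rightarrow> ('a \<Rightarrow> complex) \<Rightarrow> real" where
  "energy v q p u =
     1 / 2 * kinetic v u
     + 1 / (q + 1) * (LINT x|lborel. norm (u x) powr (q + 1))
     - 1 / (p + 1) * (LINT x|lborel. norm (u x) powr (p + 1))"

definition mass_sphere :: "real \<Rightarrow> ('a::euclidean_space \<Rightarrow> complex) set" where
  "mass_sphere \<rho> = {u \<in> sobolev (1 / 2). L2_norm u = \<rho>}"

text \<open>
  The infimum \<open>I\<close> at mass \<open>\<rho>\<^sup>2\<close>, as a function of \<open>\<rho>\<close>. It is taken in the extended reals, since a
  real-valued \<open>Inf\<close> has no meaning for sets that are not bounded below.
\<close>

definition min_energy :: "'a::euclidean_space \<Rightarrow> real \<Rightarrow> real \<Rightarrow> real \<Rightarrow> ereal" where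
  "min_energy v q p \<rho> = (INF u \<in> mass_sphere \<rho>. ereal (energy v q p u))"

end

theory Submission
  imports Defs "HOL-Probability.Characteristic_Functions" "HOL-Complex_Analysis.Great_Picard"
begin

text \<open>
  Let \<open>N\<close> be the set of all \<open>\<rho> > 0\<close> for which the energy takes a negative value at mass \<open>\<rho>\<^sup>2\<close>. Dilations
  \<open>u(x / \<mu>)\<close> with \<open>\<mu> > 1\<close> favour the potential terms, so \<open>N\<close> is upward closed; varying the amplitude shows that
  \<open>N\<close> is open and nonempty. Since \<open>p + 1\<close> lies between \<open>q + 1\<close> and \<open>2 + 2/d\<close>, Young's inequality and the
  endpoint Gagliardo-Nirenberg inequality bound the focusing term by the other two when the mass is small.
  Hence \<open>N\<close> is the open half line beyond some \<open>\<rho>\<^sub>0 > 0\<close>. Spreading \<open>u\<close> out at fixed mass makes the energy tend to zero, which gives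
  the value \<open>0\<close> up to \<open>\<rho>\<^sub>0\<close>; a minimizer below \<open>\<rho>\<^sub>0\<close> would become negative under a slight dilation.

  For \<open>\<rho> > \<rho>\<^sub>0\<close> take a minimizing sequence of negative energies, and for \<open>\<rho> = \<rho>\<^sub>0\<close> functions of negative energy
  with masses decreasing to \<open>\<rho>\<^sub>0\<^sup>2\<close>. Negative energy keeps \<open>\<parallel>u\<^sub>n\<parallel>\<close> in \<open>L\<^sup>p\<^sup>+\<^sup>1\<close> away from zero, so some fixed low-frequency
  part of \<open>u\<^sub>n\<close> is bounded below at a point; after translation there is a nonzero weak limit. The energy splits along it,
  and the dilation argument rules out a loss of mass.
\<close>

section \<open>The space \<open>L\<^sup>2\<close>\<close>

text \<open>The boost makes the symbol |\<xi>| - v.\<xi> non-radial, so symmetrization offers no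
  compactness. What remains is translation invariance of the energy and a symbol that is homogeneous
  of degree one and, as |v| < 1, comparable to |\<xi>|. The exponent 2 + 2/d is the one at which
  potential and kinetic terms scale alike under dilations of fixed mass. For masses that are not
  small the endpoint inequality cannot exclude vanishing, because its constant times the kinetic
  energy is not small. A second inequality is therefore proved, in which a moment of order 1/2 of
  the transform replaces the mass; this moment is small when the kinetic energy is. At \<rho>_0 an
  arbitrary minimizing sequence may spread out and converge to nothing, since the infimum is 0
  there. Negative energies exclude this but occur only at larger masses, so the compactness argument
  is set up for sequences whose masses merely converge to the target. Local compactness comes from
  low-frequency parts: these are pairings with fixed functions and converge pointwise under weak
  convergence.\<close>

lemma L2_measurable [measurable_dest]: "u \<in> L2 \<Longrightarrow> u \<in> borel_measurable borel"
  by (simp add: L2_def)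

lemma L2_integrable: "u \<in> L2 \<Longrightarrow> integrable lborel (\<lambda>x. (norm (u x))\<^sup>2)"
  by (simp add: L2_def)

lemma L2I:
  assumes "u \<in> borel_measurable borel" "integrable lborel (\<lambda>x. (norm (u x))\<^sup>2)"
  shows "u \<in> L2"
  using assms by (simp add: L2_def)

lemma L2_bound:
  fixes u w :: "'a::euclidean_space \<Rightarrow> complex"
  assumes "w \<in> L2" "u \<in> borel_measurable borel" "\<And>x. norm (u x) \<le> norm (w x)"
  shows "u \<in> L2"
proof (rule L2I[OF assms(2)])
  show "integrable lborel (\<lambda>x. (norm (u x))\<^sup>2)"
    by (rule Bochner_Integration.integrable_bound[OF L2_integrable[OF assms(1)]])
       (use assms in \<open>auto intro!: power_mono\<close>)
qed

lemma norm_add_squared_le: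
  fixes a b :: "'b::real_normed_vector"
  shows "(norm (a + b))\<^sup>2 \<le> 2 * (norm a)\<^sup>2 + 2 * (norm b)\<^sup>2"
proof -
  have "(norm (a + b))\<^sup>2 \<le> (norm a + norm b)\<^sup>2"
    by (intro power_mono norm_triangle_ineq) auto
  also have "\<dots> \<le> 2 * (norm a)\<^sup>2 + 2 * (norm b)\<^sup>2"
    using sum_squares_bound[of "norm a" "norm b"] by (simp add: power2_sum)
  finally show ?thesis .
qed

lemma L2_add [intro]:
  assumes [measurable]: "u \<in> L2" "w \<in> L2"
  shows "(\<lambda>x. u x + w x) \<in> L2"
proof (rule L2I)
  show "integrable lborel (\<lambda>x. (norm (u x + w x))\<^sup>2)"
    by (rule Bochner_Integration.integrable_bound[where f="\<lambda>x. 2 * (norm (u x))\<^sup>2 + 2 * (norm (w x))\<^sup>2"])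
       (use assms norm_add_squared_le in \<open>auto simp: L2_integrable intro!: Bochner_Integration.integrable_add\<close>)
qed (measurable)

lemma L2_cmult [intro]:
  assumes [measurable]: "u \<in> L2"
  shows "(\<lambda>x. c * u x) \<in> L2"
  using assms by (intro L2I) (auto simp: L2_integrable norm_mult power_mult_distrib)

lemma L2_minus [intro]: "u \<in> L2 \<Longrightarrow> (\<lambda>x. - u x) \<in> L2"
  using L2_cmult[of u "-1"] by simp

lemma L2_diff [intro]:
  assumes "u \<in> L2" "w \<in> L2"
  shows "(\<lambda>x. u x - w x) \<in> L2"
  using L2_add[OF assms(1) L2_minus[OF assms(2)]] by simp

lemma L2_zero [intro, simp]: "(\<lambda>x. 0) \<in> L2"
  by (intro L2I) auto

lemma borel_measurable_cnj [measurable (raw)]: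
  assumes "f \<in> borel_measurable M"
  shows "(\<lambda>x. cnj (f x)) \<in> borel_measurable M"
  by (rule measurable_compose[OF assms borel_measurable_continuous_onI[OF continuous_on_cnj[OF continuous_on_id]]])

lemma borel_measurable_cis [measurable (raw)]:
  assumes "f \<in> borel_measurable M"
  shows "(\<lambda>x. cis (f x)) \<in> borel_measurable M"
  by (rule measurable_compose[OF assms borel_measurable_continuous_onI]) (auto simp: cis_conv_exp intro!: continuous_intros)

lemma L2_cnj [intro]: "u \<in> L2 \<Longrightarrow> (\<lambda>x. cnj (u x)) \<in> L2"
  by (rule L2_bound[of u]) (auto intro: L2_measurable borel_measurable_cnj)

lemma L2_indicator [intro]:
  assumes "u \<in> L2" and [measurable]: "S \<in> sets borel"
  shows "(\<lambda>x. indicator S x * u x) \<in> L2"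
proof (rule L2_bound[OF assms(1)])
  note assms(1)[THEN L2_measurable, measurable]
  show "(\<lambda>x. indicator S x * u x) \<in> borel_measurable borel" by measurable
qed (auto simp: indicator_def)

lemma L2_unimodular [intro]:
  assumes "u \<in> L2" and [measurable]: "\<theta> \<in> borel_measurable borel"
  shows "(\<lambda>x. cis (\<theta> x) * u x) \<in> L2"
proof (rule L2_bound[OF assms(1)])
  note assms(1)[THEN L2_measurable, measurable]
  show "(\<lambda>x. cis (\<theta> x) * u x) \<in> borel_measurable borel" by measurable
qed (auto simp: norm_mult)

lemma L2_norm_nonneg [simp]: "0 \<le> L2_norm u"
  by (simp add: L2_norm_def)

lemma L2_norm_squared: "(L2_norm u)\<^sup>2 = (LINT x|lborel. (norm (u x))\<^sup>2)"
  by (simp add: L2_norm_def)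

lemma L2_norm_zero [simp]: "L2_norm (\<lambda>x. 0) = 0"
  by (simp add: L2_norm_def)

lemma L2_norm_cmult: "L2_norm (\<lambda>x. c * u x) = norm c * L2_norm u"
  by (simp add: L2_norm_def norm_mult power_mult_distrib real_sqrt_mult)

lemma L2_norm_minus_commute: "L2_norm (\<lambda>x. u x - w x) = L2_norm (\<lambda>x. w x - u x)"
  by (simp add: L2_norm_def norm_minus_commute)

lemma L2_norm_cong_norm: "(\<And>x. norm (u x) = norm (w x)) \<Longrightarrow> L2_norm u = L2_norm w"
  by (simp add: L2_norm_def)

lemma L2_norm_eq_0_AE:
  assumes "u \<in> L2" "L2_norm u = 0"
  shows "AE x in lborel. u x = 0"
proof -
  have "(LINT x|lborel. (norm (u x))\<^sup>2) = 0"
    using assms(2) L2_norm_squared[of u] by simp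
  then show ?thesis
    using integral_nonneg_eq_0_iff_AE[OF L2_integrable[OF assms(1)]] by simp
qed

lemma L2_norm_cong_AE:
  assumes "AE x in lborel. u x = w x" and [measurable]: "u \<in> borel_measurable borel" "w \<in> borel_measurable borel"
  shows "L2_norm u = L2_norm w"
  unfolding L2_norm_def using assms(1)
  by (intro arg_cong[where f=sqrt] integral_cong_AE) auto

lemma L2_nn_integral:
  "u \<in> L2 \<Longrightarrow> (\<integral>\<^sup>+x. ennreal ((norm (u x))\<^sup>2) \<partial>lborel) = ennreal ((L2_norm u)\<^sup>2)"
  unfolding L2_norm_squared by (intro nn_integral_eq_integral L2_integrable) auto

lemma L2_norm_le_norm:
  assumes "w \<in> L2" "u \<in> borel_measurable borel" "\<And>x. norm (u x) \<le> norm (w x)"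
  shows "L2_norm u \<le> L2_norm w"
  unfolding L2_norm_def
  by (intro real_sqrt_le_mono integral_mono L2_integrable power_mono L2_bound[OF assms] assms) auto

lemma L2_mult_integrable:
  assumes "u \<in> L2" "w \<in> L2"
  shows "integrable lborel (\<lambda>x. u x * w x)"
proof -
  note assms[THEN L2_measurable, measurable]
  show ?thesis
  proof (rule Bochner_Integration.integrable_bound)
    show "integrable lborel (\<lambda>x. (norm (u x))\<^sup>2 + (norm (w x))\<^sup>2)"
      using assms by (auto simp: L2_integrable)
    have "norm (u x * w x) \<le> (norm (u x))\<^sup>2 + (norm (w x))\<^sup>2" for x
      using sum_squares_bound[of "norm (u x)" "norm (w x)"] mult_nonneg_nonneg[of "norm (u x)" "norm (w x)"]
      by (simp add: norm_mult del: mult_nonneg_nonneg)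
    then show "AE x in lborel. norm (u x * w x) \<le> norm ((norm (u x))\<^sup>2 + (norm (w x))\<^sup>2)"
      by simp
  qed measurable
qed

lemma L2_Cauchy_Schwarz_norm:
  fixes u w :: "'a::euclidean_space \<Rightarrow> complex"
  assumes "u \<in> L2" "w \<in> L2"
  shows "(LINT x|lborel. norm (u x) * norm (w x)) \<le> L2_norm u * L2_norm w"
proof -
  have int: "integrable lborel (\<lambda>x. norm (u x) * norm (w x))"
    using integrable_norm[OF L2_mult_integrable[OF assms]] by (simp add: norm_mult)
  show ?thesis
  proof (cases "L2_norm u = 0 \<or> L2_norm w = 0")
    case True
    then have "AE x in lborel. u x = 0 \<or> w x = 0"
      using L2_norm_eq_0_AE[of u] L2_norm_eq_0_AE[of w] assms by (auto intro: AE_disjI1 AE_disjI2)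
    then have "(LINT x|lborel. norm (u x) * norm (w x)) = (LINT x|(lborel::'a measure). 0)"
      using int by (intro integral_cong_AE) (auto simp: borel_measurable_integrable)
    then show ?thesis using True by auto
  next
    case False
    then have pos: "L2_norm u > 0" "L2_norm w > 0"
      using L2_norm_nonneg[of u] L2_norm_nonneg[of w] by linarith+
    \<comment> \<open>The weight for which both terms of 2ab \<le> t a^2 + b^2 / t have the same
      integral.\<close>
    define t where "t = L2_norm w / L2_norm u"
    have t: "t > 0" using pos by (simp add: t_def)
    have "2 * (norm (u x) * norm (w x)) \<le> t * (norm (u x))\<^sup>2 + (norm (w x))\<^sup>2 / t" for x
    proof -
      have "0 \<le> (t * norm (u x) - norm (w x))\<^sup>2 / t" using t by simp
      also have "\<dots> = t * (norm (u x))\<^sup>2 + (norm (w x))\<^sup>2 / t - 2 * (norm (u x) * norm (w x))"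
        using t by (simp add: power2_eq_square field_simps)
      finally show ?thesis by simp
    qed
    then have "(LINT x|lborel. 2 * (norm (u x) * norm (w x)))
        \<le> (LINT x|lborel. t * (norm (u x))\<^sup>2 + (norm (w x))\<^sup>2 / t)"
      using int assms
      by (intro integral_mono) (auto simp: L2_integrable intro!: Bochner_Integration.integrable_add)
    also have "\<dots> = t * (L2_norm u)\<^sup>2 + (L2_norm w)\<^sup>2 / t"
      using assms by (simp add: L2_integrable L2_norm_squared)
    also have "\<dots> = 2 * (L2_norm u * L2_norm w)"
      using pos by (simp add: t_def power2_eq_square field_simps)
    finally show ?thesis using int by simp
  qed
qed

lemma L2_Cauchy_Schwarz:
  assumes "u \<in> L2" "w \<in> L2"
  shows "norm (LINT x|lborel. u x * w x) \<le> L2_norm u * L2_norm w"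
  using integral_norm_bound[of lborel "\<lambda>x. u x * w x"] L2_Cauchy_Schwarz_norm[OF assms]
  by (simp add: norm_mult)

lemma L2_norm_triangle:
  assumes "u \<in> L2" "w \<in> L2"
  shows "L2_norm (\<lambda>x. u x + w x) \<le> L2_norm u + L2_norm w"
proof (rule power2_le_imp_le)
  have int: "integrable lborel (\<lambda>x. norm (u x) * norm (w x))"
    using integrable_norm[OF L2_mult_integrable[OF assms]] by (simp add: norm_mult)
  have "(L2_norm (\<lambda>x. u x + w x))\<^sup>2 \<le> (LINT x|lborel. (norm (u x))\<^sup>2 + 2 * (norm (u x) * norm (w x)) + (norm (w x))\<^sup>2)"
    unfolding L2_norm_squared
  proof (intro integral_mono)
    show "integrable lborel (\<lambda>x. (norm (u x + w x))\<^sup>2)"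
      by (rule L2_integrable[OF L2_add[OF assms]])
    fix x
    have "(norm (u x + w x))\<^sup>2 \<le> (norm (u x) + norm (w x))\<^sup>2"
      by (intro power_mono norm_triangle_ineq) auto
    then show "(norm (u x + w x))\<^sup>2 \<le> (norm (u x))\<^sup>2 + 2 * (norm (u x) * norm (w x)) + (norm (w x))\<^sup>2"
      by (simp add: power2_sum)
  qed (use assms int in \<open>auto simp: L2_integrable intro!: Bochner_Integration.integrable_add\<close>)
  also have "\<dots> = (L2_norm u)\<^sup>2 + 2 * (LINT x|lborel. norm (u x) * norm (w x)) + (L2_norm w)\<^sup>2"
    using assms int by (simp add: L2_integrable L2_norm_squared)
  also have "\<dots> \<le> (L2_norm u + L2_norm w)\<^sup>2"
    using L2_Cauchy_Schwarz_norm[OF assms] by (simp add: power2_sum)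
  finally show "(L2_norm (\<lambda>x. u x + w x))\<^sup>2 \<le> (L2_norm u + L2_norm w)\<^sup>2" .
qed simp

lemma L2_norm_triangle_diff:
  assumes "u \<in> L2" "w \<in> L2"
  shows "L2_norm (\<lambda>x. u x - w x) \<le> L2_norm u + L2_norm w"
  using L2_norm_triangle[OF assms(1) L2_minus[OF assms(2)]] L2_norm_cong_norm[of "\<lambda>x. - w x" w] by simp

lemma L2_norm_triangle2:
  assumes "u \<in> L2" "w \<in> L2" "y \<in> L2"
  shows "L2_norm (\<lambda>x. u x - w x) \<le> L2_norm (\<lambda>x. u x - y x) + L2_norm (\<lambda>x. y x - w x)"
  using L2_norm_triangle[OF L2_diff[OF assms(1,3)] L2_diff[OF assms(3,2)]] by simp

lemma L2_norm_triangle_reverse: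
  assumes "u \<in> L2" "w \<in> L2"
  shows "\<bar>L2_norm u - L2_norm w\<bar> \<le> L2_norm (\<lambda>x. u x - w x)"
  using L2_norm_triangle[OF L2_diff[OF assms] assms(2)] L2_norm_triangle[OF L2_diff[OF assms(2,1)] assms(1)]
    L2_norm_minus_commute[of u w] by simp

lemma tendsto_L2_norm:
  assumes u: "\<And>n. u n \<in> L2" and "g \<in> L2" and lim: "((\<lambda>n. L2_norm (\<lambda>x. u n x - g x)) \<longlongrightarrow> 0) F"
  shows "((\<lambda>n. L2_norm (u n)) \<longlongrightarrow> L2_norm g) F"
proof (rule Lim_transform2[OF tendsto_const])
  show "((\<lambda>n. L2_norm g - L2_norm (u n)) \<longlongrightarrow> 0) F"
    by (rule Lim_null_comparison[OF _ lim])
       (use L2_norm_triangle_reverse[OF u assms(2)] in \<open>auto simp: abs_minus_commute intro!: always_eventually\<close>)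
qed

lemma tendsto_L2_mult:
  assumes u: "\<And>n. u n \<in> L2" "g \<in> L2" and w: "\<And>n. w n \<in> L2" "h \<in> L2"
    and lu: "((\<lambda>n. L2_norm (\<lambda>x. u n x - g x)) \<longlongrightarrow> 0) F"
    and lw: "((\<lambda>n. L2_norm (\<lambda>x. w n x - h x)) \<longlongrightarrow> 0) F"
  shows "((\<lambda>n. LINT x|lborel. u n x * w n x) \<longlongrightarrow> (LINT x|lborel. g x * h x)) F"
proof -
  have "((\<lambda>n. (LINT x|lborel. u n x * w n x) - (LINT x|lborel. g x * h x)) \<longlongrightarrow> 0) F"
  proof (rule Lim_null_comparison)
    have "norm ((LINT x|lborel. u n x * w n x) - (LINT x|lborel. g x * h x))
       \<le> L2_norm (\<lambda>x. u n x - g x) * L2_norm (w n) + L2_norm g * L2_norm (\<lambda>x. w n x - h x)" for n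
    proof -
      have "(LINT x|lborel. u n x * w n x) - (LINT x|lborel. g x * h x) = 
         (LINT x|lborel. (u n x - g x) * w n x) + (LINT x|lborel. g x * (w n x - h x))"
        using u w by (simp add: L2_mult_integrable algebra_simps)
      then show ?thesis
        using L2_Cauchy_Schwarz[OF L2_diff[OF u(1) u(2)] w(1), of n n]
         L2_Cauchy_Schwarz[OF u(2) L2_diff[OF w(1) w(2)], of n] 
         norm_triangle_ineq[of "LINT x|lborel. (u n x - g x) * w n x" "LINT x|lborel. g x * (w n x - h x)"]
        by simp
    qed
    then show "\<forall>\<^sub>F n in F. norm ((LINT x|lborel. u n x * w n x) - (LINT x|lborel. g x * h x))
       \<le> L2_norm (\<lambda>x. u n x - g x) * L2_norm (w n) + L2_norm g * L2_norm (\<lambda>x. w n x - h x)"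
      by simp
    show "((\<lambda>n. L2_norm (\<lambda>x. u n x - g x) * L2_norm (w n) + L2_norm g * L2_norm (\<lambda>x. w n x - h x)) \<longlongrightarrow> 0) F"
      using tendsto_add[OF tendsto_mult[OF lu tendsto_L2_norm[OF w lw]] tendsto_mult[OF tendsto_const[of "L2_norm g"] lw]]
      by simp
  qed
  then show ?thesis by (simp add: LIM_zero_iff)
qed

text \<open>Square integrability has to come from the extended integral: a measurable function
  outside L^2 has \<open>L2_norm\<close> 0 by convention, so a bound on that number would say
  nothing.\<close>

lemma L2_norm_le_imp_integral_le:
  assumes "u \<in> borel_measurable borel"
   "(\<integral>\<^sup>+x. ennreal ((norm (u x))\<^sup>2) \<partial>lborel) \<le> ennreal (c\<^sup>2)" "0 \<le> c"
  shows "u \<in> L2" "L2_norm u \<le> c"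
proof -
  note assms(1)[measurable]
  show L: "u \<in> L2"
  proof (rule L2I[OF assms(1)], rule integrableI_bounded)
    show "(\<integral>\<^sup>+ x. ennreal (norm ((norm (u x))\<^sup>2)) \<partial>lborel) < \<infinity>"
      using assms(2) by (simp add: le_less_trans[OF _ ennreal_less_top])
  qed measurable
  show "L2_norm u \<le> c"
    using assms(2,3) L2_nn_integral[OF L] by (simp add: abs_le_square_iff[symmetric])
qed

text \<open>Riesz-Fischer: a rapidly Cauchy subsequence converges almost everywhere, and Fatou's
  lemma turns the pointwise limit into a limit in norm.\<close>

lemma L2_complete:
  fixes u :: "nat \<Rightarrow> 'a::euclidean_space \<Rightarrow> complex"
  assumes u: "\<And>n. u n \<in> L2"
    and C: "\<And>e. e > 0 \<Longrightarrow> \<exists>N. \<forall>m\<ge>N. \<forall>n\<ge>N. L2_norm (\<lambda>x. u m x - u n x) < e"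
  obtains g where "g \<in> L2" "(\<lambda>n. L2_norm (\<lambda>x. u n x - g x)) \<longlonglongrightarrow> 0"
proof -
  note u[THEN L2_measurable, measurable]
  \<comment> \<open>The rate 1/4 leaves room for the weight 2^k below: 2^k (1/4)^(2k) = (1/8)^k is
    still summable, and the weight forces pointwise increments of order 2^(-k/2).\<close>
  have "\<exists>N. \<forall>k. (\<forall>m\<ge>N k. \<forall>n\<ge>N k. L2_norm (\<lambda>x. u m x - u n x) < (1/4)^k) \<and> N k < N (Suc k)"
  proof (rule dependent_nat_choice)
    show "\<exists>N. \<forall>m\<ge>N. \<forall>n\<ge>N. L2_norm (\<lambda>x. u m x - u n x) < (1/4)^0"
      using C[of "1"] by simp
    fix N k 
    obtain M where M: "\<forall>m\<ge>M. \<forall>n\<ge>M. L2_norm (\<lambda>x. u m x - u n x) < (1/4)^Suc k"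
      using C[of "(1/4)^Suc k"] by auto
    then show "\<exists>M. (\<forall>m\<ge>M. \<forall>n\<ge>M. L2_norm (\<lambda>x. u m x - u n x) < (1/4)^Suc k) \<and> N < M"
      by (intro exI[of _ "max M (Suc N)"]) auto
  qed
  then obtain N where N: "\<And>k m n. m \<ge> N k \<Longrightarrow> n \<ge> N k \<Longrightarrow> L2_norm (\<lambda>x. u m x - u n x) < (1/4)^k"
    and mono: "strict_mono N"
    by (auto simp: strict_mono_Suc_iff)
  define w where "w k = u (N k)" for k
  have [measurable]: "w k \<in> borel_measurable borel" for k by (simp add: w_def)
  have wL: "w k \<in> L2" for k by (simp add: w_def u)
  have step: "(L2_norm (\<lambda>x. w (Suc k) x - w k x))\<^sup>2 \<le> ((1/4)^k)\<^sup>2" for k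
    unfolding w_def
    by (intro power_mono L2_norm_nonneg less_imp_le[OF N[of k "N (Suc k)" "N k"]])
      (use mono in \<open>auto simp: strict_mono_less_eq\<close>)
  have "(\<integral>\<^sup>+x. (\<Sum>k. ennreal (2^k * (norm (w (Suc k) x - w k x))\<^sup>2)) \<partial>lborel)
     = (\<Sum>k. \<integral>\<^sup>+x. ennreal (2^k * (norm (w (Suc k) x - w k x))\<^sup>2) \<partial>lborel)"
    by (rule nn_integral_suminf) measurable
  also have "\<dots> = (\<Sum>k. ennreal (2^k * (L2_norm (\<lambda>x. w (Suc k) x - w k x))\<^sup>2))"
    by (intro suminf_cong) (simp add: ennreal_mult nn_integral_cmult L2_nn_integral[OF L2_diff[OF wL wL]])
  also have "\<dots> \<le> (\<Sum>k. ennreal ((1/8)^k))"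
  proof (intro suminf_le summableI ennreal_leI)
    fix k show "2^k * (L2_norm (\<lambda>x. w (Suc k) x - w k x))\<^sup>2 \<le> (1/8)^k"
      using mult_left_mono[OF step[of k], of "2^k"]
      by (simp add: power_mult_distrib[symmetric] power2_eq_square)
  qed
  also have "\<dots> < top"
    by (subst suminf_ennreal2) (auto intro!: summable_geometric)
  finally have "AE x in lborel. (\<Sum>k. ennreal (2^k * (norm (w (Suc k) x - w k x))\<^sup>2)) \<noteq> \<infinity>"
    by (intro nn_integral_noteq_infinite) auto
  moreover have "convergent (\<lambda>k. w k x)" 
    if fin: "(\<Sum>k. ennreal (2^k * (norm (w (Suc k) x - w k x))\<^sup>2)) \<noteq> \<infinity>" for x
  proof -
    have "summable (\<lambda>k. 2^k * (norm (w (Suc k) x - w k x))\<^sup>2)"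
      by (rule summable_suminf_not_top) (use fin in auto)
    then have "(\<lambda>k. 2^k * (norm (w (Suc k) x - w k x))\<^sup>2) \<longlonglongrightarrow> 0" by (rule summable_LIMSEQ_zero)
    then have "Bseq (\<lambda>k. 2^k * (norm (w (Suc k) x - w k x))\<^sup>2)"
      by (intro convergent_imp_Bseq) (auto simp: convergent_def)
    then obtain K where K: "K > 0" "\<And>k. 2^k * (norm (w (Suc k) x - w k x))\<^sup>2 \<le> K"
      by (auto simp: Bseq_def)
    have "summable (\<lambda>k. w (Suc k) x - w k x)"
    proof (rule summable_comparison_test'[of "\<lambda>k. sqrt K * (sqrt (1/2))^k"])
      show "summable (\<lambda>k. sqrt K * (sqrt (1/2))^k)"
        by (intro summable_mult summable_geometric) (auto simp: real_sqrt_divide)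
      fix k :: nat
      have "(norm (w (Suc k) x - w k x))\<^sup>2 \<le> K * (1/2)^k"
        using K(2)[of k] by (simp add: field_simps)
      then have "norm (w (Suc k) x - w k x) \<le> sqrt (K * (1/2)^k)"
        by (simp add: real_le_rsqrt)
      then show "norm (w (Suc k) x - w k x) \<le> sqrt K * (sqrt (1/2))^k"
        by (simp add: real_sqrt_mult real_sqrt_power)
    qed
    then have "convergent (\<lambda>n. \<Sum>k<n. w (Suc k) x - w k x)"
      by (simp add: summable_iff_convergent)
    then have "convergent (\<lambda>n. w n x - w 0 x)"
      by (simp add: sum_lessThan_telescope[of "\<lambda>k. w k x"])
    from convergent_add[OF this convergent_const[of "w 0 x"]] show ?thesis by simp
  qed
  ultimately have conv: "AE x in lborel. convergent (\<lambda>k. w k x)" by auto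
  \<comment> \<open>Where the subsequence diverges, \<open>lim\<close> has no meaning; this happens
    only on a null set.\<close>
  define g where "g x = lim (\<lambda>k. w k x)" for x
  have [measurable]: "g \<in> borel_measurable borel" unfolding g_def by measurable
  have key: "L2_norm (\<lambda>x. w k x - g x) \<le> (1/4)^k" "(\<lambda>x. w k x - g x) \<in> L2" for k
  proof -
    have "(\<integral>\<^sup>+x. ennreal ((norm (w k x - g x))\<^sup>2) \<partial>lborel) 
       = (\<integral>\<^sup>+x. liminf (\<lambda>n. ennreal ((norm (w k x - w n x))\<^sup>2)) \<partial>lborel)"
    proof (intro nn_integral_cong_AE, use conv in eventually_elim)
      fix x assume "convergent (\<lambda>k. w k x)"
      then have "(\<lambda>n. w n x) \<longlonglongrightarrow> g x" unfolding g_def by (simp add: convergent_LIMSEQ_iff)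
      then have "(\<lambda>n. ennreal ((norm (w k x - w n x))\<^sup>2)) \<longlonglongrightarrow> ennreal ((norm (w k x - g x))\<^sup>2)"
        by (intro tendsto_intros tendsto_ennrealI)
      then show "ennreal ((norm (w k x - g x))\<^sup>2) = liminf (\<lambda>n. ennreal ((norm (w k x - w n x))\<^sup>2))"
        using lim_imp_Liminf[OF sequentially_bot] by metis
    qed
    also have "\<dots> \<le> liminf (\<lambda>n. \<integral>\<^sup>+x. ennreal ((norm (w k x - w n x))\<^sup>2) \<partial>lborel)"
      by (rule nn_integral_liminf) measurable
    also have "\<dots> \<le> ennreal (((1/4)^k)\<^sup>2)"
    proof (rule Liminf_le)
      show "\<forall>\<^sub>F n in sequentially. (\<integral>\<^sup>+x. ennreal ((norm (w k x - w n x))\<^sup>2) \<partial>lborel) \<le> ennreal (((1/4)^k)\<^sup>2)"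
        unfolding L2_nn_integral[OF L2_diff[OF wL wL]]
      proof (intro eventually_sequentiallyI[of k] ennreal_leI power_mono L2_norm_nonneg)
        fix n assume "k \<le> n"
        then show "L2_norm (\<lambda>x. w k x - w n x) \<le> (1/4)^k"
          unfolding w_def using mono
          by (intro less_imp_le[OF N[of k "N k" "N n"]]) (auto simp: strict_mono_less_eq)
      qed
    qed simp
    finally have *: "(\<integral>\<^sup>+x. ennreal ((norm (w k x - g x))\<^sup>2) \<partial>lborel) \<le> ennreal (((1/4)^k)\<^sup>2)" .
    show "L2_norm (\<lambda>x. w k x - g x) \<le> (1/4)^k" "(\<lambda>x. w k x - g x) \<in> L2"
      by (rule L2_norm_le_imp_integral_le[OF _ *], simp_all)+
  qed
  have "(\<lambda>x. w 0 x - (w 0 x - g x)) \<in> L2"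
    by (rule L2_diff[OF wL key(2)])
  then have g: "g \<in> L2" by simp
  have "(\<lambda>n. L2_norm (\<lambda>x. u n x - g x)) \<longlonglongrightarrow> 0"
  proof (rule LIMSEQ_I, simp)
    fix e :: real assume "e > 0"
    then obtain k where k: "(1/4::real)^k < e / 2" using real_arch_pow_inv[of "e/2" "1/4"] by auto
    show "\<exists>M. \<forall>n\<ge>M. L2_norm (\<lambda>x. u n x - g x) < e"
    proof (intro exI[of _ "N k"] allI impI)
      fix n assume "n \<ge> N k"
      have "L2_norm (\<lambda>x. u n x - g x) \<le> L2_norm (\<lambda>x. u n x - w k x) + L2_norm (\<lambda>x. w k x - g x)"
        by (rule L2_norm_triangle2[OF u g wL])
      also have "\<dots> < e" using N[of k n "N k"] key(1)[of k] \<open>n \<ge> N k\<close> k by (simp add: w_def)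
      finally show "L2_norm (\<lambda>x. u n x - g x) < e" .
    qed
  qed
  then show ?thesis using that g by blast
qed

section \<open>Affine changes of variables\<close>

lemma nn_integral_affine:
  fixes t :: "'a::euclidean_space"
  assumes [measurable]: "f \<in> borel_measurable borel" and c: "c \<noteq> 0"
  shows "(\<integral>\<^sup>+x. f x \<partial>lborel) = ennreal (\<bar>c\<bar>^DIM('a)) * (\<integral>\<^sup>+x. f (t + c *\<^sub>R x) \<partial>lborel)"
  by (subst lborel_affine[OF c, of t])
     (simp add: nn_integral_density nn_integral_distr nn_integral_cmult)

lemma integrable_affine:
  fixes f :: "'a::euclidean_space \<Rightarrow> 'b::{banach, second_countable_topology}"
  assumes f: "integrable lborel f" and c: "c \<noteq> 0"
  shows "integrable lborel (\<lambda>x. f (t + c *\<^sub>R x))"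
proof -
  have [measurable]: "f \<in> borel_measurable borel" using f by auto
  have "(\<integral>\<^sup>+x. norm (f x) \<partial>lborel) < \<infinity>" using f by (simp add: integrable_iff_bounded)
  then have "(\<integral>\<^sup>+x. norm (f (t + c *\<^sub>R x)) \<partial>lborel) < \<infinity>"
    using c by (subst (asm) nn_integral_affine[where c=c and t=t]) (auto simp: ennreal_mult_less_top)
  then show ?thesis by (simp add: integrable_iff_bounded)
qed

lemma integral_affine:
  fixes f :: "'a::euclidean_space \<Rightarrow> 'b::{banach, second_countable_topology}"
  assumes c: "c \<noteq> 0"
  shows "(LINT x|lborel. f x) = \<bar>c\<bar>^DIM('a) *\<^sub>R (LINT x|lborel. f (t + c *\<^sub>R x))"
proof cases
  assume f[measurable]: "integrable lborel f" then show ?thesis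
    using c f f[THEN borel_measurable_integrable] f[THEN integrable_affine, of c t]
    by (subst lborel_affine[OF c, of t])
       (simp add: integral_density integral_distr)
next
  \<comment> \<open>Here both sides are 0 by convention, once the inverse substitution shows that
    the transformed function is not integrable either.\<close>
  assume n: "\<not> integrable lborel f"
  have "\<not> integrable lborel (\<lambda>x. f (t + c *\<^sub>R x))"
  proof
    assume "integrable lborel (\<lambda>x. f (t + c *\<^sub>R x))"
    from integrable_affine[OF this, of "1/c" "- (1/c) *\<^sub>R t"] have "integrable lborel f"
      using c by (simp add: algebra_simps)
    with n show False by simp
  qed
  then show ?thesis using n by (simp add: not_integrable_integral_eq)
qed

lemma integral_translate:
  fixes f :: "'a::euclidean_space \<Rightarrow> 'b::{banach, second_countable_topology}"
  shows "(LINT x|lborel. f (x + t)) = (LINT x|lborel. f x)"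
  using integral_affine[of 1 f t] by (simp add: add.commute)

lemma integral_reflect:
  fixes f :: "'a::euclidean_space \<Rightarrow> 'b::{banach, second_countable_topology}"
  shows "(LINT x|lborel. f (- x)) = (LINT x|lborel. f x)"
  using integral_affine[of "-1" f 0] by simp

lemma L2_affine [intro]:
  assumes "u \<in> L2" "c \<noteq> 0"
  shows "(\<lambda>x. u (t + c *\<^sub>R x)) \<in> L2"
proof (rule L2I)
  note assms(1)[THEN L2_measurable, measurable]
  show "(\<lambda>x. u (t + c *\<^sub>R x)) \<in> borel_measurable borel" by measurable
qed (use integrable_affine[OF L2_integrable[OF assms(1)] assms(2)] in simp)

lemma L2_translate [intro]: "u \<in> L2 \<Longrightarrow> (\<lambda>x. u (x + t)) \<in> L2"
  using L2_affine[of u 1 t] by (simp add: add.commute)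

lemma L2_reflect [intro]: "u \<in> L2 \<Longrightarrow> (\<lambda>x. u (- x)) \<in> L2"
  using L2_affine[of u "-1" 0] by simp

lemma L2_norm_translate: "L2_norm (\<lambda>x. u (x + t)) = L2_norm u"
  using integral_translate[of "\<lambda>x. (norm (u x))\<^sup>2" t] by (simp add: L2_norm_def)

lemma L2_norm_reflect: "L2_norm (\<lambda>x. u (- x)) = L2_norm u"
  using integral_reflect[of "\<lambda>x. (norm (u x))\<^sup>2"] by (simp add: L2_norm_def)

section \<open>Continuity of translations\<close>

text \<open>For open \<open>U\<close> the integrand is \<open>2 1\<^sub>U(x) (1 - 1\<^sub>U(x + h))\<close> up to a function with integral zero, and this
  vanishes pointwise as \<open>h\<close> tends to zero.\<close>

lemma tendsto_L1_translate_open: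
  fixes U :: "'a::euclidean_space set"
  assumes U: "open U" "emeasure lborel U < \<infinity>" and h: "h \<longlonglongrightarrow> 0"
  shows "(\<lambda>n. LINT x|lborel. \<bar>indicator U (x + h n) - indicator U x :: real\<bar>) \<longlonglongrightarrow> 0"
proof -
  have [measurable]: "U \<in> sets borel" using U by auto
  have iU: "integrable lborel (indicator U :: 'a \<Rightarrow> real)" using U by (intro integrable_real_indicator) auto
  have iUh: "integrable lborel (\<lambda>x. indicator U (x + t) :: real)" for t
    using integrable_affine[OF iU, of 1 t] by (simp add: add.commute)
  have iP: "integrable lborel (\<lambda>x. indicator U x * (1 - indicator U (x + t)) :: real)" for t
    by (rule Bochner_Integration.integrable_bound[OF iU]) (auto simp: indicator_def)
  have "(LINT x|lborel. \<bar>indicator U (x + h n) - indicator U x :: real\<bar>)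
     = 2 * (LINT x|lborel. indicator U x * (1 - indicator U (x + h n)))" for n
  proof -
    have "(LINT x|lborel. \<bar>indicator U (x + h n) - indicator U x :: real\<bar>)
      = (LINT x|lborel. indicator U (x + h n) - indicator U x + 2 * (indicator U x * (1 - indicator U (x + h n))))"
      by (intro Bochner_Integration.integral_cong) (auto simp: indicator_def)
    also have "\<dots> = 2 * (LINT x|lborel. indicator U x * (1 - indicator U (x + h n)))"
      using iU iUh iP integral_translate[of "indicator U :: 'a \<Rightarrow> real" "h n"]
      by simp
    finally show ?thesis .
  qed
  moreover have "(\<lambda>n. LINT x|lborel. indicator U x * (1 - indicator U (x + h n)) :: real) \<longlonglongrightarrow> (LINT x|(lborel::'a measure). 0)"
  proof (rule integral_dominated_convergence[where w="indicator U"])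
    show "AE x in lborel. (\<lambda>n. indicator U x * (1 - indicator U (x + h n)) :: real) \<longlonglongrightarrow> 0"
    proof (rule AE_I2)
      fix x :: 'a
      show "(\<lambda>n. indicator U x * (1 - indicator U (x + h n)) :: real) \<longlonglongrightarrow> 0"
      proof (cases "x \<in> U")
        case True
        have "(\<lambda>n. x + h n) \<longlonglongrightarrow> x" using tendsto_add[OF tendsto_const[of x] h] by simp
        then have "\<forall>\<^sub>F n in sequentially. x + h n \<in> U"
          using True U(1) by (intro topological_tendstoD)
        then show ?thesis
          by (intro tendsto_eventually, rule eventually_mono) (use True in simp)
      qed simp
    qed
  qed (use iU in \<open>auto simp: indicator_def\<close>)
  ultimately show ?thesis
    using tendsto_mult[OF tendsto_const[of "2::real"]] by fastforce
qed

text \<open>Translations are isometries of L^1, so the functions on which they act continuously form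
  a closed set: a three-epsilon argument.\<close>

lemma tendsto_L1_translate_approx:
  fixes f :: "'a::euclidean_space \<Rightarrow> complex"
  assumes f: "integrable lborel f"
    and a: "\<And>e. e > 0 \<Longrightarrow> \<exists>g. integrable lborel g \<and> (LINT x|lborel. norm (g x - f x)) < e \<and>
       (\<lambda>n. LINT x|lborel. norm (g (x + h n) - g x)) \<longlonglongrightarrow> 0"
  shows "(\<lambda>n. LINT x|lborel. norm (f (x + h n) - f x)) \<longlonglongrightarrow> 0"
proof (rule LIMSEQ_I, simp)
  fix e :: real assume "e > 0"
  then obtain g where g: "integrable lborel g" "(LINT x|lborel. norm (g x - f x)) < e/3"
    "(\<lambda>n. LINT x|lborel. norm (g (x + h n) - g x)) \<longlonglongrightarrow> 0"
    using a[of "e/3"] by auto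
  then obtain N where N: "\<And>n. n \<ge> N \<Longrightarrow> (LINT x|lborel. norm (g (x + h n) - g x)) < e/3"
    using LIMSEQ_D[OF g(3), of "e/3"] \<open>e > 0\<close> by auto
  have ft: "integrable lborel (\<lambda>x. f (x + t))" for t using integrable_affine[OF f, of 1 t] by (simp add: add.commute)
  have gt: "integrable lborel (\<lambda>x. g (x + t))" for t using integrable_affine[OF g(1), of 1 t] by (simp add: add.commute)
  show "\<exists>N. \<forall>n\<ge>N. (LINT x|lborel. norm (f (x + h n) - f x)) < e"
  proof (intro exI[of _ N] allI impI)
    fix n assume "N \<le> n"
    have "(LINT x|lborel. norm (f (x + h n) - f x)) \<le>
       (LINT x|lborel. norm (g (x + h n) - f (x + h n)) + norm (g (x + h n) - g x) + norm (g x - f x))"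
    proof (intro integral_mono)
      fix x
      show "norm (f (x + h n) - f x) \<le> norm (g (x + h n) - f (x + h n)) + norm (g (x + h n) - g x) + norm (g x - f x)"
        by norm
    qed (use f g ft gt in auto)
    also have "\<dots> = (LINT x|lborel. norm (g x - f x)) + (LINT x|lborel. norm (g (x + h n) - g x)) + (LINT x|lborel. norm (g x - f x))"
      using f g ft gt integral_translate[of "\<lambda>x. norm (g x - f x)" "h n"] by simp
    also have "\<dots> < e" using g(2) N[OF \<open>N \<le> n\<close>] by simp
    finally show "(LINT x|lborel. norm (f (x + h n) - f x)) < e" .
  qed
qed

text \<open>Induction over integrable functions. For an indicator, outer regularity encloses the set
  in an open one of almost the same measure.\<close>

lemma tendsto_L1_translate:
  fixes f :: "'a::euclidean_space \<Rightarrow> complex"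
  assumes f: "integrable lborel f" and h: "h \<longlonglongrightarrow> 0"
  shows "(\<lambda>n. LINT x|lborel. norm (f (x + h n) - f x)) \<longlonglongrightarrow> 0"
  using f
proof (induction rule: integrable_induct)
  case (base A c)
  then have [measurable]: "A \<in> sets borel" by simp
  have iA: "integrable lborel (indicator A :: 'a \<Rightarrow> real)"
    using base by (intro integrable_real_indicator) auto
  show ?case
  proof (rule tendsto_L1_translate_approx)
    show "integrable lborel (\<lambda>x. indicator A x *\<^sub>R c)" using iA by simp
    fix e :: real assume "e > 0"
    \<comment> \<open>The summand 1 covers the case \<open>c = 0\<close>.\<close>
    define e' where "e' = e / (norm c + 1)"
    have e': "e' > 0" using \<open>e > 0\<close> by (simp add: e'_def add_nonneg_pos)
    obtain U where U: "open U" "A \<subseteq> U" "emeasure lborel (U - A) < ennreal e'"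
      using outer_regular_lborel[of A e'] e' by auto
    have [measurable]: "U \<in> sets borel" using U by auto
    have "emeasure lborel U = emeasure lborel A + emeasure lborel (U - A)"
      using U by (subst plus_emeasure) (auto simp: Un_absorb1)
    also have "\<dots> < \<infinity>" using base U(3) by (auto simp: less_top[symmetric] intro: less_trans)
    finally have Ufin: "emeasure lborel U < \<infinity>" .
    have iU: "integrable lborel (indicator U :: 'a \<Rightarrow> real)" using Ufin by (intro integrable_real_indicator) auto
    have "(LINT x|lborel. norm (indicator U x *\<^sub>R c - indicator A x *\<^sub>R c)) = (LINT x|lborel. indicator (U - A) x * norm c)"
      using U(2) by (intro Bochner_Integration.integral_cong) (auto simp: indicator_def)
    also have "\<dots> = measure lborel (U - A) * norm c" by simp
    also have "\<dots> \<le> e' * norm c"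
    proof (intro mult_right_mono norm_ge_zero)
      show "measure lborel (U - A) \<le> e'"
        unfolding measure_def using U(3) e' by (intro enn2real_leI) auto
    qed
    also have "\<dots> < e' * (norm c + 1)" using e' by simp
    also have "\<dots> = e" using norm_ge_zero[of c] by (simp add: e'_def add_nonneg_eq_0_iff)
    finally have 1: "(LINT x|lborel. norm (indicator U x *\<^sub>R c - indicator A x *\<^sub>R c)) < e" .
    have "(\<lambda>n. norm c * (LINT x|lborel. \<bar>indicator U (x + h n) - indicator U x :: real\<bar>)) \<longlonglongrightarrow> norm c * 0"
      by (intro tendsto_intros tendsto_L1_translate_open U Ufin h)
    moreover have "norm (indicator U (x + h n) *\<^sub>R c - indicator U x *\<^sub>R c) = norm c * \<bar>indicator U (x + h n) - indicator U x :: real\<bar>" for x n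
      by (auto simp: indicator_def)
    ultimately have "(\<lambda>n. LINT x|lborel. norm (indicator U (x + h n) *\<^sub>R c - indicator U x *\<^sub>R c)) \<longlonglongrightarrow> 0"
      by simp
    then show "\<exists>g. integrable lborel g \<and> (LINT x|lborel. norm (g x - indicator A x *\<^sub>R c)) < e \<and>
       (\<lambda>n. LINT x|lborel. norm (g (x + h n) - g x)) \<longlonglongrightarrow> 0"
      using 1 iU by (intro exI[of _ "\<lambda>x. indicator U x *\<^sub>R c"]) auto
  qed
next
  case (add f g)
  have ft: "integrable lborel (\<lambda>x. f (x + t))" for t using integrable_affine[OF add.hyps(1), of 1 t] by (simp add: add.commute)
  have gt: "integrable lborel (\<lambda>x. g (x + t))" for t using integrable_affine[OF add.hyps(2), of 1 t] by (simp add: add.commute)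
  show ?case
  proof (rule Lim_null_comparison[OF _ tendsto_add_zero[OF add.IH]], intro always_eventually allI)
    fix n
    have "(LINT x|lborel. norm (f (x + h n) + g (x + h n) - (f x + g x))) \<le> (LINT x|lborel. norm (f (x + h n) - f x) + norm (g (x + h n) - g x))"
    proof (intro integral_mono)
      fix x
      show "norm (f (x + h n) + g (x + h n) - (f x + g x)) \<le> norm (f (x + h n) - f x) + norm (g (x + h n) - g x)"
        by norm
    qed (use add ft gt in auto)
    also have "\<dots> = (LINT x|lborel. norm (f (x + h n) - f x)) + (LINT x|lborel. norm (g (x + h n) - g x))"
      using add ft gt by simp
    finally show "norm (LINT x|lborel. norm (f (x + h n) + g (x + h n) - (f x + g x))) \<le> (LINT x|lborel. norm (f (x + h n) - f x)) + (LINT x|lborel. norm (g (x + h n) - g x))"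
      by simp
  qed
next
  case (lim f s)
  have [measurable]: "f \<in> borel_measurable borel" "s i \<in> borel_measurable borel" for i
    using borel_measurable_integrable[OF lim.hyps(1)] borel_measurable_integrable[OF lim.hyps(4)] by auto
  have "(\<lambda>i. LINT x|lborel. norm (s i x - f x)) \<longlonglongrightarrow> (LINT x|(lborel::'a measure). norm (0::complex))"
  proof (rule integral_dominated_convergence[where w="\<lambda>x. 3 * norm (f x)"])
    show "AE x in lborel. (\<lambda>i. norm (s i x - f x)) \<longlonglongrightarrow> norm (0::complex)"
      using lim.hyps(2) by (intro AE_I2 tendsto_norm) (simp add: LIM_zero)
    show "AE x in lborel. norm (norm (s i x - f x)) \<le> 3 * norm (f x)" for i
      using lim.hyps(3)[of _ i] by (intro AE_I2) (simp, smt (verit) norm_triangle_ineq4)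
  qed (use lim.hyps(4) in auto)
  then have L: "(\<lambda>i. LINT x|lborel. norm (s i x - f x)) \<longlonglongrightarrow> 0" by simp
  show ?case
  proof (rule tendsto_L1_translate_approx[OF lim.hyps(4)])
    fix e :: real assume "e > 0"
    then obtain i where "(LINT x|lborel. norm (s i x - f x)) < e"
      using LIMSEQ_D[OF L, of e] by auto
    then show "\<exists>g. integrable lborel g \<and> (LINT x|lborel. norm (g x - f x)) < e \<and>
       (\<lambda>n. LINT x|lborel. norm (g (x + h n) - g x)) \<longlonglongrightarrow> 0"
      using lim.hyps(1) lim.IH by blast
  qed
qed

lemma tendsto_L2_cball:
  fixes u :: "'a::euclidean_space \<Rightarrow> complex"
  assumes u: "u \<in> L2"
  shows "((\<lambda>R::real. L2_norm (\<lambda>x. indicator (cball 0 R) x * u x - u x)) \<longlongrightarrow> 0) at_top"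
proof -
  note u[THEN L2_measurable, measurable]
  have "((\<lambda>R::real. LINT x|lborel. (norm (indicator (cball 0 R) x * u x - u x))\<^sup>2) \<longlongrightarrow> (LINT x|(lborel::'a measure). 0)) at_top"
  proof (rule integral_dominated_convergence_at_top[where w="\<lambda>x. (norm (u x))\<^sup>2"])
    show "AE x in lborel. ((\<lambda>R. (norm (indicator (cball 0 R) x * u x - u x))\<^sup>2) \<longlongrightarrow> 0) at_top"
    proof (rule AE_I2)
      fix x
      show "((\<lambda>R. (norm (indicator (cball 0 R) x * u x - u x))\<^sup>2) \<longlongrightarrow> 0) at_top"
        by (rule tendsto_eventually, rule eventually_mono[OF eventually_ge_at_top[of "norm x"]]) auto
    qed
    show "\<forall>\<^sub>F R in at_top. AE x in lborel. norm ((norm (indicator (cball 0 R) x * u x - u x))\<^sup>2) \<le> (norm (u x))\<^sup>2"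
      by (intro always_eventually allI AE_I2) (auto simp: indicator_def)
    show "(\<lambda>x. (norm (indicator (cball 0 R) x * u x - u x))\<^sup>2) \<in> borel_measurable lborel" for R
      using L2_measurable[OF L2_diff[OF L2_indicator[OF u] u], of "cball 0 R"]
      by (intro borel_measurable_power borel_measurable_norm) simp
  qed (use u in \<open>auto simp: L2_integrable\<close>)
  from tendsto_real_sqrt[OF this] show ?thesis unfolding L2_norm_def by simp
qed

lemma integrable_indicator_cball:
  "integrable lborel (indicator (cball a R) :: 'a::euclidean_space \<Rightarrow> real)"
  using emeasure_lborel_cball_finite[of a R] by (intro integrable_real_indicator) (auto simp: less_top)

lemma L2_indicator_cball: "(\<lambda>x. indicator (cball a R) x :: complex) \<in> L2"
proof (rule L2I)
  show "(\<lambda>x. indicator (cball a R) x :: complex) \<in> borel_measurable borel"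
    by (rule borel_measurable_indicator) auto
  show "integrable lborel (\<lambda>x. (norm (indicator (cball a R) x :: complex))\<^sup>2)"
    by (rule Bochner_Integration.integrable_cong[THEN iffD1, OF refl _ integrable_indicator_cball])
      (auto simp: indicator_def)
qed

lemma L2_cball_integrable:
  fixes u :: "'a::euclidean_space \<Rightarrow> complex"
  assumes u: "u \<in> L2"
  shows "integrable lborel (\<lambda>x. indicator (cball 0 R) x * u x)"
  by (rule L2_mult_integrable[OF L2_indicator_cball u])

text \<open>For a function bounded by k, |w(x + h) - w(x)|^2 is at most 2k |w(x + h) - w(x)|, which
  reduces the claim to L^1. Cutting in space and in height approximates \<open>u\<close> by such
  functions.\<close>

lemma tendsto_L2_translate:
  fixes u :: "'a::euclidean_space \<Rightarrow> complex"
  assumes u: "u \<in> L2" and h: "h \<longlonglongrightarrow> 0"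
  shows "(\<lambda>n. L2_norm (\<lambda>x. u (x + h n) - u x)) \<longlonglongrightarrow> 0"
proof (rule LIMSEQ_I, simp)
  fix e :: real assume e: "e > 0"
  note u[THEN L2_measurable, measurable]
  define w where "w k x = indicator (cball 0 (real k) \<inter> {x. norm (u x) \<le> real k}) x * u x" for k x
  have wL: "w k \<in> L2" for k unfolding w_def by (rule L2_indicator[OF u]) measurable
  note wL[THEN L2_measurable, measurable]
  have "(\<lambda>k. LINT x|lborel. (norm (w k x - u x))\<^sup>2) \<longlonglongrightarrow> (LINT x|(lborel::'a measure). 0)"
  proof (rule integral_dominated_convergence[where w="\<lambda>x. (norm (u x))\<^sup>2"])
    show "AE x in lborel. (\<lambda>k. (norm (w k x - u x))\<^sup>2) \<longlonglongrightarrow> 0"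
    proof (rule AE_I2)
      fix x
      obtain K where K: "norm x \<le> real K" "norm (u x) \<le> real K"
        using real_arch_simple[of "max (norm x) (norm (u x))"] by auto
      show "(\<lambda>k. (norm (w k x - u x))\<^sup>2) \<longlonglongrightarrow> 0"
        by (rule tendsto_eventually, rule eventually_sequentiallyI[of K]) (use K in \<open>auto simp: w_def\<close>)
    qed
  qed (use u in \<open>auto simp: L2_integrable w_def indicator_def\<close>)
  from tendsto_real_sqrt[OF this] have "(\<lambda>k. L2_norm (\<lambda>x. w k x - u x)) \<longlonglongrightarrow> 0" unfolding L2_norm_def by simp
  then obtain k where k: "L2_norm (\<lambda>x. w k x - u x) < e / 3" using LIMSEQ_D[of "\<lambda>k. L2_norm (\<lambda>x. w k x - u x)" 0 "e/3"] e by auto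
  have wi: "integrable lborel (w k)"
    by (rule Bochner_Integration.integrable_bound[OF L2_cball_integrable[OF u, of "real k"]])
      (auto simp: w_def indicator_def)
  have wb: "norm (w k x) \<le> real k" for x by (auto simp: w_def indicator_def)
  have wt: "integrable lborel (\<lambda>x. w k (x + t))" for t using integrable_affine[OF wi, of 1 t] by (simp add: add.commute)
  have "(\<lambda>n. sqrt (2 * real k * (LINT x|lborel. norm (w k (x + h n) - w k x)))) \<longlonglongrightarrow> sqrt (2 * real k * 0)"
    by (intro tendsto_intros tendsto_L1_translate[OF wi h])
  then obtain N where N: "\<And>n. n \<ge> N \<Longrightarrow> sqrt (2 * real k * (LINT x|lborel. norm (w k (x + h n) - w k x))) < e/3"
    using LIMSEQ_D[of _ 0 "e/3"] e by fastforce
  show "\<exists>N. \<forall>n\<ge>N. L2_norm (\<lambda>x. u (x + h n) - u x) < e"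
  proof (intro exI[of _ N] allI impI)
    fix n assume n: "N \<le> n"
    have "L2_norm (\<lambda>x. w k (x + h n) - w k x) \<le> sqrt (2 * real k * (LINT x|lborel. norm (w k (x + h n) - w k x)))"
      unfolding L2_norm_def
    proof (rule real_sqrt_le_mono)
      have "(LINT x|lborel. (norm (w k (x + h n) - w k x))\<^sup>2) \<le> (LINT x|lborel. 2 * real k * norm (w k (x + h n) - w k x))"
      proof (intro integral_mono L2_integrable L2_diff L2_translate wL)
        fix x
        have "norm (w k (x + h n) - w k x) \<le> 2 * real k"
          using wb[of x] wb[of "x + h n"] norm_triangle_ineq4[of "w k (x + h n)" "w k x"] by linarith
        from mult_right_mono[OF this norm_ge_zero] 
        show "(norm (w k (x + h n) - w k x))\<^sup>2 \<le> 2 * real k * norm (w k (x + h n) - w k x)" 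
          by (simp add: power2_eq_square)
      qed (use wi wt in auto)
      then show "(LINT x|lborel. (norm (w k (x + h n) - w k x))\<^sup>2) \<le> 2 * real k * (LINT x|lborel. norm (w k (x + h n) - w k x))" 
        by simp
    qed
    also have "\<dots> < e/3" using N[OF n] .
    finally have 1: "L2_norm (\<lambda>x. w k (x + h n) - w k x) < e/3" .
    have "L2_norm (\<lambda>x. u (x + h n) - u x) \<le> L2_norm (\<lambda>x. u (x + h n) - w k (x + h n)) + L2_norm (\<lambda>x. w k (x + h n) - u x)"
      by (intro L2_norm_triangle2 L2_translate u wL)
    also have "L2_norm (\<lambda>x. w k (x + h n) - u x) \<le> L2_norm (\<lambda>x. w k (x + h n) - w k x) + L2_norm (\<lambda>x. w k x - u x)"
      by (intro L2_norm_triangle2 L2_translate u wL)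
    also have "L2_norm (\<lambda>x. u (x + h n) - w k (x + h n)) = L2_norm (\<lambda>x. w k x - u x)"
      using L2_norm_translate[of "\<lambda>x. u x - w k x" "h n"] L2_norm_minus_commute[of u "w k"] by simp
    finally show "L2_norm (\<lambda>x. u (x + h n) - u x) < e" using 1 k by simp
  qed
qed

section \<open>Plancherel's theorem\<close>

text \<open>A rescaling of the characteristic function of the standard normal distribution.\<close>

lemma gaussian_transform_real:
  fixes a t :: real
  assumes a: "a > 0"
  shows "integrable lborel (\<lambda>x. exp (- a * x\<^sup>2 / 2))"
    and "(LINT x|lborel. cis (- (t * x)) * of_real (exp (- a * x\<^sup>2 / 2))) = of_real (sqrt (2 * pi / a) * exp (- t\<^sup>2 / (2 * a)))"
proof -
  have nd: "std_normal_density x = (1 / sqrt (2 * pi)) * exp (- x\<^sup>2 / 2)" for x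
    by (simp add: std_normal_density_def)
  have i0: "integrable lborel (\<lambda>x. sqrt (2 * pi) * std_normal_density x)"
    by (intro integrable_mult_right integrable_normal_density) auto
  have eq: "exp (- (sqrt a * x)\<^sup>2 / 2) = exp (- a * x\<^sup>2 / 2)" for x using a by (simp add: power_mult_distrib)
  have "integrable lborel (\<lambda>x::real. exp (- x\<^sup>2 / 2))"
    using i0 by (simp add: nd)
  from lborel_integrable_real_affine[OF this, of "sqrt a" 0] a
  show "integrable lborel (\<lambda>x. exp (- a * x\<^sup>2 / 2))" by (simp add: power_mult_distrib)
  have base: "(LINT x|lborel. cis (s * x) * of_real (exp (- x\<^sup>2 / 2))) = of_real (sqrt (2 * pi) * exp (- s\<^sup>2 / 2))" for s
  proof -
    have "of_real (exp (- s\<^sup>2 / 2)) = char std_normal_distribution s"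
      by (simp add: char_std_normal_distribution)
    also have "\<dots> = (LINT x|lborel. std_normal_density x *\<^sub>R iexp (s * x))"
      unfolding char_def by (subst integral_density) (auto simp: normal_density_nonneg)
    also have "\<dots> = (LINT x|lborel. of_real (1 / sqrt (2 * pi)) * (cis (s * x) * of_real (exp (- x\<^sup>2 / 2))))"
      by (intro Bochner_Integration.integral_cong) (simp_all add: nd cis_conv_exp scaleR_conv_of_real mult_ac)
    also have "\<dots> = of_real (1 / sqrt (2 * pi)) * (LINT x|lborel. cis (s * x) * of_real (exp (- x\<^sup>2 / 2)))"
      by (rule integral_mult_right_zero)
    finally show ?thesis by (simp add: field_simps)
  qed
  have "(LINT x|lborel. cis (- (t / sqrt a) * x) * of_real (exp (- x\<^sup>2 / 2)))
     = \<bar>sqrt a\<bar> *\<^sub>R (LINT x|lborel. cis (- (t / sqrt a) * (0 + sqrt a * x)) * of_real (exp (- (0 + sqrt a * x)\<^sup>2 / 2)))"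
    using a by (intro lborel_integral_real_affine) auto
  also have "\<dots> = sqrt a *\<^sub>R (LINT x|lborel. cis (- (t * x)) * of_real (exp (- a * x\<^sup>2 / 2)))"
    using a by (simp add: power_mult_distrib)
  finally have "sqrt a *\<^sub>R (LINT x|lborel. cis (- (t * x)) * of_real (exp (- a * x\<^sup>2 / 2))) = of_real (sqrt (2 * pi) * exp (- (t / sqrt a)\<^sup>2 / 2))"
    using base[of "- (t / sqrt a)"] by simp
  then show "(LINT x|lborel. cis (- (t * x)) * of_real (exp (- a * x\<^sup>2 / 2))) = of_real (sqrt (2 * pi / a) * exp (- t\<^sup>2 / (2 * a)))"
    using a by (simp add: real_sqrt_divide power_divide scaleR_conv_of_real field_simps)
qed

lemma cis_sum: "finite S \<Longrightarrow> cis (\<Sum>i\<in>S. f i) = (\<Prod>i\<in>S. cis (f i))"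
  by (induction rule: finite_induct) (auto simp flip: cis_mult)

text \<open>Lebesgue measure is the image under \<open>T\<close> of a product of one-dimensional
  ones, and both the character and the Gaussian factor over the coordinates.\<close>

lemma gaussian_transform:
  fixes \<xi> :: "'a::euclidean_space" and a :: real
  assumes a: "a > 0"
  shows "integrable lborel (\<lambda>x::'a. exp (- a * (norm x)\<^sup>2 / 2))"
    and "(LINT x|lborel. cis (- (\<xi> \<bullet> x)) * of_real (exp (- a * (norm x)\<^sup>2 / 2))) 
      = of_real (sqrt (2 * pi / a) ^ DIM('a) * exp (- (norm \<xi>)\<^sup>2 / (2 * a)))"
proof -
  interpret product_sigma_finite "\<lambda>b::'a. lborel :: real measure" by standard
  define T where "T = (\<lambda>f. \<Sum>b\<in>Basis. f b *\<^sub>R b :: 'a)"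
  have [measurable]: "T \<in> (\<Pi>\<^sub>M b\<in>(Basis::'a set). lborel) \<rightarrow>\<^sub>M borel" unfolding T_def by measurable
  have L: "(lborel :: 'a measure) = distr (\<Pi>\<^sub>M b\<in>(Basis::'a set). lborel) borel T"
    unfolding T_def by (rule lborel_eq)
  define G where "G b r = cis (- ((\<xi> \<bullet> b) * r)) * of_real (exp (- a * r\<^sup>2 / 2))" for b and r :: real
  have Gi: "integrable lborel (G b)" for b
    by (rule Bochner_Integration.integrable_bound[OF gaussian_transform_real(1)[OF a]])
      (simp_all add: G_def[abs_def] norm_mult)
  have nT: "(norm (T f))\<^sup>2 = (\<Sum>b\<in>Basis. (f b)\<^sup>2)" for f
  proof -
    have "(norm (T f))\<^sup>2 = (\<Sum>b\<in>Basis. (T f \<bullet> b)\<^sup>2)"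
      unfolding power2_norm_eq_inner using euclidean_inner[of "T f" "T f"] by (simp add: power2_eq_square)
    also have "\<dots> = (\<Sum>b\<in>Basis. (f b)\<^sup>2)"
      unfolding T_def by (intro sum.cong refl) simp
    finally show ?thesis .
  qed
  have iT: "\<xi> \<bullet> T f = (\<Sum>b\<in>Basis. (\<xi> \<bullet> b) * f b)" for f
    unfolding T_def by (simp add: inner_sum_right mult_ac)
  have eq: "cis (- (\<xi> \<bullet> T f)) * of_real (exp (- a * (norm (T f))\<^sup>2 / 2)) = (\<Prod>b\<in>Basis. G b (f b))" for f
  proof -
    have 1: "- (\<xi> \<bullet> T f) = (\<Sum>b\<in>Basis. - ((\<xi> \<bullet> b) * f b))"
      by (simp add: iT sum_negf)
    have 2: "- a * (norm (T f))\<^sup>2 / 2 = (\<Sum>b\<in>Basis. - a * (f b)\<^sup>2 / 2)"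
      unfolding nT by (simp only: sum_distrib_left sum_divide_distrib)
    show ?thesis
      unfolding 1 2 by (simp only: G_def prod.distrib cis_sum exp_sum of_real_prod finite_Basis)
  qed
  have "integrable (\<Pi>\<^sub>M b\<in>(Basis::'a set). lborel) (\<lambda>f. \<Prod>b\<in>Basis. G b (f b))"
    by (rule product_integrable_prod) (use Gi in auto)
  then have "integrable lborel (\<lambda>x. cis (- (\<xi> \<bullet> x)) * of_real (exp (- a * (norm x)\<^sup>2 / 2)))"
    unfolding L by (subst integrable_distr_eq) (auto simp only: eq[symmetric], measurable)
  from integrable_norm[OF this] show "integrable lborel (\<lambda>x::'a. exp (- a * (norm x)\<^sup>2 / 2))" by (simp add: norm_mult)
  have "(LINT x|lborel. cis (- (\<xi> \<bullet> x)) * of_real (exp (- a * (norm x)\<^sup>2 / 2))) = 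
    (LINT f|(\<Pi>\<^sub>M b\<in>(Basis::'a set). lborel). (\<Prod>b\<in>Basis. G b (f b)))"
    unfolding L by (subst integral_distr) (simp_all only: eq, measurable)
  also have "\<dots> = (\<Prod>b\<in>Basis. (LINT r|lborel. G b r))"
    by (rule product_integral_prod) (use Gi in auto)
  also have "\<dots> = (\<Prod>b\<in>Basis. of_real (sqrt (2 * pi / a) * exp (- (\<xi> \<bullet> b)\<^sup>2 / (2 * a))))"
    unfolding G_def by (intro prod.cong refl gaussian_transform_real(2)[OF a])
  also have "\<dots> = of_real (sqrt (2 * pi / a) ^ DIM('a) * exp (- (norm \<xi>)\<^sup>2 / (2 * a)))"
  proof -
    have "(norm \<xi>)\<^sup>2 = (\<Sum>b\<in>Basis. (\<xi> \<bullet> b)\<^sup>2)"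
      unfolding power2_norm_eq_inner using euclidean_inner[of \<xi> \<xi>] by (simp add: power2_eq_square)
    then have "- (norm \<xi>)\<^sup>2 / (2 * a) = (\<Sum>b\<in>Basis. - (\<xi> \<bullet> b)\<^sup>2 / (2 * a))"
      by (simp add: sum_negf sum_divide_distrib)
    then show ?thesis
      by (simp only: prod.distrib exp_sum finite_Basis of_real_prod[symmetric] prod_constant)
  qed
  finally show "(LINT x|lborel. cis (- (\<xi> \<bullet> x)) * of_real (exp (- a * (norm x)\<^sup>2 / 2))) 
      = of_real (sqrt (2 * pi / a) ^ DIM('a) * exp (- (norm \<xi>)\<^sup>2 / (2 * a)))" .
qed

section \<open>The Fourier integral on L^1 and its isometry property\<close>

text \<open>Without the normalizing constant, so that the Fubini and Gaussian computations carry no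
  powers of 2 \<pi> besides those of the Gaussian itself.\<close>

definition fourier_integral :: "('a::euclidean_space \<Rightarrow> complex) \<Rightarrow> 'a \<Rightarrow> complex" where
  "fourier_integral f \<xi> = (LINT x|lborel. cis (- (\<xi> \<bullet> x)) * f x)"

lemma fourier_L1_eq:
  "fourier_L1 f \<xi> = of_real ((2 * pi) powr (- real DIM('a) / 2)) * fourier_integral f (\<xi> :: 'a::euclidean_space)"
  by (simp add: fourier_L1_def fourier_integral_def)

lemma integrable_cis_mult:
  fixes f :: "'a::euclidean_space \<Rightarrow> complex"
  assumes f: "integrable lborel f" and [measurable]: "\<theta> \<in> borel_measurable borel"
  shows "integrable lborel (\<lambda>x. cis (\<theta> x) * f x)"
proof (rule Bochner_Integration.integrable_bound[OF f])
  note borel_measurable_integrable[OF f, measurable]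
  show "(\<lambda>x. cis (\<theta> x) * f x) \<in> borel_measurable lborel" by measurable
qed (auto simp: norm_mult)

lemma borel_measurable_fourier_integral [measurable]:
  assumes "integrable lborel f"
  shows "fourier_integral f \<in> borel_measurable borel"
proof -
  note borel_measurable_integrable[OF assms, measurable]
  show ?thesis unfolding fourier_integral_def by measurable
qed

lemma norm_fourier_integral_le: "norm (fourier_integral f \<xi>) \<le> (LINT x|lborel. norm (f x))"
  unfolding fourier_integral_def
  by (rule order_trans[OF integral_norm_bound]) (simp add: norm_mult)

lemma fourier_integral_diff:
  assumes "integrable lborel f" "integrable lborel g"
  shows "fourier_integral (\<lambda>x. f x - g x) \<xi> = fourier_integral f \<xi> - fourier_integral g \<xi>"
  using assms unfolding fourier_integral_def
  by (simp add: right_diff_distrib integrable_cis_mult)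

lemma fourier_integral_add:
  assumes "integrable lborel f" "integrable lborel g"
  shows "fourier_integral (\<lambda>x. f x + g x) \<xi> = fourier_integral f \<xi> + fourier_integral g \<xi>"
  using assms unfolding fourier_integral_def
  by (simp add: distrib_left integrable_cis_mult)

lemma fourier_integral_cmult: "fourier_integral (\<lambda>x. c * f x) \<xi> = c * fourier_integral f \<xi>"
  unfolding fourier_integral_def by (simp add: mult.left_commute)

lemma integrable_pair_product:
  fixes f g :: "'a::euclidean_space \<Rightarrow> complex" and \<theta> :: "'a \<times> 'a \<Rightarrow> complex"
  assumes f: "integrable lborel f" and g: "integrable lborel g"
    and [measurable]: "\<theta> \<in> borel_measurable (borel \<Otimes>\<^sub>M borel)" and "\<And>z. norm (\<theta> z) \<le> 1"
  shows "integrable (lborel \<Otimes>\<^sub>M lborel) (\<lambda>(x, y). \<theta> (x, y) * f x * g y)"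
proof -
  note borel_measurable_integrable[OF f, measurable] borel_measurable_integrable[OF g, measurable]
  have "integrable (lborel \<Otimes>\<^sub>M lborel) (\<lambda>(x, y). f x * g y)"
  proof (rule lborel_pair.Fubini_integrable)
    show "integrable lborel (\<lambda>x. LINT y|lborel. norm (case (x, y) of (x, y) \<Rightarrow> f x * g y))"
      using f by (simp add: norm_mult)
    show "AE x in lborel. integrable lborel (\<lambda>y. case (x, y) of (x, y) \<Rightarrow> f x * g y)"
      using g by simp
  qed measurable
  then show ?thesis
  proof (rule Bochner_Integration.integrable_bound)
    show "AE z in lborel \<Otimes>\<^sub>M lborel. norm (case z of (x, y) \<Rightarrow> \<theta> (x, y) * f x * g y) \<le> norm (case z of (x, y) \<Rightarrow> f x * g y)"
    proof (rule AE_I2, clarify)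
      fix x y :: 'a
      have "norm (\<theta> (x, y)) * (norm (f x) * norm (g y)) \<le> 1 * (norm (f x) * norm (g y))"
        using assms(4) by (intro mult_right_mono) auto
      then show "norm (\<theta> (x, y) * f x * g y) \<le> norm (f x * g y)" by (simp add: norm_mult mult.assoc)
    qed
  qed measurable
qed

text \<open>Fubini, the kernel being symmetric in \<open>x\<close> and \<xi>.\<close>

lemma fourier_integral_exchange:
  fixes f g :: "'a::euclidean_space \<Rightarrow> complex"
  assumes f: "integrable lborel f" and g: "integrable lborel g"
  shows "(LINT \<xi>|lborel. fourier_integral f \<xi> * g \<xi>) = (LINT x|lborel. f x * fourier_integral g x)"
proof -
  have m: "(\<lambda>z. cis (- (snd z \<bullet> fst z))) \<in> borel_measurable (borel \<Otimes>\<^sub>M (borel :: 'a measure))"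
    by measurable
  have "(LINT \<xi>|lborel. LINT x|lborel. cis (- (\<xi> \<bullet> x)) * f x * g \<xi>) = (LINT x|lborel. LINT \<xi>|lborel. cis (- (\<xi> \<bullet> x)) * f x * g \<xi>)"
    using lborel_pair.Fubini_integral[OF integrable_pair_product[OF f g m]] by simp
  moreover have "(LINT x|lborel. cis (- (\<xi> \<bullet> x)) * f x * g \<xi>) = fourier_integral f \<xi> * g \<xi>" for \<xi>
    unfolding fourier_integral_def by (rule integral_mult_left_zero)
  moreover have "(LINT \<xi>|lborel. cis (- (\<xi> \<bullet> x)) * f x * g \<xi>) = f x * fourier_integral g x" for x
  proof -
    have "(LINT \<xi>|lborel. cis (- (\<xi> \<bullet> x)) * f x * g \<xi>) = (LINT \<xi>|lborel. f x * (cis (- (x \<bullet> \<xi>)) * g \<xi>))"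
      by (simp add: inner_commute mult_ac)
    then show ?thesis by (simp add: fourier_integral_def)
  qed
  ultimately show ?thesis by (simp only:)
qed

text \<open>The Gaussian factor makes the squared transform integrable before Plancherel is known.
  The exchange formula moves one transform onto the damped conjugate, whose transform is a Gaussian
  mean of translates of \<open>cnj u\<close>.\<close>

lemma gaussian_mean_correlation:
  fixes u :: "'a::euclidean_space \<Rightarrow> complex"
  assumes u: "integrable lborel u" and e: "\<epsilon> > 0"
  shows "integrable lborel (\<lambda>\<xi>. (norm (fourier_integral u \<xi>))\<^sup>2 * exp (- \<epsilon> * (norm \<xi>)\<^sup>2 / 2))"
    and "complex_of_real (LINT \<xi>|lborel. (norm (fourier_integral u \<xi>))\<^sup>2 * exp (- \<epsilon> * (norm \<xi>)\<^sup>2 / 2))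
     = of_real (sqrt (2 * pi) ^ DIM('a)) *
       (LINT x|lborel. LINT z|lborel. u x * cnj (u (x + sqrt \<epsilon> *\<^sub>R z)) * of_real (exp (- (norm z)\<^sup>2 / 2)))"
proof -
  note borel_measurable_integrable[OF u, measurable]
  note borel_measurable_fourier_integral[OF u, measurable]
  define \<gamma> where "\<gamma> \<xi> = exp (- \<epsilon> * (norm \<xi>)\<^sup>2 / 2)" for \<xi> :: 'a
  have \<gamma>: "integrable lborel \<gamma>" unfolding \<gamma>_def by (rule gaussian_transform(1)[OF e])
  note borel_measurable_integrable[OF \<gamma>, measurable]
  define K where "K = (LINT x|lborel. norm (u x))"
  have K: "norm (fourier_integral u \<xi>) \<le> K" for \<xi> unfolding K_def by (rule norm_fourier_integral_le)
  define w where "w \<xi> = cnj (fourier_integral u \<xi>) * of_real (\<gamma> \<xi>)" for \<xi>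
  have w: "integrable lborel w"
  proof (rule Bochner_Integration.integrable_bound)
    show "integrable lborel (\<lambda>\<xi>. K * \<gamma> \<xi>)" using \<gamma> by simp
    show "AE \<xi> in lborel. norm (w \<xi>) \<le> norm (K * \<gamma> \<xi>)"
      using K order_trans[OF norm_ge_zero K] by (auto simp: w_def norm_mult \<gamma>_def intro!: mult_right_mono)
  qed (unfold w_def, measurable)
  have eq: "complex_of_real ((norm (fourier_integral u \<xi>))\<^sup>2 * \<gamma> \<xi>) = fourier_integral u \<xi> * w \<xi>" for \<xi>
    by (simp add: w_def complex_norm_square mult_ac del: of_real_power)
  have "integrable lborel (\<lambda>\<xi>. K\<^sup>2 * \<gamma> \<xi>)" using \<gamma> by simp
  then have "integrable lborel (\<lambda>\<xi>. (norm (fourier_integral u \<xi>))\<^sup>2 * \<gamma> \<xi>)"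
  proof (rule Bochner_Integration.integrable_bound)
    show "AE \<xi> in lborel. norm ((norm (fourier_integral u \<xi>))\<^sup>2 * \<gamma> \<xi>) \<le> norm (K\<^sup>2 * \<gamma> \<xi>)"
      using K by (auto simp: \<gamma>_def intro!: mult_right_mono power_mono)
  qed measurable
  then show "integrable lborel (\<lambda>\<xi>. (norm (fourier_integral u \<xi>))\<^sup>2 * exp (- \<epsilon> * (norm \<xi>)\<^sup>2 / 2))"
    by (simp add: \<gamma>_def)
  have hw: "fourier_integral w x = of_real (sqrt (2 * pi) ^ DIM('a)) * (LINT z|lborel. cnj (u (x + sqrt \<epsilon> *\<^sub>R z)) * of_real (exp (- (norm z)\<^sup>2 / 2)))" for x
  proof -
    define h where "h \<xi> = cis (x \<bullet> \<xi>) * of_real (\<gamma> \<xi>)" for \<xi>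
    have h: "integrable lborel h" unfolding h_def using \<gamma> by (intro integrable_cis_mult) auto
    have "cnj (fourier_integral w x) = (LINT \<xi>|lborel. cnj (cis (- (x \<bullet> \<xi>)) * w \<xi>))"
      unfolding fourier_integral_def by (rule Bochner_Integration.integral_cnj[symmetric])
    also have "\<dots> = (LINT \<xi>|lborel. fourier_integral u \<xi> * h \<xi>)"
      by (simp add: w_def h_def cis_cnj mult_ac)
    also have "\<dots> = (LINT y|lborel. u y * fourier_integral h y)"
      by (rule fourier_integral_exchange[OF u h])
    also have "fourier_integral h = (\<lambda>y. of_real (sqrt (2 * pi / \<epsilon>) ^ DIM('a) * exp (- (norm (y - x))\<^sup>2 / (2 * \<epsilon>))))"
    proof
      fix y
      have "fourier_integral h y = (LINT \<xi>|lborel. cis (- ((y - x) \<bullet> \<xi>)) * of_real (exp (- \<epsilon> * (norm \<xi>)\<^sup>2 / 2)))"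
        unfolding fourier_integral_def h_def \<gamma>_def
        by (simp add: mult.assoc[symmetric] cis_mult inner_diff_left)
      then show "fourier_integral h y = of_real (sqrt (2 * pi / \<epsilon>) ^ DIM('a) * exp (- (norm (y - x))\<^sup>2 / (2 * \<epsilon>)))"
        using gaussian_transform(2)[OF e, of "y - x"] by simp
    qed
    \<comment> \<open>The substitution y = x + sqrt \<epsilon> z moves \<epsilon> from the Gaussian
      into a translation of \<open>u\<close>, where continuity of translations can act as \<epsilon>
      tends to 0.\<close>
    also have "(LINT y|lborel. u y * of_real (sqrt (2 * pi / \<epsilon>) ^ DIM('a) * exp (- (norm (y - x))\<^sup>2 / (2 * \<epsilon>))))
       = \<bar>sqrt \<epsilon>\<bar> ^ DIM('a) *\<^sub>R (LINT z|lborel. u (x + sqrt \<epsilon> *\<^sub>R z) * of_real (sqrt (2 * pi / \<epsilon>) ^ DIM('a) * exp (- (norm (x + sqrt \<epsilon> *\<^sub>R z - x))\<^sup>2 / (2 * \<epsilon>))))"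
      using e by (intro integral_affine) auto
    also have "\<dots> = \<bar>sqrt \<epsilon>\<bar> ^ DIM('a) *\<^sub>R (LINT z|lborel. of_real (sqrt (2 * pi / \<epsilon>) ^ DIM('a)) * (u (x + sqrt \<epsilon> *\<^sub>R z) * of_real (exp (- (norm z)\<^sup>2 / 2))))"
      using e by (simp add: power_mult_distrib mult_ac)
    also have "\<dots> = of_real (sqrt \<epsilon> ^ DIM('a) * sqrt (2 * pi / \<epsilon>) ^ DIM('a)) * (LINT z|lborel. u (x + sqrt \<epsilon> *\<^sub>R z) * of_real (exp (- (norm z)\<^sup>2 / 2)))"
      using e by (subst integral_mult_right_zero) (simp add: scaleR_conv_of_real mult_ac)
    also have "sqrt \<epsilon> ^ DIM('a) * sqrt (2 * pi / \<epsilon>) ^ DIM('a) = sqrt (2 * pi) ^ DIM('a)"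
      using e by (simp add: power_mult_distrib[symmetric] real_sqrt_mult[symmetric])
    finally have "cnj (cnj (fourier_integral w x)) = cnj (of_real (sqrt (2 * pi) ^ DIM('a)) * (LINT z|lborel. u (x + sqrt \<epsilon> *\<^sub>R z) * of_real (exp (- (norm z)\<^sup>2 / 2))))"
      by simp
    then show ?thesis by (simp flip: Bochner_Integration.integral_cnj)
  qed
  have "complex_of_real (LINT \<xi>|lborel. (norm (fourier_integral u \<xi>))\<^sup>2 * \<gamma> \<xi>) = (LINT \<xi>|lborel. fourier_integral u \<xi> * w \<xi>)"
    unfolding eq[symmetric] by (rule integral_complex_of_real[symmetric])
  also have "\<dots> = (LINT x|lborel. u x * fourier_integral w x)"
    by (rule fourier_integral_exchange[OF u w])
  also have "\<dots> = (LINT x|lborel. of_real (sqrt (2 * pi) ^ DIM('a)) * (LINT z|lborel. u x * cnj (u (x + sqrt \<epsilon> *\<^sub>R z)) * of_real (exp (- (norm z)\<^sup>2 / 2))))"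
    by (simp add: hw mult_ac)
  also have "\<dots> = of_real (sqrt (2 * pi) ^ DIM('a)) *
       (LINT x|lborel. LINT z|lborel. u x * cnj (u (x + sqrt \<epsilon> *\<^sub>R z)) * of_real (exp (- (norm z)\<^sup>2 / 2)))"
    by (rule integral_mult_right_zero)
  finally show "complex_of_real (LINT \<xi>|lborel. (norm (fourier_integral u \<xi>))\<^sup>2 * exp (- \<epsilon> * (norm \<xi>)\<^sup>2 / 2))
     = of_real (sqrt (2 * pi) ^ DIM('a)) *
       (LINT x|lborel. LINT z|lborel. u x * cnj (u (x + sqrt \<epsilon> *\<^sub>R z)) * of_real (exp (- (norm z)\<^sup>2 / 2)))"
    by (simp add: \<gamma>_def)
qed

text \<open>Let the damping tend to zero in the correlation identity. On the right the
  autocorrelation tends to its value at 0, the squared norm; on the left monotone convergence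
  applies.\<close>

lemma plancherel_L1_L2:
  fixes u :: "'a::euclidean_space \<Rightarrow> complex"
  assumes u1: "integrable lborel u" and u2: "u \<in> L2"
  shows "fourier_L1 u \<in> L2" "L2_norm (fourier_L1 u) = L2_norm u"
proof -
  note borel_measurable_integrable[OF u1, measurable]
  note borel_measurable_fourier_integral[OF u1, measurable]
  define g where "g z = exp (- (norm z)\<^sup>2 / 2)" for z :: 'a
  have g: "integrable lborel g" using gaussian_transform(1)[of 1, where 'a='a] by (simp add: g_def[abs_def])
  note borel_measurable_integrable[OF g, measurable]
  \<comment> \<open>This constant enters twice, as the prefactor of the correlation identity and as
    the integral of \<open>g\<close>. The unnormalized transform thus multiplies squared norms by
    S^2 = (2 \<pi>)^d.\<close>
  define S where "S = sqrt (2 * pi) ^ DIM('a)"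
  have gS: "(LINT z|lborel. of_real (g z)) = complex_of_real S"
    using gaussian_transform(2)[of 1 "0::'a"] by (simp add: g_def S_def)
  define e where "e n = 1 / real (Suc n)" for n
  have e: "e n > 0" for n by (simp add: e_def)
  have e0: "e \<longlonglongrightarrow> 0" unfolding e_def by (rule LIMSEQ_Suc[OF lim_1_over_n])
  define C where "C h = (LINT x|lborel. u x * cnj (u (x + h)))" for h
  have Cb: "norm (C h) \<le> (L2_norm u)\<^sup>2" for h
    unfolding C_def using L2_Cauchy_Schwarz[OF u2 L2_cnj[OF L2_translate[OF u2, of h]]]
      L2_norm_cong_norm[of "\<lambda>x. cnj (u (x + h))" "\<lambda>x. u (x + h)"]
    by (simp add: L2_norm_translate power2_eq_square)
  have C0: "C 0 = of_real ((L2_norm u)\<^sup>2)"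
  proof -
    have "C 0 = (LINT x|lborel. complex_of_real ((norm (u x))\<^sup>2))"
      unfolding C_def by (simp add: complex_norm_square del: of_real_power)
    then show ?thesis unfolding L2_norm_squared by (simp only: integral_complex_of_real)
  qed
  have Cc: "(\<lambda>n. C (sqrt (e n) *\<^sub>R z)) \<longlonglongrightarrow> C 0" for z
  proof -
    have h: "(\<lambda>n. sqrt (e n) *\<^sub>R z) \<longlonglongrightarrow> 0"
      using tendsto_scaleR[OF tendsto_real_sqrt[OF e0] tendsto_const[of z]] by simp
    show ?thesis unfolding C_def
    proof (rule tendsto_L2_mult[of "\<lambda>n. u"])
      show "(\<lambda>n. L2_norm (\<lambda>x. cnj (u (x + sqrt (e n) *\<^sub>R z)) - cnj (u (x + 0)))) \<longlonglongrightarrow> 0"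
        using tendsto_L2_translate[OF u2 h] L2_norm_cong_norm[OF complex_mod_cnj, of "\<lambda>x. u (x + h) - u x" for h]
        by simp
    qed (use u2 in \<open>auto intro: L2_cnj L2_translate\<close>)
  qed
  have uu: "integrable lborel (\<lambda>x. norm (u x) * norm (u (x + h)))"
    "(LINT x|lborel. norm (u x) * norm (u (x + h))) \<le> (L2_norm u)\<^sup>2" for h
    using integrable_norm[OF L2_mult_integrable[OF u2 L2_translate[OF u2, of h]]]
      L2_Cauchy_Schwarz_norm[OF u2 L2_translate[OF u2, of h]]
    by (simp_all add: norm_mult L2_norm_translate power2_eq_square)
  \<comment> \<open>Integrating in \<open>x\<close> first produces the autocorrelation
    \<open>C\<close>; Cauchy-Schwarz in \<open>x\<close> makes the double integral absolutely
    convergent.\<close>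
  have swap: "(LINT x|lborel. LINT z|lborel. u x * cnj (u (x + sqrt \<epsilon> *\<^sub>R z)) * of_real (g z)) = 
      (LINT z|lborel. C (sqrt \<epsilon> *\<^sub>R z) * of_real (g z))" for \<epsilon>
  proof -
    have "integrable (lborel \<Otimes>\<^sub>M lborel) (\<lambda>(z, x). u x * cnj (u (x + sqrt \<epsilon> *\<^sub>R z)) * of_real (g z))"
    proof (rule lborel_pair.Fubini_integrable)
      show "integrable lborel (\<lambda>z. LINT x|lborel. norm (case (z, x) of (z, x) \<Rightarrow> u x * cnj (u (x + sqrt \<epsilon> *\<^sub>R z)) * of_real (g z)))"
      proof (rule Bochner_Integration.integrable_bound)
        show "integrable lborel (\<lambda>z. (L2_norm u)\<^sup>2 * g z)" using g by simp
        have "(LINT x|lborel. norm (u x) * norm (u (x + sqrt \<epsilon> *\<^sub>R z)) * g z) \<le> (L2_norm u)\<^sup>2 * g z" for z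
          using uu(2)[of "sqrt \<epsilon> *\<^sub>R z"] by (simp add: g_def)
        moreover have "0 \<le> (LINT x|lborel. norm (u x) * norm (u (x + sqrt \<epsilon> *\<^sub>R z)) * g z)" for z
          by (intro integral_nonneg_AE) (simp add: g_def)
        ultimately show "AE z in lborel. norm (LINT x|lborel. norm (case (z, x) of (z, x) \<Rightarrow> u x * cnj (u (x + sqrt \<epsilon> *\<^sub>R z)) * of_real (g z)))
           \<le> norm ((L2_norm u)\<^sup>2 * g z)"
          by (intro AE_I2) (simp add: norm_mult g_def)
      qed measurable
      show "AE z in lborel. integrable lborel (\<lambda>x. case (z, x) of (z, x) \<Rightarrow> u x * cnj (u (x + sqrt \<epsilon> *\<^sub>R z)) * of_real (g z))"
        using L2_mult_integrable[OF u2 L2_cnj[OF L2_translate[OF u2]]] by (intro AE_I2) simp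
    qed measurable
    from lborel_pair.Fubini_integral[OF this] show ?thesis by (simp add: C_def)
  qed
  define A where "A n = (LINT \<xi>|lborel. (norm (fourier_integral u \<xi>))\<^sup>2 * exp (- e n * (norm \<xi>)\<^sup>2 / 2))" for n
  have "(\<lambda>n. LINT z|lborel. C (sqrt (e n) *\<^sub>R z) * of_real (g z)) \<longlonglongrightarrow> (LINT z|lborel. C 0 * of_real (g z))"
  proof (rule integral_dominated_convergence[where w="\<lambda>z. (L2_norm u)\<^sup>2 * g z"])
    show "(\<lambda>z. C (sqrt (e n) *\<^sub>R z) * of_real (g z)) \<in> borel_measurable lborel" for n
      unfolding C_def by measurable
    show "AE z in lborel. (\<lambda>n. C (sqrt (e n) *\<^sub>R z) * of_real (g z)) \<longlonglongrightarrow> C 0 * of_real (g z)"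
      by (intro AE_I2 tendsto_intros Cc)
    show "AE z in lborel. norm (C (sqrt (e n) *\<^sub>R z) * of_real (g z)) \<le> (L2_norm u)\<^sup>2 * g z" for n
      using Cb by (intro AE_I2) (simp add: norm_mult g_def)
  qed (use g in auto)
  then have "(\<lambda>n. of_real S * (LINT z|lborel. C (sqrt (e n) *\<^sub>R z) * of_real (g z))) \<longlonglongrightarrow> of_real S * (of_real ((L2_norm u)\<^sup>2) * of_real S)"
    by (intro tendsto_intros) (simp only: C0 integral_mult_right_zero gS)
  then have "(\<lambda>n. complex_of_real (A n)) \<longlonglongrightarrow> complex_of_real (S\<^sup>2 * (L2_norm u)\<^sup>2)"
    unfolding A_def gaussian_mean_correlation(2)[OF u1 e] using swap
    by (simp add: S_def g_def power2_eq_square mult_ac)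
  then have A: "A \<longlonglongrightarrow> S\<^sup>2 * (L2_norm u)\<^sup>2"
    by (subst (asm) tendsto_of_real_iff)
  \<comment> \<open>As \<open>e\<close> decreases, the damped integrands increase to the undamped
    one, so monotone convergence gives integrability together with the value.\<close>
  have mono: "mono (\<lambda>n. (norm (fourier_integral u \<xi>))\<^sup>2 * exp (- e n * (norm \<xi>)\<^sup>2 / 2))" for \<xi>
    by (intro monoI mult_left_mono) (auto simp: e_def intro!: mult_right_mono divide_left_mono)
  have lim: "(\<lambda>n. (norm (fourier_integral u \<xi>))\<^sup>2 * exp (- e n * (norm \<xi>)\<^sup>2 / 2)) \<longlonglongrightarrow> (norm (fourier_integral u \<xi>))\<^sup>2" for \<xi>
  proof -
    have "(\<lambda>n. (norm (fourier_integral u \<xi>))\<^sup>2 * exp (- e n * (norm \<xi>)\<^sup>2 / 2)) \<longlonglongrightarrow> (norm (fourier_integral u \<xi>))\<^sup>2 * exp (- 0 * (norm \<xi>)\<^sup>2 / 2)"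
      by (intro tendsto_intros e0) simp
    then show ?thesis by simp
  qed
  have int: "integrable lborel (\<lambda>\<xi>. (norm (fourier_integral u \<xi>))\<^sup>2)"
    and val: "(LINT \<xi>|lborel. (norm (fourier_integral u \<xi>))\<^sup>2) = S\<^sup>2 * (L2_norm u)\<^sup>2"
  proof -
    show "integrable lborel (\<lambda>\<xi>. (norm (fourier_integral u \<xi>))\<^sup>2)"
      by (rule integrable_monotone_convergence[OF gaussian_mean_correlation(1)[OF u1 e] _ _ A[unfolded A_def]])
        (use mono lim in auto)
    show "(LINT \<xi>|lborel. (norm (fourier_integral u \<xi>))\<^sup>2) = S\<^sup>2 * (L2_norm u)\<^sup>2"
      by (rule integral_monotone_convergence[OF gaussian_mean_correlation(1)[OF u1 e] _ _ A[unfolded A_def]])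
        (use mono lim in auto)
  qed
  have F: "fourier_integral u \<in> L2" by (rule L2I[OF _ int]) simp
  then show "fourier_L1 u \<in> L2" unfolding fourier_L1_eq[abs_def] by (rule L2_cmult)
  have "S = (2 * pi) powr (real DIM('a) / 2)"
    by (simp add: S_def powr_half_sqrt[symmetric] powr_realpow[symmetric] powr_powr)
  then have c: "(2 * pi) powr (- real DIM('a) / 2) * S = 1" 
    by (simp add: powr_add[symmetric])
  have S0: "S \<ge> 0" by (simp add: S_def)
  have "L2_norm (fourier_integral u) = S * L2_norm u"
    unfolding L2_norm_def[of "fourier_integral u"] val using S0 by (simp add: real_sqrt_mult)
  then show "L2_norm (fourier_L1 u) = L2_norm u" 
    unfolding fourier_L1_eq[abs_def] L2_norm_cmult using c by (simp add: mult.assoc[symmetric])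
qed

section \<open>The Fourier transform on \<open>L\<^sup>2\<close>\<close>

abbreviation truncate :: "real \<Rightarrow> ('a::euclidean_space \<Rightarrow> complex) \<Rightarrow> 'a \<Rightarrow> complex" where
  "truncate R u \<equiv> (\<lambda>x. indicator (cball 0 R) x * u x)"

lemma L2_truncate [intro]: "u \<in> L2 \<Longrightarrow> truncate R u \<in> L2"
  by (rule L2_indicator) auto

lemma fourier_L1_diff:
  assumes "integrable lborel f" "integrable lborel g"
  shows "fourier_L1 (\<lambda>x. f x - g x) \<xi> = fourier_L1 f \<xi> - fourier_L1 g \<xi>"
  using assms by (simp add: fourier_L1_eq fourier_integral_diff right_diff_distrib)

lemma fourier_L1_add_cmult:
  assumes "integrable lborel f" "integrable lborel g"
  shows "fourier_L1 (\<lambda>x. f x + c * g x) \<xi> = fourier_L1 f \<xi> + c * fourier_L1 g \<xi>"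
  using assms by (simp add: fourier_L1_eq fourier_integral_add fourier_integral_cmult algebra_simps)

lemma fourier_L1_cong_AE:
  assumes "AE x in lborel. f x = g x" "f \<in> borel_measurable borel" "g \<in> borel_measurable borel"
  shows "fourier_L1 f = fourier_L1 g"
proof
  fix \<xi>
  note assms(2,3)[measurable]
  have "fourier_integral f \<xi> = fourier_integral g \<xi>"
    unfolding fourier_integral_def
  proof (rule integral_cong_AE)
    show "AE x in lborel. cis (- (\<xi> \<bullet> x)) * f x = cis (- (\<xi> \<bullet> x)) * g x" using assms(1) by auto
  qed measurable
  then show "fourier_L1 f \<xi> = fourier_L1 g \<xi>" by (simp add: fourier_L1_eq)
qed

lemma fourier_L1_truncate_L2:
  assumes "u \<in> L2"
  shows "fourier_L1 (truncate R u) \<in> L2"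
  by (rule plancherel_L1_L2[OF L2_cball_integrable[OF assms] L2_truncate[OF assms]])

lemma L2_norm_fourier_L1_diff:
  assumes "integrable lborel u" "u \<in> L2" "integrable lborel w" "w \<in> L2"
  shows "L2_norm (\<lambda>\<xi>. fourier_L1 u \<xi> - fourier_L1 w \<xi>) = L2_norm (\<lambda>x. u x - w x)"
  using plancherel_L1_L2(2)[of "\<lambda>x. u x - w x"] assms
  by (simp add: fourier_L1_diff[OF assms(1,3), abs_def] L2_diff)

text \<open>The extended integral in the definition can be traded for \<open>L2_norm\<close> because
  Plancherel already places the transforms of the truncations in L^2.\<close>

lemma is_fourier_L2_iff:
  assumes "u \<in> L2"
  shows "is_fourier_L2 u g \<longleftrightarrow> g \<in> L2 \<and> ((\<lambda>R. L2_norm (\<lambda>\<xi>. fourier_L1 (truncate R u) \<xi> - g \<xi>)) \<longlongrightarrow> 0) at_top"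
proof (cases "g \<in> L2")
  case True
  have "((\<lambda>R. ennreal ((L2_norm (\<lambda>\<xi>. fourier_L1 (truncate R u) \<xi> - g \<xi>))\<^sup>2)) \<longlongrightarrow> ennreal 0) at_top \<longleftrightarrow>
     ((\<lambda>R. (L2_norm (\<lambda>\<xi>. fourier_L1 (truncate R u) \<xi> - g \<xi>))\<^sup>2) \<longlongrightarrow> 0) at_top"
    by (rule tendsto_ennreal_iff) auto
  also have "\<dots> \<longleftrightarrow> ((\<lambda>R. L2_norm (\<lambda>\<xi>. fourier_L1 (truncate R u) \<xi> - g \<xi>)) \<longlongrightarrow> 0) at_top"
    using tendsto_real_sqrt[of "\<lambda>R. (L2_norm (\<lambda>\<xi>. fourier_L1 (truncate R u) \<xi> - g \<xi>))\<^sup>2" 0 at_top]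
      tendsto_power[of "\<lambda>R. L2_norm (\<lambda>\<xi>. fourier_L1 (truncate R u) \<xi> - g \<xi>)" 0 at_top 2]
    by auto
  finally show ?thesis
    using True unfolding is_fourier_L2_def
    by (simp add: L2_nn_integral[OF L2_diff[OF fourier_L1_truncate_L2[OF assms] True]])
qed (simp add: is_fourier_L2_def)

lemma is_fourier_L2_L2: "is_fourier_L2 u g \<Longrightarrow> g \<in> L2"
  by (simp add: is_fourier_L2_def)

text \<open>The truncations are Cauchy in L^2, and Plancherel carries this over to their
  transforms.\<close>

lemma is_fourier_L2_exists:
  fixes u :: "'a::euclidean_space \<Rightarrow> complex"
  assumes u: "u \<in> L2"
  obtains g where "is_fourier_L2 u g"
proof -
  let ?F = "\<lambda>R. fourier_L1 (truncate R u)"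
  have F: "?F R \<in> L2" for R by (rule fourier_L1_truncate_L2[OF u])
  have d: "L2_norm (\<lambda>\<xi>. ?F R \<xi> - ?F S \<xi>) \<le> L2_norm (\<lambda>x. truncate R u x - u x) + L2_norm (\<lambda>x. truncate S u x - u x)" for R S
  proof -
    have "L2_norm (\<lambda>\<xi>. ?F R \<xi> - ?F S \<xi>) = L2_norm (\<lambda>x. truncate R u x - truncate S u x)"
      by (intro L2_norm_fourier_L1_diff L2_cball_integrable L2_truncate u)
    also have "\<dots> \<le> L2_norm (\<lambda>x. truncate R u x - u x) + L2_norm (\<lambda>x. u x - truncate S u x)"
      by (intro L2_norm_triangle2 L2_truncate u)
    finally show ?thesis by (simp add: L2_norm_minus_commute[of u])
  qed
  have ev: "\<exists>S. \<forall>R\<ge>S. L2_norm (\<lambda>x. truncate R u x - u x) < e" if "e > 0" for e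
    using order_tendstoD(2)[OF tendsto_L2_cball[OF u] that] by (simp add: eventually_at_top_linorder)
  \<comment> \<open>Completeness is a statement about sequences, so the limit is taken along integer
    radii; the Cauchy estimate \<open>d\<close> then extends it to all real radii.\<close>
  have "\<exists>g. g \<in> L2 \<and> (\<lambda>n. L2_norm (\<lambda>\<xi>. ?F (real n) \<xi> - g \<xi>)) \<longlonglongrightarrow> 0"
  proof (rule L2_complete[of "\<lambda>n. ?F (real n)"])
    fix e :: real assume "e > 0"
    then obtain S where S: "\<And>R. R \<ge> S \<Longrightarrow> L2_norm (\<lambda>x. truncate R u x - u x) < e/2" using ev[of "e/2"] by auto
    obtain N where N: "real N \<ge> S" using real_arch_simple by blast
    show "\<exists>N. \<forall>m\<ge>N. \<forall>n\<ge>N. L2_norm (\<lambda>x. ?F (real m) x - ?F (real n) x) < e"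
    proof (intro exI[of _ N] allI impI)
      fix m n assume "N \<le> m" "N \<le> n"
      then have "real m \<ge> S" "real n \<ge> S" using N by linarith+
      then show "L2_norm (\<lambda>x. ?F (real m) x - ?F (real n) x) < e"
        using S[of "real m"] S[of "real n"] d[of "real m" "real n"] by simp
    qed
  qed (use F in auto)
  then obtain g where g: "g \<in> L2" and lim: "(\<lambda>n. L2_norm (\<lambda>\<xi>. ?F (real n) \<xi> - g \<xi>)) \<longlonglongrightarrow> 0" by blast
  have "((\<lambda>R. L2_norm (\<lambda>\<xi>. ?F R \<xi> - g \<xi>)) \<longlongrightarrow> 0) at_top"
  proof (rule tendstoI)
    fix e :: real assume "e > 0"
    then obtain S where S: "\<And>R. R \<ge> S \<Longrightarrow> L2_norm (\<lambda>x. truncate R u x - u x) < e/3" using ev[of "e/3"] by auto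
    obtain N where N: "\<And>n. n \<ge> N \<Longrightarrow> L2_norm (\<lambda>\<xi>. ?F (real n) \<xi> - g \<xi>) < e/3"
      using LIMSEQ_D[OF lim, of "e/3"] \<open>e > 0\<close> by auto
    obtain M where M: "real M \<ge> S" using real_arch_simple by blast
    define n where "n = max N M"
    have n: "real n \<ge> S" "n \<ge> N" using M by (auto simp: n_def)
    show "\<forall>\<^sub>F R in at_top. dist (L2_norm (\<lambda>\<xi>. ?F R \<xi> - g \<xi>)) 0 < e"
    proof (rule eventually_mono[OF eventually_ge_at_top[of S]])
      fix R assume R: "S \<le> R"
      have "L2_norm (\<lambda>\<xi>. ?F R \<xi> - g \<xi>) \<le> L2_norm (\<lambda>\<xi>. ?F R \<xi> - ?F (real n) \<xi>) + L2_norm (\<lambda>\<xi>. ?F (real n) \<xi> - g \<xi>)"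
        by (intro L2_norm_triangle2 F g)
      also have "\<dots> < e" using d[of R "real n"] S[OF R] S[OF n(1)] N[OF n(2)] by simp
      finally show "dist (L2_norm (\<lambda>\<xi>. ?F R \<xi> - g \<xi>)) 0 < e" by simp
    qed
  qed
  then show ?thesis using that g is_fourier_L2_iff[OF u] by blast
qed

text \<open>Plancherel for the integrable truncations, passed to the limit on both sides. The choice
  \<open>w = 0\<close> gives the isometry.\<close>

lemma is_fourier_L2_dist:
  fixes u w :: "'a::euclidean_space \<Rightarrow> complex"
  assumes u: "u \<in> L2" and g: "is_fourier_L2 u g" and w: "w \<in> L2" "integrable lborel w"
  shows "L2_norm (\<lambda>\<xi>. g \<xi> - fourier_L1 w \<xi>) = L2_norm (\<lambda>x. u x - w x)"
proof (rule tendsto_unique[of at_top])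
  let ?F = "\<lambda>R. fourier_L1 (truncate R u)"
  have gL: "g \<in> L2" and lim: "((\<lambda>R. L2_norm (\<lambda>\<xi>. ?F R \<xi> - g \<xi>)) \<longlongrightarrow> 0) at_top"
    using g is_fourier_L2_iff[OF u] by auto
  have W: "fourier_L1 w \<in> L2" by (rule plancherel_L1_L2[OF w(2,1)])
  show "((\<lambda>R. L2_norm (\<lambda>\<xi>. ?F R \<xi> - fourier_L1 w \<xi>)) \<longlongrightarrow> L2_norm (\<lambda>\<xi>. g \<xi> - fourier_L1 w \<xi>)) at_top"
    by (rule tendsto_L2_norm) (use gL lim W fourier_L1_truncate_L2[OF u] in \<open>auto intro: L2_diff\<close>)
  have "((\<lambda>R. L2_norm (\<lambda>x. truncate R u x - w x)) \<longlongrightarrow> L2_norm (\<lambda>x. u x - w x)) at_top"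
    by (rule tendsto_L2_norm) (use w u tendsto_L2_cball[OF u] in \<open>auto intro!: L2_diff\<close>)
  then show "((\<lambda>R. L2_norm (\<lambda>\<xi>. ?F R \<xi> - fourier_L1 w \<xi>)) \<longlongrightarrow> L2_norm (\<lambda>x. u x - w x)) at_top"
    using L2_norm_fourier_L1_diff[OF L2_cball_integrable[OF u] L2_truncate[OF u] w(2,1)] by simp
qed simp

lemma is_fourier_L2_norm:
  assumes "u \<in> L2" "is_fourier_L2 u g"
  shows "L2_norm g = L2_norm u"
  using is_fourier_L2_dist[OF assms L2_zero] by (simp add: fourier_L1_def)

lemma is_fourier_L2_add_cmult:
  assumes u: "u \<in> L2" "is_fourier_L2 u f" and w: "w \<in> L2" "is_fourier_L2 w g"
  shows "is_fourier_L2 (\<lambda>x. u x + c * w x) (\<lambda>\<xi>. f \<xi> + c * g \<xi>)"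
proof -
  have f: "f \<in> L2" and lf: "((\<lambda>R. L2_norm (\<lambda>\<xi>. fourier_L1 (truncate R u) \<xi> - f \<xi>)) \<longlongrightarrow> 0) at_top"
    using u is_fourier_L2_iff by auto
  have g: "g \<in> L2" and lg: "((\<lambda>R. L2_norm (\<lambda>\<xi>. fourier_L1 (truncate R w) \<xi> - g \<xi>)) \<longlongrightarrow> 0) at_top"
    using w is_fourier_L2_iff by auto
  have eq: "fourier_L1 (truncate R (\<lambda>x. u x + c * w x)) \<xi> - (f \<xi> + c * g \<xi>) 
     = (fourier_L1 (truncate R u) \<xi> - f \<xi>) + c * (fourier_L1 (truncate R w) \<xi> - g \<xi>)" for R \<xi>
    using fourier_L1_add_cmult[OF L2_cball_integrable[OF u(1)] L2_cball_integrable[OF w(1)], of R c R \<xi>]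
    by (simp add: algebra_simps)
  have "((\<lambda>R. L2_norm (\<lambda>\<xi>. fourier_L1 (truncate R (\<lambda>x. u x + c * w x)) \<xi> - (f \<xi> + c * g \<xi>))) \<longlongrightarrow> 0) at_top"
  proof (rule Lim_null_comparison[of _ "\<lambda>R. L2_norm (\<lambda>\<xi>. fourier_L1 (truncate R u) \<xi> - f \<xi>)
     + norm c * L2_norm (\<lambda>\<xi>. fourier_L1 (truncate R w) \<xi> - g \<xi>)"], rule always_eventually, rule allI)
    fix R
    show "norm (L2_norm (\<lambda>\<xi>. fourier_L1 (truncate R (\<lambda>x. u x + c * w x)) \<xi> - (f \<xi> + c * g \<xi>))) \<le>
       L2_norm (\<lambda>\<xi>. fourier_L1 (truncate R u) \<xi> - f \<xi>) + norm c * L2_norm (\<lambda>\<xi>. fourier_L1 (truncate R w) \<xi> - g \<xi>)"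
      unfolding eq using L2_norm_triangle[OF L2_diff[OF fourier_L1_truncate_L2[OF u(1)] f]
        L2_cmult[OF L2_diff[OF fourier_L1_truncate_L2[OF w(1)] g]], of R c R]
      by (simp add: L2_norm_cmult)
  qed (use tendsto_add[OF lf tendsto_mult[OF tendsto_const[of "norm c"] lg]] in simp)
  then show ?thesis
    using f g u w by (subst is_fourier_L2_iff) (auto intro: L2_add L2_cmult)
qed

lemma is_fourier_L2_diff:
  assumes "u \<in> L2" "is_fourier_L2 u f" "w \<in> L2" "is_fourier_L2 w g"
  shows "is_fourier_L2 (\<lambda>x. u x - w x) (\<lambda>\<xi>. f \<xi> - g \<xi>)"
  using is_fourier_L2_add_cmult[OF assms, of "-1"] by simp

lemma is_fourier_L2_cmult:
  assumes "u \<in> L2" "is_fourier_L2 u f"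
  shows "is_fourier_L2 (\<lambda>x. c * u x) (\<lambda>\<xi>. c * f \<xi>)"
  using is_fourier_L2_add_cmult[OF assms assms, of "c - 1"] by (simp add: algebra_simps)

text \<open>By linearity the difference is a transform of the zero function, and the isometry makes
  its norm vanish.\<close>

lemma is_fourier_L2_unique:
  assumes "u \<in> L2" "is_fourier_L2 u f" "is_fourier_L2 u g"
  shows "AE \<xi> in lborel. f \<xi> = g \<xi>"
proof -
  have d: "(\<lambda>\<xi>. f \<xi> - g \<xi>) \<in> L2" using assms by (auto dest: is_fourier_L2_L2)
  have "is_fourier_L2 (\<lambda>x. u x - u x) (\<lambda>\<xi>. f \<xi> - g \<xi>)"
    by (rule is_fourier_L2_diff) (use assms in auto)
  from is_fourier_L2_norm[OF _ this] have "L2_norm (\<lambda>\<xi>. f \<xi> - g \<xi>) = 0" by simp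
  from L2_norm_eq_0_AE[OF d this] show ?thesis by simp
qed

lemma is_fourier_L2_cong_AE:
  assumes uf: "is_fourier_L2 u f" and L: "u \<in> L2" "w \<in> L2" "g \<in> L2"
    and ae: "AE x in lborel. u x = w x" "AE \<xi> in lborel. f \<xi> = g \<xi>"
  shows "is_fourier_L2 w g"
proof -
  have f: "f \<in> L2" using uf by (rule is_fourier_L2_L2)
  have "fourier_L1 (truncate R u) = fourier_L1 (truncate R w)" for R
    using ae L2_measurable[OF L2_truncate[OF L(1)]] L2_measurable[OF L2_truncate[OF L(2)]]
    by (intro fourier_L1_cong_AE) auto
  moreover have "L2_norm (\<lambda>\<xi>. fourier_L1 (truncate R u) \<xi> - f \<xi>) = L2_norm (\<lambda>\<xi>. fourier_L1 (truncate R u) \<xi> - g \<xi>)" for R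
    using ae L2_measurable[OF L2_diff[OF fourier_L1_truncate_L2[OF L(1)] f]] 
      L2_measurable[OF L2_diff[OF fourier_L1_truncate_L2[OF L(1)] L(3)]]
    by (intro L2_norm_cong_AE) auto
  ultimately show ?thesis using uf L by (simp add: is_fourier_L2_iff)
qed

section \<open>Symmetries, exchange formula and inversion\<close>

lemma fourier_L1_reflect: "fourier_L1 (\<lambda>x. f (- x)) \<xi> = fourier_L1 f (- \<xi>)"
  using integral_reflect[of "\<lambda>x. cis (- ((- \<xi>) \<bullet> x)) * f x"] by (simp add: fourier_L1_def)

lemma fourier_L1_cnj: "fourier_L1 (\<lambda>x. cnj (f x)) \<xi> = cnj (fourier_L1 f (- \<xi>))"
proof -
  have "cnj (LINT x|lborel. cis (- ((- \<xi>) \<bullet> x)) * f x) = (LINT x|lborel. cnj (cis (- ((- \<xi>) \<bullet> x)) * f x))"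
    by (rule Bochner_Integration.integral_cnj[symmetric])
  then show ?thesis by (simp add: fourier_L1_def cis_cnj)
qed

lemma indicator_cball_uminus: "indicator (cball 0 R) (- x) = indicator (cball 0 R) (x::'a::euclidean_space)"
  by (simp add: indicator_def)

lemma is_fourier_L2_reflect:
  assumes u: "u \<in> L2" "is_fourier_L2 u f"
  shows "is_fourier_L2 (\<lambda>x. u (- x)) (\<lambda>\<xi>. f (- \<xi>))"
proof -
  have "fourier_L1 (truncate R (\<lambda>x. u (- x))) \<xi> = fourier_L1 (truncate R u) (- \<xi>)" for R \<xi>
    using fourier_L1_reflect[of "truncate R u" \<xi>] by (simp add: indicator_cball_uminus)
  moreover have "L2_norm (\<lambda>\<xi>. fourier_L1 (truncate R u) (- \<xi>) - f (- \<xi>)) = L2_norm (\<lambda>\<xi>. fourier_L1 (truncate R u) \<xi> - f \<xi>)" for R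
    using L2_norm_reflect[of "\<lambda>\<xi>. fourier_L1 (truncate R u) \<xi> - f \<xi>"] by simp
  ultimately show ?thesis
    using u by (simp add: is_fourier_L2_iff L2_reflect)
qed

lemma is_fourier_L2_cnj:
  assumes u: "u \<in> L2" "is_fourier_L2 u f"
  shows "is_fourier_L2 (\<lambda>x. cnj (u x)) (\<lambda>\<xi>. cnj (f (- \<xi>)))"
proof -
  have "fourier_L1 (truncate R (\<lambda>x. cnj (u x))) \<xi> = cnj (fourier_L1 (truncate R u) (- \<xi>))" for R \<xi>
  proof -
    have "truncate R (\<lambda>x. cnj (u x)) = (\<lambda>x. cnj (truncate R u x))" by (auto simp: indicator_def)
    then show ?thesis using fourier_L1_cnj[of "truncate R u" \<xi>] by simp
  qed
  moreover have "L2_norm (\<lambda>\<xi>. cnj (fourier_L1 (truncate R u) (- \<xi>)) - cnj (f (- \<xi>))) = L2_norm (\<lambda>\<xi>. fourier_L1 (truncate R u) \<xi> - f \<xi>)" for R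
    using L2_norm_reflect[of "\<lambda>\<xi>. fourier_L1 (truncate R u) \<xi> - f \<xi>"]
      L2_norm_cong_norm[OF complex_mod_cnj, of "\<lambda>\<xi>. fourier_L1 (truncate R u) (- \<xi>) - f (- \<xi>)"] by simp
  ultimately show ?thesis
    using u by (simp add: is_fourier_L2_iff L2_reflect L2_cnj)
qed

lemma is_fourier_L2_exchange:
  assumes u: "u \<in> L2" "is_fourier_L2 u f" and w: "w \<in> L2" "is_fourier_L2 w g"
  shows "(LINT x|lborel. f x * w x) = (LINT x|lborel. u x * g x)"
proof (rule tendsto_unique[of at_top])
  have f: "f \<in> L2" and lf: "((\<lambda>R. L2_norm (\<lambda>\<xi>. fourier_L1 (truncate R u) \<xi> - f \<xi>)) \<longlongrightarrow> 0) at_top"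
    using u is_fourier_L2_iff by auto
  have g: "g \<in> L2" and lg: "((\<lambda>R. L2_norm (\<lambda>\<xi>. fourier_L1 (truncate R w) \<xi> - g \<xi>)) \<longlongrightarrow> 0) at_top"
    using w is_fourier_L2_iff by auto
  show "((\<lambda>R. LINT x|lborel. fourier_L1 (truncate R u) x * truncate R w x) \<longlongrightarrow> (LINT x|lborel. f x * w x)) at_top"
    by (rule tendsto_L2_mult) (use u w f lf tendsto_L2_cball fourier_L1_truncate_L2 in auto)
  have "((\<lambda>R. LINT x|lborel. truncate R u x * fourier_L1 (truncate R w) x) \<longlongrightarrow> (LINT x|lborel. u x * g x)) at_top"
    by (rule tendsto_L2_mult) (use u w g lg tendsto_L2_cball fourier_L1_truncate_L2 in auto)
  moreover have "(LINT x|lborel. truncate R u x * fourier_L1 (truncate R w) x) = (LINT x|lborel. fourier_L1 (truncate R u) x * truncate R w x)" for R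
    using fourier_integral_exchange[OF L2_cball_integrable[OF u(1)] L2_cball_integrable[OF w(1)], of R R]
    by (simp add: fourier_L1_eq mult.assoc mult.left_commute[of _ "of_real _"])
  ultimately show "((\<lambda>R. LINT x|lborel. fourier_L1 (truncate R u) x * truncate R w x) \<longlongrightarrow> (LINT x|lborel. u x * g x)) at_top"
    by simp
qed simp

lemma L2_norm_diff_squared:
  assumes "u \<in> L2" "w \<in> L2"
  shows "(L2_norm (\<lambda>x. u x - w x))\<^sup>2 = (L2_norm u)\<^sup>2 + (L2_norm w)\<^sup>2 - 2 * Re (LINT x|lborel. u x * cnj (w x))"
proof -
  have i: "integrable lborel (\<lambda>x. u x * cnj (w x))"
    by (rule L2_mult_integrable[OF assms(1) L2_cnj[OF assms(2)]])
  have "(norm (u x - w x))\<^sup>2 = (norm (u x))\<^sup>2 + (norm (w x))\<^sup>2 - 2 * Re (u x * cnj (w x))" for x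
    using dot_norm_neg[of "u x" "w x"] by (simp add: inner_complex_def)
  then have "(L2_norm (\<lambda>x. u x - w x))\<^sup>2 = (LINT x|lborel. (norm (u x))\<^sup>2 + (norm (w x))\<^sup>2 - 2 * Re (u x * cnj (w x)))"
    unfolding L2_norm_squared by presburger
  also have "\<dots> = (L2_norm u)\<^sup>2 + (L2_norm w)\<^sup>2 - 2 * (LINT x|lborel. Re (u x * cnj (w x)))"
    unfolding L2_norm_squared using assms i by (simp add: L2_integrable integrable_Re del: Re_complex_of_real times_complex.sel)
  also have "(LINT x|lborel. Re (u x * cnj (w x))) = Re (LINT x|lborel. u x * cnj (w x))"
    by (rule integral_Re[OF i])
  finally show ?thesis .
qed

text \<open>If \<open>g\<close> is the transform of \<open>f\<close>, the exchange formula gives \<open>\<langle>g, u(-\<cdot>)\<rangle> = \<parallel>f\<parallel>\<^sup>2\<close>; as all the norms agree, \<open>g\<close> and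
  \<open>u(-\<cdot>)\<close> are at distance zero.\<close>

lemma is_fourier_L2_inversion:
  fixes u :: "'a::euclidean_space \<Rightarrow> complex"
  assumes u: "u \<in> L2" "is_fourier_L2 u f"
  shows "is_fourier_L2 f (\<lambda>x. u (- x))"
proof -
  have f: "f \<in> L2" using u(2) by (rule is_fourier_L2_L2)
  obtain g where g: "is_fourier_L2 f g" using is_fourier_L2_exists[OF f] by blast
  have gL: "g \<in> L2" using g by (rule is_fourier_L2_L2)
  have r: "is_fourier_L2 (\<lambda>x. cnj (u (- x))) (\<lambda>\<xi>. cnj (f \<xi>))"
    using is_fourier_L2_cnj[OF L2_reflect[OF u(1)] is_fourier_L2_reflect[OF u]] by simp
  have "(LINT x|lborel. g x * cnj (u (- x))) = (LINT x|lborel. f x * cnj (f x))"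
    by (rule is_fourier_L2_exchange[OF f g L2_cnj[OF L2_reflect[OF u(1)]] r])
  also have "\<dots> = (LINT x|lborel. complex_of_real ((norm (f x))\<^sup>2))"
    by (simp add: complex_norm_square del: of_real_power)
  also have "\<dots> = of_real ((L2_norm f)\<^sup>2)" unfolding L2_norm_squared by (rule integral_complex_of_real)
  finally have "(L2_norm (\<lambda>x. g x - u (- x)))\<^sup>2 = 0"
    unfolding L2_norm_diff_squared[OF gL L2_reflect[OF u(1)]] L2_norm_reflect
    using is_fourier_L2_norm[OF u] is_fourier_L2_norm[OF f g] by (simp del: of_real_power)
  then have "AE x in lborel. g x - u (- x) = 0"
    using L2_norm_eq_0_AE[OF L2_diff[OF gL L2_reflect[OF u(1)]]] by simp
  then have "AE x in lborel. g x = u (- x)" by simp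
  then show ?thesis by (intro is_fourier_L2_cong_AE[OF g f f]) (use u in auto)
qed

text \<open>By inversion, the reflected transform of \<open>f\<close> is a preimage of
  \<open>f\<close>.\<close>

lemma is_fourier_L2_surj:
  assumes f: "f \<in> L2"
  obtains u where "u \<in> L2" "is_fourier_L2 u f"
proof -
  obtain g where g: "is_fourier_L2 f g" using is_fourier_L2_exists[OF f] by blast
  have gL: "g \<in> L2" using g by (rule is_fourier_L2_L2)
  have "is_fourier_L2 (\<lambda>x. g (- x)) f"
    using is_fourier_L2_reflect[OF gL is_fourier_L2_inversion[OF f g]] by simp
  then show ?thesis using that L2_reflect[OF gL] by blast
qed

lemma is_fourier_L2_fourier_L2:
  assumes "u \<in> L2"
  shows "is_fourier_L2 u (fourier_L2 u)"
  unfolding fourier_L2_def using is_fourier_L2_exists[OF assms] by (metis someI)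

text \<open>Truncation to balls about the origin commutes with modulations but not with
  translations. The rule is therefore proved for the transform of the modulated \<open>f\<close>,
  and inversion turns it into the rule for translates of \<open>u\<close>.\<close>

lemma is_fourier_L2_translate:
  assumes u: "u \<in> L2" "is_fourier_L2 u f"
  shows "is_fourier_L2 (\<lambda>x. u (x + y)) (\<lambda>\<xi>. cis (\<xi> \<bullet> y) * f \<xi>)"
proof -
  have f: "f \<in> L2" using u(2) by (rule is_fourier_L2_L2)
  have fy: "(\<lambda>\<xi>. cis (\<xi> \<bullet> y) * f \<xi>) \<in> L2" by (rule L2_unimodular[OF f]) measurable
  have i: "is_fourier_L2 f (\<lambda>x. u (- x))" by (rule is_fourier_L2_inversion[OF u])
  have uy: "(\<lambda>x. u (y - x)) \<in> L2" using L2_affine[OF u(1), of "-1" y] by simp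
  have "fourier_L1 (truncate R (\<lambda>\<xi>. cis (\<xi> \<bullet> y) * f \<xi>)) x = fourier_L1 (truncate R f) (x + (- y))" for R x
  proof -
    have "cis (- (x \<bullet> \<xi>)) * (indicator (cball 0 R) \<xi> * (cis (\<xi> \<bullet> y) * f \<xi>)) = cis (- ((x + (- y)) \<bullet> \<xi>)) * (indicator (cball 0 R) \<xi> * f \<xi>)" for \<xi>
    proof -
      have "cis (- ((x + (- y)) \<bullet> \<xi>)) = cis (- (x \<bullet> \<xi>)) * cis (\<xi> \<bullet> y)"
        by (simp add: cis_mult inner_diff_left inner_commute[of y])
      then show ?thesis by simp
    qed
    then show ?thesis unfolding fourier_L1_def by presburger
  qed
  moreover have "L2_norm (\<lambda>x. fourier_L1 (truncate R f) (x + (- y)) - u (y - x)) = L2_norm (\<lambda>x. fourier_L1 (truncate R f) x - u (- x))" for R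
    using L2_norm_translate[of "\<lambda>x. fourier_L1 (truncate R f) x - u (- x)" "- y"] by simp
  ultimately have "is_fourier_L2 (\<lambda>\<xi>. cis (\<xi> \<bullet> y) * f \<xi>) (\<lambda>x. u (y - x))"
    using i is_fourier_L2_iff[OF f] is_fourier_L2_iff[OF fy] uy by simp
  from is_fourier_L2_reflect[OF uy is_fourier_L2_inversion[OF fy this]]
  show ?thesis by (simp add: add.commute)
qed

lemma L2_norm_dilate:
  fixes u :: "'a::euclidean_space \<Rightarrow> complex"
  assumes "c > 0"
  shows "(L2_norm (\<lambda>x. u (c *\<^sub>R x)))\<^sup>2 = (L2_norm u)\<^sup>2 / c ^ DIM('a)"
  using integral_affine[of c "\<lambda>x. (norm (u x))\<^sup>2" 0] assms by (simp add: L2_norm_squared)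

text \<open>Dilation carries the truncation at radius \<open>R / c\<close> to the one at radius
  \<open>R\<close>, and both radii tend to infinity together.\<close>

lemma is_fourier_L2_dilate:
  fixes u :: "'a::euclidean_space \<Rightarrow> complex"
  assumes u: "u \<in> L2" "is_fourier_L2 u f" and c: "c > 0"
  shows "is_fourier_L2 (\<lambda>x. u ((1 / c) *\<^sub>R x)) (\<lambda>\<xi>. of_real (c ^ DIM('a)) * f (c *\<^sub>R \<xi>))"
proof -
  have f: "f \<in> L2" and lf: "((\<lambda>R. L2_norm (\<lambda>\<xi>. fourier_L1 (truncate R u) \<xi> - f \<xi>)) \<longlongrightarrow> 0) at_top"
    using u is_fourier_L2_iff by auto
  have ud: "(\<lambda>x. u ((1 / c) *\<^sub>R x)) \<in> L2" using L2_affine[OF u(1), of "1/c" 0] c by simp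
  have fd: "(\<lambda>\<xi>. of_real (c ^ DIM('a)) * f (c *\<^sub>R \<xi>)) \<in> L2" using L2_affine[OF f, of "c" 0] c by auto
  have eq: "fourier_L1 (truncate R (\<lambda>x. u ((1 / c) *\<^sub>R x))) \<xi> = of_real (c ^ DIM('a)) * fourier_L1 (truncate (R / c) u) (c *\<^sub>R \<xi>)" for R \<xi>
  proof -
    have "cis (- (\<xi> \<bullet> (0 + c *\<^sub>R x))) * truncate R (\<lambda>x. u ((1 / c) *\<^sub>R x)) (0 + c *\<^sub>R x) = cis (- ((c *\<^sub>R \<xi>) \<bullet> x)) * truncate (R / c) u x" for x
      using c by (auto simp: indicator_def field_simps)
    moreover have "(LINT x|lborel. cis (- (\<xi> \<bullet> x)) * truncate R (\<lambda>x. u ((1 / c) *\<^sub>R x)) x) = \<bar>c\<bar> ^ DIM('a) *\<^sub>R (LINT x|lborel. cis (- (\<xi> \<bullet> (0 + c *\<^sub>R x))) * truncate R (\<lambda>x. u ((1 / c) *\<^sub>R x)) (0 + c *\<^sub>R x))"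
      using c by (intro integral_affine) auto
    ultimately show ?thesis
      unfolding fourier_L1_def using c by (simp only:) (simp add: scaleR_conv_of_real)
  qed
  have n: "L2_norm (\<lambda>\<xi>. fourier_L1 (truncate R (\<lambda>x. u ((1 / c) *\<^sub>R x))) \<xi> - of_real (c ^ DIM('a)) * f (c *\<^sub>R \<xi>))
     = sqrt (c ^ DIM('a)) * L2_norm (\<lambda>\<xi>. fourier_L1 (truncate (R / c) u) \<xi> - f \<xi>)" for R
  proof -
    have "L2_norm (\<lambda>\<xi>. fourier_L1 (truncate R (\<lambda>x. u ((1 / c) *\<^sub>R x))) \<xi> - of_real (c ^ DIM('a)) * f (c *\<^sub>R \<xi>))
      = c ^ DIM('a) * L2_norm (\<lambda>\<xi>. fourier_L1 (truncate (R / c) u) (c *\<^sub>R \<xi>) - f (c *\<^sub>R \<xi>))"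
      using L2_norm_cmult[of "of_real (c ^ DIM('a))" "\<lambda>\<xi>. fourier_L1 (truncate (R / c) u) (c *\<^sub>R \<xi>) - f (c *\<^sub>R \<xi>)"] c
      by (simp add: eq right_diff_distrib norm_power)
    also have "L2_norm (\<lambda>\<xi>. fourier_L1 (truncate (R / c) u) (c *\<^sub>R \<xi>) - f (c *\<^sub>R \<xi>)) = sqrt ((L2_norm (\<lambda>\<xi>. fourier_L1 (truncate (R / c) u) \<xi> - f \<xi>))\<^sup>2 / c ^ DIM('a))"
      using L2_norm_dilate[OF c, of "\<lambda>\<xi>. fourier_L1 (truncate (R / c) u) \<xi> - f \<xi>"]
      by (intro real_sqrt_unique[symmetric]) auto
    also have "c ^ DIM('a) * \<dots> = sqrt (c ^ DIM('a)) * L2_norm (\<lambda>\<xi>. fourier_L1 (truncate (R / c) u) \<xi> - f \<xi>)"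
    proof -
      have "c ^ DIM('a) * (N / sqrt (c ^ DIM('a))) = sqrt (c ^ DIM('a)) * N" for N
        using real_div_sqrt[of "c ^ DIM('a)"] c
        by (metis less_imp_le mult.commute times_divide_eq_right zero_less_power)
      then show ?thesis by (simp add: real_sqrt_divide)
    qed
    finally show ?thesis .
  qed
  have "filterlim (\<lambda>R::real. (1 / c) * R) at_top at_top"
    using c by (intro filterlim_tendsto_pos_mult_at_top[OF tendsto_const _ filterlim_ident]) auto
  then have "((\<lambda>R. L2_norm (\<lambda>\<xi>. fourier_L1 (truncate (R / c) u) \<xi> - f \<xi>)) \<longlongrightarrow> 0) at_top"
    using filterlim_compose[OF lf, of "\<lambda>R. (1 / c) * R" at_top] by simp
  from tendsto_mult[OF tendsto_const[of "sqrt (c ^ DIM('a))"] this]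
  show ?thesis unfolding is_fourier_L2_iff[OF ud] n using fd by simp
qed

text \<open>The inverse transform of \<open>f\<close> restricted to \<open>|\<xi>| \<le> A\<close>. Being an absolutely convergent integral, it has
  pointwise values.\<close>

definition lowpass :: "('a::euclidean_space \<Rightarrow> complex) \<Rightarrow> real \<Rightarrow> 'a \<Rightarrow> complex" where
  "lowpass f A x = fourier_L1 (truncate A f) (- x)"

lemma is_fourier_L2_lowpass:
  assumes f: "f \<in> L2"
  shows "lowpass f A \<in> L2" "is_fourier_L2 (lowpass f A) (truncate A f)"
proof -
  have F: "fourier_L1 (truncate A f) \<in> L2" by (rule fourier_L1_truncate_L2[OF f])
  \<comment> \<open>Truncations of a function supported in a ball become stationary, so its L^1
    transform is also its L^2 transform.\<close>
  have "truncate R (truncate A f) = truncate A f" if "A \<le> R" for R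
    using that by (auto simp: indicator_def)
  then have "is_fourier_L2 (truncate A f) (fourier_L1 (truncate A f))"
    unfolding is_fourier_L2_iff[OF L2_truncate[OF f]] using F
    by (intro conjI tendsto_eventually eventually_mono[OF eventually_ge_at_top[of A]]) auto
  from is_fourier_L2_reflect[OF F is_fourier_L2_inversion[OF L2_truncate[OF f] this]]
  show "is_fourier_L2 (lowpass f A) (truncate A f)" by (simp add: lowpass_def[abs_def])
  show "lowpass f A \<in> L2" unfolding lowpass_def[abs_def] by (rule L2_reflect[OF F])
qed

section \<open>Weak compactness in \<open>L\<^sup>2\<close>\<close>

text \<open>Dyadic convex combinations of the tail from \<open>N\<close> on. Closure under midpoints
  is exactly what the parallelogram law requires.\<close>

inductive midpoint_hull :: "(nat \<Rightarrow> 'a \<Rightarrow> complex) \<Rightarrow> nat \<Rightarrow> ('a \<Rightarrow> complex) \<Rightarrow> bool" for f N where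
  generator: "n \<ge> N \<Longrightarrow> midpoint_hull f N (f n)"
| midpoint: "midpoint_hull f N c \<Longrightarrow> midpoint_hull f N c' \<Longrightarrow> midpoint_hull f N (\<lambda>x. 1/2 * (c x + c' x))"

lemma midpoint_hull_mono:
  assumes "midpoint_hull f N c" "N' \<le> N"
  shows "midpoint_hull f N' c"
  using assms
proof induction
  case (generator n)
  then show ?case by (intro midpoint_hull.generator) simp
next
  case (midpoint c c')
  then show ?case by (intro midpoint_hull.midpoint) auto
qed

lemma midpoint_hull_L2:
  assumes "midpoint_hull f N c" "\<And>n. f n \<in> L2"
  shows "c \<in> L2"
  using assms
proof induction
  case (midpoint c c')
  then show ?case by (intro L2_cmult L2_add) auto
qed auto

text \<open>The functions whose pairing with \<open>h\<close> lies within \<open>e\<close> of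
  \<open>L\<close> form a convex set, so an estimate on the tail extends to its hull.\<close>

lemma midpoint_hull_integral:
  assumes "midpoint_hull f N c" and f: "\<And>n. f n \<in> L2" and h: "h \<in> L2"
    and b: "\<And>n. n \<ge> N \<Longrightarrow> norm ((LINT x|lborel. f n x * h x) - L) \<le> e"
  shows "norm ((LINT x|lborel. c x * h x) - L) \<le> e"
  using assms(1)
proof induction
  case (midpoint c c')
  have i: "integrable lborel (\<lambda>x. c x * h x)" "integrable lborel (\<lambda>x. c' x * h x)"
    using midpoint_hull_L2[OF midpoint(1) f] midpoint_hull_L2[OF midpoint(2) f] h by (auto intro: L2_mult_integrable)
  have "1/2 * (c x + c' x) * h x = 1/2 * (c x * h x) + 1/2 * (c' x * h x)" for x
    by (simp add: field_simps)
  then have "(LINT x|lborel. 1/2 * (c x + c' x) * h x) = (LINT x|lborel. 1/2 * (c x * h x) + 1/2 * (c' x * h x))"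
    by presburger
  also have "\<dots> = 1/2 * (LINT x|lborel. c x * h x) + 1/2 * (LINT x|lborel. c' x * h x)"
    using i by (simp del: times_divide_eq_left)
  finally have "(LINT x|lborel. 1/2 * (c x + c' x) * h x) - L
      = 1/2 * ((LINT x|lborel. c x * h x) - L) + 1/2 * ((LINT x|lborel. c' x * h x) - L)"
    by (simp add: field_simps)
  also have "norm \<dots> \<le> 1/2 * norm ((LINT x|lborel. c x * h x) - L) + 1/2 * norm ((LINT x|lborel. c' x * h x) - L)"
    by (rule order_trans[OF norm_triangle_ineq]) (simp add: norm_mult)
  also have "\<dots> \<le> e" using midpoint.IH by simp
  finally show ?case .
qed (use b in auto)

lemma L2_parallelogram:
  assumes "u \<in> L2" "w \<in> L2"
  shows "(L2_norm (\<lambda>x. u x - w x))\<^sup>2 = 2 * (L2_norm u)\<^sup>2 + 2 * (L2_norm w)\<^sup>2 - 4 * (L2_norm (\<lambda>x. 1/2 * (u x + w x)))\<^sup>2"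
proof -
  have "(norm (u x - w x))\<^sup>2 = 2 * (norm (u x))\<^sup>2 + 2 * (norm (w x))\<^sup>2 - (norm (u x + w x))\<^sup>2" for x
    unfolding cmod_power2 by (simp add: power2_eq_square algebra_simps)
  then have "(L2_norm (\<lambda>x. u x - w x))\<^sup>2 = (LINT x|lborel. 2 * (norm (u x))\<^sup>2 + 2 * (norm (w x))\<^sup>2 - (norm (u x + w x))\<^sup>2)"
    unfolding L2_norm_squared by presburger
  also have "\<dots> = 2 * (L2_norm u)\<^sup>2 + 2 * (L2_norm w)\<^sup>2 - (L2_norm (\<lambda>x. u x + w x))\<^sup>2"
    unfolding L2_norm_squared using assms L2_integrable[OF L2_add[OF assms]] by (simp add: L2_integrable)
  finally show ?thesis
    unfolding L2_norm_cmult by (simp add: power_mult_distrib power2_eq_square)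
qed

text \<open>Elements of almost minimal norm in the midpoint hulls of the tails form a Cauchy sequence, by the
  parallelogram law. Its limit inherits the limit of every functional that converges along the
  sequence, which avoids the Riesz representation theorem.\<close>

lemma L2_mean_limit:
  fixes f :: "nat \<Rightarrow> 'a::euclidean_space \<Rightarrow> complex"
  assumes f: "\<And>n. f n \<in> L2" and M: "\<And>n. L2_norm (f n) \<le> M"
  obtains g where "g \<in> L2"
    "\<And>h L. h \<in> L2 \<Longrightarrow> (\<lambda>n. LINT x|lborel. f n x * h x) \<longlonglongrightarrow> L \<Longrightarrow> (LINT x|lborel. g x * h x) = L"
proof -
  \<comment> \<open>The hulls shrink as \<open>N\<close> grows, so these infima increase; they are
    bounded by \<open>M\<close> and hence converge.\<close>
  define d where "d N = Inf (L2_norm ` {c. midpoint_hull f N c})" for N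
  have ne: "{c. midpoint_hull f N c} \<noteq> {}" for N using midpoint_hull.generator[of N N f] by auto
  have bdd: "bdd_below (L2_norm ` {c. midpoint_hull f N c})" for N
    by (rule bdd_belowI[of _ 0]) auto
  have d_le: "d N \<le> L2_norm c" if "midpoint_hull f N c" for N c
    unfolding d_def using that bdd by (intro cInf_lower) auto
  have d_mono: "d N \<le> d N'" if "N \<le> N'" for N N'
    unfolding d_def using that midpoint_hull_mono[of f N' _ N] by (intro cInf_superset_mono image_mono bdd) (use ne in auto)
  have d_M: "d N \<le> M" for N using d_le[OF midpoint_hull.generator[of N N f]] M[of N] by simp
  have d_0: "0 \<le> d N" for N unfolding d_def using ne by (intro cInf_greatest) auto
  have "incseq d" using d_mono by (simp add: incseq_def)
  from incseq_convergent[OF this, of M] d_M obtain D where D: "d \<longlonglongrightarrow> D" "\<And>N. d N \<le> D" by auto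
  have "\<exists>c. midpoint_hull f N c \<and> L2_norm c < d N + 1 / real (Suc N)" for N
  proof -
    have "Inf (L2_norm ` {c. midpoint_hull f N c}) < d N + 1 / real (Suc N)" by (simp add: d_def)
    from cInf_lessD[OF _ this] ne show ?thesis by auto
  qed
  then obtain c where c: "\<And>N. midpoint_hull f N (c N)" "\<And>N. L2_norm (c N) < d N + 1 / real (Suc N)" by metis
  have cL: "c N \<in> L2" for N by (rule midpoint_hull_L2[OF c(1) f])
  define \<epsilon> where "\<epsilon> N = 4 * (D + 1 / real (Suc N))\<^sup>2 - 4 * (d N)\<^sup>2" for N
  have "(\<lambda>N. D + 1 / real (Suc N)) \<longlonglongrightarrow> D + 0"
    by (intro tendsto_intros LIMSEQ_Suc[OF lim_1_over_n])
  then have \<epsilon>0: "\<epsilon> \<longlonglongrightarrow> 4 * D\<^sup>2 - 4 * D\<^sup>2" unfolding \<epsilon>_def by (intro tendsto_intros D) simp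
  \<comment> \<open>The midpoint of two elements stays in the hull, so its norm is at least
    \<open>d N\<close>, while both elements have norm at most D + 1 / (N + 1).\<close>
  have est: "(L2_norm (\<lambda>x. c m x - c n x))\<^sup>2 \<le> \<epsilon> N" if "N \<le> m" "N \<le> n" for m n N
  proof -
    have b: "(L2_norm (c k))\<^sup>2 \<le> (D + 1 / real (Suc N))\<^sup>2" if "N \<le> k" for k
    proof (intro power_mono L2_norm_nonneg)
      have "1 / real (Suc k) \<le> 1 / real (Suc N)" using that by (simp add: divide_simps)
      then show "L2_norm (c k) \<le> D + 1 / real (Suc N)" using c(2)[of k] D(2)[of k] by linarith
    qed
    have "midpoint_hull f N (\<lambda>x. 1/2 * (c m x + c n x))"
      using that by (intro midpoint_hull.midpoint midpoint_hull_mono[OF c(1)]) auto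
    then have "(d N)\<^sup>2 \<le> (L2_norm (\<lambda>x. 1/2 * (c m x + c n x)))\<^sup>2" using d_0 d_le by (intro power_mono) auto
    then show ?thesis unfolding L2_parallelogram[OF cL cL] \<epsilon>_def using b[OF that(1)] b[OF that(2)] by linarith
  qed
  obtain g where g: "g \<in> L2" "(\<lambda>N. L2_norm (\<lambda>x. c N x - g x)) \<longlonglongrightarrow> 0"
  proof (rule L2_complete[OF cL])
    fix e :: real assume "e > 0"
    then have "e\<^sup>2 > 0" by simp
    then obtain N where N: "\<epsilon> N < e\<^sup>2" using order_tendstoD(2)[OF \<epsilon>0, of "e\<^sup>2"] by (auto simp: eventually_sequentially)
    show "\<exists>N. \<forall>m\<ge>N. \<forall>n\<ge>N. L2_norm (\<lambda>x. c m x - c n x) < e"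
    proof (intro exI[of _ N] allI impI)
      fix m n assume "N \<le> m" "N \<le> n"
      from est[OF this] N have "(L2_norm (\<lambda>x. c m x - c n x))\<^sup>2 < e\<^sup>2" by simp
      then show "L2_norm (\<lambda>x. c m x - c n x) < e" using \<open>e > 0\<close> by (simp add: power2_less_imp_less)
    qed
  qed auto
  show ?thesis
  proof (rule that[OF g(1)])
    fix h L assume h: "h \<in> L2" and lim: "(\<lambda>n. LINT x|lborel. f n x * h x) \<longlonglongrightarrow> L"
    have "(\<lambda>N. LINT x|lborel. c N x * h x) \<longlonglongrightarrow> (LINT x|lborel. g x * h x)"
      by (rule tendsto_L2_mult[of c g "\<lambda>_. h" h]) (use cL g h in auto)
    moreover have "(\<lambda>N. LINT x|lborel. c N x * h x) \<longlonglongrightarrow> L"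
    proof (rule LIMSEQ_I)
      fix e :: real assume "e > 0"
      then obtain N where N: "\<And>n. n \<ge> N \<Longrightarrow> norm ((LINT x|lborel. f n x * h x) - L) < e/2"
        using LIMSEQ_D[OF lim, of "e/2"] by auto
      have "norm ((LINT x|lborel. c n x * h x) - L) \<le> e/2" if "n \<ge> N" for n
        using that N by (intro midpoint_hull_integral[OF c(1) f h]) (meson less_imp_le order_trans)
      then show "\<exists>no. \<forall>n\<ge>no. norm ((LINT x|lborel. c n x * h x) - L) < e"
        using \<open>e > 0\<close> by (intro exI[of _ N] allI impI) (smt (verit) field_sum_of_halves)
    qed
    ultimately show "(LINT x|lborel. g x * h x) = L" by (rule LIMSEQ_unique)
  qed
qed

text \<open>A diagonal extraction makes the pairings with the members of the sequence converge. This
  already forces convergence against every \<open>h\<close>: a subsequence violating it would have a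
  mean limit of its own, and the difference of the two mean limits would be orthogonal to
  itself.\<close>

lemma L2_weakly_compact:
  fixes f :: "nat \<Rightarrow> 'a::euclidean_space \<Rightarrow> complex"
  assumes f: "\<And>n. f n \<in> L2" and M: "\<And>n. L2_norm (f n) \<le> M"
  obtains g r where "strict_mono r" "g \<in> L2"
    "\<And>h. h \<in> L2 \<Longrightarrow> (\<lambda>n. LINT x|lborel. f (r n) x * h x) \<longlonglongrightarrow> (LINT x|lborel. g x * h x)"
proof -
  have M0: "0 \<le> M" using M[of 0] L2_norm_nonneg[of "f 0"] by linarith
  have cn: "L2_norm (\<lambda>x. cnj (u x)) = L2_norm u" for u :: "'a \<Rightarrow> complex"
    by (rule L2_norm_cong_norm) simp
  \<comment> \<open>The countable family of test functions is the original sequence itself, which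
    takes the place of a countable dense set.\<close>
  obtain r where r: "strict_mono (r :: nat \<Rightarrow> nat)"
    and conv: "\<And>k. \<exists>l. (\<lambda>n. LINT x|lborel. f (r n) x * cnj (f k x)) \<longlonglongrightarrow> l"
  proof (rule function_convergent_subsequence[of "UNIV :: nat set" "\<lambda>n k. LINT x|lborel. f n x * cnj (f k x)" "M * M"])
    fix n k
    have "norm (LINT x|lborel. f n x * cnj (f k x)) \<le> L2_norm (f n) * L2_norm (f k)"
      using L2_Cauchy_Schwarz[OF f L2_cnj[OF f], of n k] by (simp add: cn)
    also have "\<dots> \<le> M * M" using M M0 by (intro mult_mono) auto
    finally show "norm (LINT x|lborel. f n x * cnj (f k x)) \<le> M * M" .
  qed auto
  define F where "F = (\<lambda>n. f (r n))"
  have F: "F n \<in> L2" "L2_norm (F n) \<le> M" for n using f M by (auto simp: F_def)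
  obtain g where g: "g \<in> L2"
    and gl: "\<And>h L. h \<in> L2 \<Longrightarrow> (\<lambda>n. LINT x|lborel. F n x * h x) \<longlonglongrightarrow> L \<Longrightarrow> (LINT x|lborel. g x * h x) = L"
    by (rule L2_mean_limit[of F M, OF F]) (rule that)
  have "(\<lambda>n. LINT x|lborel. F n x * h x) \<longlonglongrightarrow> (LINT x|lborel. g x * h x)" if h: "h \<in> L2" for h
  proof (rule ccontr)
    let ?X = "\<lambda>n. LINT x|lborel. F n x * h x" and ?L = "LINT x|lborel. g x * h x"
    assume "\<not> ?X \<longlonglongrightarrow> ?L"
    then obtain e where e: "e > 0" "\<not> (\<forall>\<^sub>F n in sequentially. dist (?X n) ?L < e)"
      by (auto simp: tendsto_iff)
    then have "\<exists>\<^sub>F n in sequentially. dist (?X n) ?L \<ge> e"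
      by (simp add: frequently_def not_le)
    then have "infinite {n. dist (?X n) ?L \<ge> e}" by (simp add: cofinite_eq_sequentially[symmetric] frequently_cofinite)
    from infinite_enumerate[OF this] obtain s where s: "strict_mono (s :: nat \<Rightarrow> nat)" "\<And>n. dist (?X (s n)) ?L \<ge> e" by auto
    have "bounded (range (\<lambda>n. ?X (s n)))"
    proof (rule boundedI, clarify)
      fix n
      have "norm (?X (s n)) \<le> L2_norm (F (s n)) * L2_norm h" by (rule L2_Cauchy_Schwarz[OF F(1) h])
      also have "\<dots> \<le> M * L2_norm h" using F by (intro mult_right_mono) auto
      finally show "norm (?X (s n)) \<le> M * L2_norm h" .
    qed
    from bounded_imp_convergent_subsequence[OF this] obtain L' t where
      t: "strict_mono (t :: nat \<Rightarrow> nat)" "((\<lambda>n. ?X (s n)) \<circ> t) \<longlonglongrightarrow> L'" by auto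
    define F' where "F' = (\<lambda>n. F (s (t n)))"
    have F': "F' n \<in> L2" "L2_norm (F' n) \<le> M" for n using F by (auto simp: F'_def)
    obtain g' where g': "g' \<in> L2"
      and gl': "\<And>h L. h \<in> L2 \<Longrightarrow> (\<lambda>n. LINT x|lborel. F' n x * h x) \<longlonglongrightarrow> L \<Longrightarrow> (LINT x|lborel. g' x * h x) = L"
      by (rule L2_mean_limit[of F' M, OF F']) (rule that)
    have L': "(LINT x|lborel. g' x * h x) = L'"
      using t(2) by (intro gl'[OF h]) (simp add: F'_def o_def)
    define w where "w x = g' x - g x" for x
    have w: "w \<in> L2" unfolding w_def using g g' by auto
    \<comment> \<open>Both mean limits have the same pairing with each \<open>cnj (F k)\<close>.
      Their difference \<open>w\<close> is thus orthogonal to the whole sequence, and this property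
      passes to the mean limits and so to \<open>w\<close>.\<close>
    have ortho: "(LINT x|lborel. F k x * cnj (w x)) = 0" for k
    proof -
      obtain l where l: "(\<lambda>n. LINT x|lborel. F n x * cnj (F k x)) \<longlonglongrightarrow> l"
        using conv[of "r k"] by (auto simp: F_def)
      have "strict_mono (\<lambda>n. s (t n))" using s(1) t(1) by (auto simp: strict_mono_def)
      from LIMSEQ_subseq_LIMSEQ[OF l this] have "(\<lambda>n. LINT x|lborel. F' n x * cnj (F k x)) \<longlonglongrightarrow> l"
        by (simp add: F'_def o_def)
      then have "(LINT x|lborel. g' x * cnj (F k x)) = l" by (rule gl'[OF L2_cnj[OF F(1)]])
      moreover have "(LINT x|lborel. g x * cnj (F k x)) = l" by (rule gl[OF L2_cnj[OF F(1)] l])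
      ultimately have "(LINT x|lborel. w x * cnj (F k x)) = 0"
        unfolding w_def using g g' F(1) by (simp add: left_diff_distrib L2_mult_integrable L2_cnj)
      then have "cnj (LINT x|lborel. w x * cnj (F k x)) = 0" by simp
      also have "cnj (LINT x|lborel. w x * cnj (F k x)) = (LINT x|lborel. cnj (w x * cnj (F k x)))"
        by (rule Bochner_Integration.integral_cnj[symmetric])
      finally show ?thesis by (simp add: mult.commute)
    qed
    have "(LINT x|lborel. g x * cnj (w x)) = 0"
      by (rule gl[OF L2_cnj[OF w]]) (simp add: ortho)
    moreover have "(LINT x|lborel. g' x * cnj (w x)) = 0"
      by (rule gl'[OF L2_cnj[OF w]]) (simp add: ortho F'_def)
    ultimately have "(LINT x|lborel. w x * cnj (w x)) = 0"
      unfolding w_def using g g' by (simp add: left_diff_distrib L2_mult_integrable L2_cnj L2_diff)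
    also have "(LINT x|lborel. w x * cnj (w x)) = (LINT x|lborel. complex_of_real ((norm (w x))\<^sup>2))"
      by (simp add: complex_norm_square del: of_real_power)
    also have "\<dots> = of_real ((L2_norm w)\<^sup>2)" unfolding L2_norm_squared by (rule integral_complex_of_real)
    finally have "L2_norm w = 0" by simp
    then have "AE x in lborel. g' x = g x" using L2_norm_eq_0_AE[OF w] by (auto simp: w_def)
    then have "?L = (LINT x|lborel. g' x * h x)"
      using g g' h by (intro integral_cong_AE borel_measurable_times) (auto dest: L2_measurable)
    then have "?L = L'" using L' by simp
    have "\<forall>\<^sub>F n in sequentially. dist (?X (s (t n))) L' < e" using tendstoD[OF t(2) e(1)] by simp
    then obtain n where "dist (?X (s (t n))) L' < e" by (auto simp: eventually_sequentially)
    with s(2)[of "t n"] \<open>?L = L'\<close> show False by simp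
  qed
  then show ?thesis using that r g unfolding F_def by blast
qed

section \<open>Gagliardo-Nirenberg inequalities\<close>

lemma nn_integral_powr_Ioo:
  fixes a r :: real
  assumes r: "r > 0" and a: "a \<ge> 0"
  shows "(\<integral>\<^sup>+t. (if 0 < t \<and> t < a then ennreal (t powr (r - 1)) else 0) \<partial>lborel) = ennreal (a powr r / r)"
proof -
  have "(\<integral>\<^sup>+t. (if 0 < t \<and> t < a then ennreal (t powr (r - 1)) else 0) \<partial>lborel) = (\<integral>\<^sup>+t. ennreal (t powr (r - 1)) * indicator {0..a} t \<partial>lborel)"
    by (intro nn_integral_cong_AE) (use AE_lborel_singleton[of 0] AE_lborel_singleton[of a] in eventually_elim, auto simp: indicator_def)
  also have "\<dots> = ennreal (a powr r / r)"
    using has_integral_powr_from_0[of "r - 1" a] r a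
    by (intro nn_integral_has_integral_lebesgue') auto
  finally show ?thesis .
qed

text \<open>At height \<open>t\<close>, the function is cut at the frequency \<open>A(t)\<close> where the low part is bounded by \<open>t / 2\<close>. The set
  \<open>|u| > t\<close> is then controlled by the high part alone, and integrating Chebyshev's inequality over \<open>t\<close>
  produces the weight \<open>|\<xi>|\<close> to the power \<open>\<gamma> (s - 2)\<close>.\<close>

lemma chemin_xu:
  fixes u f :: "'a::euclidean_space \<Rightarrow> complex"
  assumes u: "u \<in> L2" "is_fourier_L2 u f" and K: "K > 0" and \<gamma>: "\<gamma> > 0" and s: "s > 2"
    and low: "\<And>A x. A > 0 \<Longrightarrow> norm (lowpass f A x) \<le> K * A powr \<gamma>"
  shows "(\<integral>\<^sup>+x. ennreal (norm (u x) powr s) \<partial>lborel)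
    \<le> ennreal (4 * s / (s - 2) * (2 * K) powr (s - 2)) * (\<integral>\<^sup>+\<xi>. ennreal (norm \<xi> powr (\<gamma> * (s - 2)) * (norm (f \<xi>))\<^sup>2) \<partial>lborel)"
proof -
  have f: "f \<in> L2" using u(2) by (rule is_fourier_L2_L2)
  note u(1)[THEN L2_measurable, measurable] f[THEN L2_measurable, measurable]
  define A where "A t = (t / (2 * K)) powr (1 / \<gamma>)" for t :: real
  have A_less: "A t < r \<longleftrightarrow> t < 2 * K * r powr \<gamma>" if "t > 0" "r \<ge> 0" for t r
  proof -
    have "A t \<ge> 0" by (simp add: A_def)
    then have "A t < r \<longleftrightarrow> A t powr \<gamma> < r powr \<gamma>"
      using powr_less_mono2[of \<gamma> "A t" r] powr_mono2[of \<gamma> r "A t"] \<gamma> that by (auto simp: not_less[symmetric])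
    also have "A t powr \<gamma> = t / (2 * K)" using \<gamma> K that by (simp add: A_def powr_powr)
    finally show ?thesis using K by (simp add: field_simps)
  qed
  have tail: "emeasure lborel {x \<in> space lborel. t < norm (u x)} \<le> ennreal (4 / t\<^sup>2) * (\<integral>\<^sup>+\<xi>. ennreal ((norm (f \<xi>))\<^sup>2) * indicator {\<xi>. t < 2 * K * norm \<xi> powr \<gamma>} \<xi> \<partial>lborel)"
    if l: "t > 0" for t
  proof -
    have A0: "A t > 0" using l K by (simp add: A_def)
    define h where "h x = u x - lowpass f (A t) x" for x
    have hL: "h \<in> L2" unfolding h_def by (intro L2_diff u is_fourier_L2_lowpass(1) f)
    note hL[THEN L2_measurable, measurable]
    have hF: "is_fourier_L2 h (\<lambda>\<xi>. f \<xi> - truncate (A t) f \<xi>)"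
      unfolding h_def by (intro is_fourier_L2_diff u is_fourier_L2_lowpass f)
    have "t / 2 < norm (h x)" if "t < norm (u x)" for x
    proof -
      have "norm (lowpass f (A t) x) \<le> K * A t powr \<gamma>" by (rule low[OF A0])
      also have "\<dots> = t / 2" using \<gamma> K l by (simp add: A_def powr_powr)
      finally show ?thesis using that norm_triangle_ineq2[of "u x" "lowpass f (A t) x"] by (simp add: h_def)
    qed
    then have "emeasure lborel {x \<in> space lborel. t < norm (u x)} \<le> emeasure lborel ({x \<in> space lborel. 1 \<le> ennreal (4 / t\<^sup>2) * ennreal ((norm (h x))\<^sup>2)} \<inter> UNIV)"
    proof (intro emeasure_mono subsetI)
      fix x assume a: "\<And>x. t < norm (u x) \<Longrightarrow> t / 2 < norm (h x)" "x \<in> {x \<in> space lborel. t < norm (u x)}"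
      then have "(t / 2)\<^sup>2 \<le> (norm (h x))\<^sup>2" using l by (intro power_mono) (auto intro: less_imp_le)
      then have "1 \<le> 4 / t\<^sup>2 * (norm (h x))\<^sup>2" using l by (simp add: field_simps power2_eq_square)
      then have "ennreal 1 \<le> ennreal (4 / t\<^sup>2 * (norm (h x))\<^sup>2)" by (rule ennreal_leI)
      also have "\<dots> = ennreal (4 / t\<^sup>2) * ennreal ((norm (h x))\<^sup>2)" by (rule ennreal_mult) auto
      finally have "1 \<le> ennreal (4 / t\<^sup>2) * ennreal ((norm (h x))\<^sup>2)" by (simp only: ennreal_1)
      then show "x \<in> {x \<in> space lborel. 1 \<le> ennreal (4 / t\<^sup>2) * ennreal ((norm (h x))\<^sup>2)} \<inter> UNIV"
        by (intro IntI CollectI conjI) (simp_all only: space_lborel space_borel UNIV_I)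
    qed measurable
    also have "\<dots> \<le> ennreal (4 / t\<^sup>2) * (\<integral>\<^sup>+x. ennreal ((norm (h x))\<^sup>2) * indicator UNIV x \<partial>lborel)"
    proof -
      have "emeasure lborel {x \<in> UNIV. 1 \<le> ennreal (4 / t\<^sup>2) * ennreal ((norm (h x))\<^sup>2)} \<le> ennreal (4 / t\<^sup>2) * (\<integral>\<^sup>+x. ennreal ((norm (h x))\<^sup>2) * indicator UNIV x \<partial>lborel)"
        by (rule nn_integral_Markov_inequality) auto
      then show ?thesis by (simp only: Int_UNIV_right space_lborel space_borel)
    qed
    also have "(\<integral>\<^sup>+x. ennreal ((norm (h x))\<^sup>2) * indicator UNIV x \<partial>lborel) = (\<integral>\<^sup>+\<xi>. ennreal ((norm (f \<xi> - truncate (A t) f \<xi>))\<^sup>2) \<partial>lborel)"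
      using is_fourier_L2_norm[OF hL hF] L2_nn_integral[OF hL] L2_nn_integral[OF is_fourier_L2_L2[OF hF]] by simp
    also have "\<dots> = (\<integral>\<^sup>+\<xi>. ennreal ((norm (f \<xi>))\<^sup>2) * indicator {\<xi>. t < 2 * K * norm \<xi> powr \<gamma>} \<xi> \<partial>lborel)"
    proof (intro nn_integral_cong)
      fix \<xi> :: 'a
      have "\<xi> \<in> cball 0 (A t) \<longleftrightarrow> \<not> t < 2 * K * norm \<xi> powr \<gamma>"
        using A_less[OF l norm_ge_zero[of \<xi>]] by auto
      then show "ennreal ((norm (f \<xi> - truncate (A t) f \<xi>))\<^sup>2) = ennreal ((norm (f \<xi>))\<^sup>2) * indicator {\<xi>. t < 2 * K * norm \<xi> powr \<gamma>} \<xi>"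
        by (simp add: indicator_def)
    qed
    finally show ?thesis .
  qed
  define G where "G x t = (if 0 < t \<and> t < norm (u x) then ennreal (t powr (s - 1)) else 0)" for x t
  \<comment> \<open>Chebyshev's factor 4 / t^2 lowers the exponent s - 1 to s - 3, written as
    \<open>s - 2 - 1\<close> to fit \<open>nn_integral_powr_Ioo\<close>; since s > 2, the integral
    converges at t = 0.\<close>
  define H where "H \<xi> t = ennreal (4 * (norm (f \<xi>))\<^sup>2) * (if 0 < t \<and> t < 2 * K * norm \<xi> powr \<gamma> then ennreal (t powr (s - 2 - 1)) else 0)" for \<xi> t
  have [measurable]: "(\<lambda>(x, t). G x t) \<in> borel_measurable (lborel \<Otimes>\<^sub>M lborel)"
    "(\<lambda>(x, t). H x t) \<in> borel_measurable (lborel \<Otimes>\<^sub>M lborel)"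
    unfolding G_def H_def by measurable
  have "(\<integral>\<^sup>+x. ennreal (norm (u x) powr s) \<partial>lborel) = (\<integral>\<^sup>+x. ennreal s * (\<integral>\<^sup>+t. G x t \<partial>lborel) \<partial>lborel)"
    unfolding G_def using s by (intro nn_integral_cong) (simp add: nn_integral_powr_Ioo ennreal_mult[symmetric])
  also have "\<dots> = ennreal s * (\<integral>\<^sup>+x. (\<integral>\<^sup>+t. G x t \<partial>lborel) \<partial>lborel)"
    by (rule nn_integral_cmult) measurable
  also have "(\<integral>\<^sup>+x. (\<integral>\<^sup>+t. G x t \<partial>lborel) \<partial>lborel) = (\<integral>\<^sup>+t. (\<integral>\<^sup>+x. G x t \<partial>lborel) \<partial>lborel)"
    by (rule lborel_pair.Fubini'[symmetric]) measurable
  also have "\<dots> \<le> (\<integral>\<^sup>+t. (\<integral>\<^sup>+\<xi>. H \<xi> t \<partial>lborel) \<partial>lborel)"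
  proof (rule nn_integral_mono)
    fix t :: real
    show "(\<integral>\<^sup>+x. G x t \<partial>lborel) \<le> (\<integral>\<^sup>+\<xi>. H \<xi> t \<partial>lborel)"
    proof (cases "t > 0")
      case True
      have "(\<integral>\<^sup>+x. G x t \<partial>lborel) = (\<integral>\<^sup>+x. ennreal (t powr (s - 1)) * indicator {x \<in> space lborel. t < norm (u x)} x \<partial>lborel)"
        using True by (intro nn_integral_cong) (simp add: G_def indicator_def)
      also have "\<dots> = ennreal (t powr (s - 1)) * emeasure lborel {x \<in> space lborel. t < norm (u x)}"
        by (rule nn_integral_cmult_indicator) measurable
      also have "\<dots> \<le> ennreal (t powr (s - 1)) * (ennreal (4 / t\<^sup>2) * (\<integral>\<^sup>+\<xi>. ennreal ((norm (f \<xi>))\<^sup>2) * indicator {\<xi>. t < 2 * K * norm \<xi> powr \<gamma>} \<xi> \<partial>lborel))"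
        by (intro mult_left_mono tail[OF True]) simp
      also have "\<dots> = (\<integral>\<^sup>+\<xi>. ennreal (t powr (s - 1) * (4 / t\<^sup>2)) * (ennreal ((norm (f \<xi>))\<^sup>2) * indicator {\<xi>. t < 2 * K * norm \<xi> powr \<gamma>} \<xi>) \<partial>lborel)"
      proof -
        have "ennreal (t powr (s - 1) * (4 / t\<^sup>2)) = ennreal (t powr (s - 1)) * ennreal (4 / t\<^sup>2)"
          by (rule ennreal_mult) auto
        then show ?thesis by (subst nn_integral_cmult) (simp_all only: mult.assoc, measurable)
      qed
      also have "\<dots> = (\<integral>\<^sup>+\<xi>. H \<xi> t \<partial>lborel)"
      proof (intro nn_integral_cong)
        fix \<xi>
        have "t powr (s - 1) * (4 / t\<^sup>2) = 4 * t powr (s - 2 - 1)"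
          using True by (simp add: powr_diff powr_numeral power2_eq_square power3_eq_cube mult_ac)
        then show "ennreal (t powr (s - 1) * (4 / t\<^sup>2)) * (ennreal ((norm (f \<xi>))\<^sup>2) * indicator {\<xi>. t < 2 * K * norm \<xi> powr \<gamma>} \<xi>) = H \<xi> t"
          using True by (simp add: H_def indicator_def ennreal_mult[symmetric] mult_ac)
      qed
      finally show ?thesis .
    qed (simp add: G_def)
  qed
  also have "\<dots> = (\<integral>\<^sup>+\<xi>. (\<integral>\<^sup>+t. H \<xi> t \<partial>lborel) \<partial>lborel)"
    by (rule lborel_pair.Fubini') measurable
  also have "\<dots> = (\<integral>\<^sup>+\<xi>. ennreal (4 / (s - 2) * (2 * K) powr (s - 2)) * ennreal (norm \<xi> powr (\<gamma> * (s - 2)) * (norm (f \<xi>))\<^sup>2) \<partial>lborel)"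
  proof (intro nn_integral_cong)
    fix \<xi> :: 'a
    have "(\<integral>\<^sup>+t. H \<xi> t \<partial>lborel) = ennreal (4 * (norm (f \<xi>))\<^sup>2) * ennreal ((2 * K * norm \<xi> powr \<gamma>) powr (s - 2) / (s - 2))"
      unfolding H_def using s K by (subst nn_integral_cmult) (simp_all add: nn_integral_powr_Ioo)
    also have "\<dots> = ennreal (4 / (s - 2) * (2 * K) powr (s - 2)) * ennreal (norm \<xi> powr (\<gamma> * (s - 2)) * (norm (f \<xi>))\<^sup>2)"
      using s K by (simp add: ennreal_mult[symmetric] powr_mult powr_powr field_simps)
    finally show "(\<integral>\<^sup>+t. H \<xi> t \<partial>lborel) = ennreal (4 / (s - 2) * (2 * K) powr (s - 2)) * ennreal (norm \<xi> powr (\<gamma> * (s - 2)) * (norm (f \<xi>))\<^sup>2)" .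
  qed
  also have "\<dots> = ennreal (4 / (s - 2) * (2 * K) powr (s - 2)) * (\<integral>\<^sup>+\<xi>. ennreal (norm \<xi> powr (\<gamma> * (s - 2)) * (norm (f \<xi>))\<^sup>2) \<partial>lborel)"
    by (rule nn_integral_cmult) measurable
  finally have "(\<integral>\<^sup>+x. ennreal (norm (u x) powr s) \<partial>lborel) \<le> ennreal s * (ennreal (4 / (s - 2) * (2 * K) powr (s - 2)) * (\<integral>\<^sup>+\<xi>. ennreal (norm \<xi> powr (\<gamma> * (s - 2)) * (norm (f \<xi>))\<^sup>2) \<partial>lborel))"
    by (simp add: mult_left_mono)
  also have "\<dots> = ennreal (4 * s / (s - 2) * (2 * K) powr (s - 2)) * (\<integral>\<^sup>+\<xi>. ennreal (norm \<xi> powr (\<gamma> * (s - 2)) * (norm (f \<xi>))\<^sup>2) \<partial>lborel)"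
    using s by (simp add: ennreal_mult[symmetric] mult.assoc[symmetric]) (simp add: mult_ac)
  finally show ?thesis .
qed

section \<open>Powers of the norm on balls and bounds for low frequencies\<close>

lemma sets_borel_cball [measurable]: "cball (a::'a::euclidean_space) r \<in> sets borel"
  by simp

text \<open>On the dyadic shell between the radii (1/2)^(k+1) and (1/2)^k the integrand is at most
  2^((k+1) b). Bounding each shell by its ball gives a geometric series of ratio 2^(b - d).\<close>

lemma nn_integral_norm_powr_ball:
  assumes b: "0 \<le> b" "b < real DIM('a::euclidean_space)"
  shows "(\<integral>\<^sup>+\<xi>. ennreal (indicator (cball 0 1) \<xi> * norm (\<xi>::'a) powr (- b)) \<partial>lborel) < \<infinity>"
proof -
  let ?d = "DIM('a)"
  define V where "V = unit_ball_vol (real ?d)"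
  have V: "V \<ge> 0" unfolding V_def by simp
  have "(\<integral>\<^sup>+\<xi>. ennreal (indicator (cball 0 1) \<xi> * norm (\<xi>::'a) powr (- b)) \<partial>lborel) 
     \<le> (\<integral>\<^sup>+\<xi>. (\<Sum>k. ennreal (2 powr (real (Suc k) * b)) * indicator (cball 0 ((1/2)^k)) (\<xi>::'a)) \<partial>lborel)"
  proof (rule nn_integral_mono)
    fix \<xi> :: 'a
    show "ennreal (indicator (cball 0 1) \<xi> * norm (\<xi>::'a) powr (- b)) \<le> (\<Sum>k. ennreal (2 powr (real (Suc k) * b)) * indicator (cball 0 ((1/2)^k)) \<xi>)"
    proof (cases "\<xi> \<in> cball 0 1 \<and> \<xi> \<noteq> 0")
      case True
      then have n: "norm \<xi> > 0" "norm \<xi> \<le> 1" by auto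
      obtain m where m: "(1/2::real)^m < norm \<xi>" using real_arch_pow_inv[of "norm \<xi>" "1/2"] n by auto
      \<comment> \<open>The least exponent places \<xi> in the shell (1/2)^M < |\<xi>| \<le>
        (1/2)^(M - 1); it is at least 1 because |\<xi>| \<le> 1.\<close>
      define M where "M = (LEAST m. (1/2::real)^m < norm \<xi>)"
      have M: "(1/2::real)^M < norm \<xi>" unfolding M_def by (rule LeastI[of _ m]) (rule m)
      have "M \<noteq> 0" using M n by (intro notI) simp
      then obtain k where k: "M = Suc k" by (cases M) auto
      have le: "norm \<xi> \<le> (1/2)^k" using not_less_Least[of k "\<lambda>m. (1/2::real)^m < norm \<xi>"] k by (auto simp: M_def not_less)
      have "norm \<xi> powr (- b) \<le> ((1/2)^Suc k) powr (- b)"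
        using M k b by (intro powr_mono2') auto
      also have "\<dots> = 2 powr (real (Suc k) * b)"
      proof -
        have "((1/2::real)^Suc k) = 2 powr (- real (Suc k))"
          by (simp add: powr_minus powr_realpow power_divide inverse_eq_divide del: of_nat_Suc power_Suc)
        then show ?thesis by (simp add: powr_powr del: of_nat_Suc power_Suc)
      qed
      finally have "ennreal (indicator (cball 0 1) \<xi> * norm \<xi> powr (- b)) \<le> ennreal (2 powr (real (Suc k) * b)) * indicator (cball 0 ((1/2)^k)) \<xi>"
        using n le True by (simp add: ennreal_leI)
      also have "\<dots> \<le> (\<Sum>k. ennreal (2 powr (real (Suc k) * b)) * indicator (cball 0 ((1/2)^k)) \<xi>)"
      proof -
        define g where "g j = ennreal (2 powr (real (Suc j) * b)) * indicator (cball 0 ((1/2)^j)) \<xi>" for j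
        have "g k \<le> suminf g" using sum_le_suminf[OF summableI, of "{k}" g] by simp
        then show ?thesis unfolding g_def .
      qed
      finally show ?thesis .
    next
      case False
      then have "indicator (cball 0 1) \<xi> * norm \<xi> powr (- b) = 0" by (auto simp: indicator_def)
      then show ?thesis by (simp only: ennreal_0 zero_le)
    qed
  qed
  also have "\<dots> = (\<Sum>k. \<integral>\<^sup>+\<xi>. ennreal (2 powr (real (Suc k) * b)) * indicator (cball 0 ((1/2)^k)) (\<xi>::'a) \<partial>lborel)"
    by (rule nn_integral_suminf) measurable
  also have "\<dots> = (\<Sum>k. ennreal (2 powr b * V * (2 powr (b - real ?d)) ^ k))"
  proof (intro suminf_cong)
    fix k
    have "(\<integral>\<^sup>+\<xi>. ennreal (2 powr (real (Suc k) * b)) * indicator (cball 0 ((1/2)^k)) (\<xi>::'a) \<partial>lborel) = ennreal (2 powr (real (Suc k) * b)) * emeasure lborel (cball (0::'a) ((1/2)^k))"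
      by (rule nn_integral_cmult_indicator) simp
    also have "\<dots> = ennreal (2 powr (real (Suc k) * b) * (V * ((1/2)^k) ^ ?d))"
      by (simp add: emeasure_cball V_def ennreal_mult del: of_nat_Suc)
    also have "2 powr (real (Suc k) * b) * (V * ((1/2)^k) ^ ?d) = 2 powr b * V * (2 powr (b - real ?d)) ^ k"
    proof -
      have "2 powr (real (Suc k) * b) = 2 powr b * (2 powr b) ^ k"
        by (simp add: powr_realpow[symmetric] powr_powr powr_add[symmetric] algebra_simps)
      moreover have "((1/2::real)^k) ^ ?d = ((1/2)^?d)^k" by (simp add: power_mult[symmetric] mult.commute)
      moreover have "2 powr (b - real ?d) = 2 powr b * (1/2)^?d" by (simp add: powr_diff powr_realpow power_divide)
      ultimately show ?thesis by (simp add: power_mult_distrib)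
    qed
    finally show "(\<integral>\<^sup>+\<xi>. ennreal (2 powr (real (Suc k) * b)) * indicator (cball 0 ((1/2)^k)) (\<xi>::'a) \<partial>lborel) = ennreal (2 powr b * V * (2 powr (b - real ?d)) ^ k)" .
  qed
  also have "\<dots> < \<infinity>"
  proof -
    have "2 powr (b - real ?d) < 2 powr 0" using b by (intro powr_less_mono) auto
    then have "summable (\<lambda>k. 2 powr b * V * (2 powr (b - real ?d)) ^ k)"
      by (intro summable_mult summable_geometric) simp
    then show ?thesis using V by (subst suminf_ennreal2) auto
  qed
  finally show ?thesis .
qed

text \<open>The type argument carries the dimension, on which the value depends.\<close>

definition ball_powr_integral :: "'a::euclidean_space itself \<Rightarrow> real \<Rightarrow> real" where
  "ball_powr_integral _ b = (LINT \<xi>|lborel. indicator (cball 0 1) \<xi> * norm (\<xi>::'a) powr (- b))"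

lemma integrable_norm_powr_ball:
  assumes b: "0 \<le> b" "b < real DIM('a::euclidean_space)" and A: "A > 0"
  shows "integrable lborel (\<lambda>\<xi>::'a. indicator (cball 0 A) \<xi> * norm \<xi> powr (- b))"
    and "(LINT \<xi>|lborel. indicator (cball 0 A) \<xi> * norm (\<xi>::'a) powr (- b)) = A powr (real DIM('a) - b) * ball_powr_integral TYPE('a) b"
proof -
  have i1: "integrable lborel (\<lambda>\<xi>::'a. indicator (cball 0 1) \<xi> * norm \<xi> powr (- b))"
    using nn_integral_norm_powr_ball[OF b] by (intro integrableI_nonneg) auto
  have eq: "indicator (cball 0 A) (0 + A *\<^sub>R \<xi>) * norm (0 + A *\<^sub>R \<xi>) powr (- b) = A powr (- b) * (indicator (cball 0 1) \<xi> * norm \<xi> powr (- b))" for \<xi> :: 'a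
    using A by (auto simp: indicator_def powr_mult)
  have "integrable lborel (\<lambda>\<xi>::'a. A powr (- b) * (indicator (cball 0 1) (0 + (1/A) *\<^sub>R \<xi>) * norm (0 + (1/A) *\<^sub>R \<xi>) powr (- b)))"
    using integrable_affine[OF i1, of "1/A" 0] A by simp
  moreover have "A powr (- b) * (indicator (cball 0 1) (0 + (1/A) *\<^sub>R \<xi>) * norm (0 + (1/A) *\<^sub>R \<xi>) powr (- b)) = indicator (cball 0 A) \<xi> * norm \<xi> powr (- b)" for \<xi> :: 'a
    using A by (auto simp: indicator_def powr_divide powr_minus field_simps)
  ultimately show "integrable lborel (\<lambda>\<xi>::'a. indicator (cball 0 A) \<xi> * norm \<xi> powr (- b))" by (simp only:)
  have "(LINT \<xi>|lborel. indicator (cball 0 A) \<xi> * norm (\<xi>::'a) powr (- b)) 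
     = \<bar>A\<bar> ^ DIM('a) *\<^sub>R (LINT \<xi>|lborel. indicator (cball 0 A) (0 + A *\<^sub>R \<xi>) * norm (0 + A *\<^sub>R \<xi> :: 'a) powr (- b))"
    using A by (intro integral_affine) auto
  also have "\<dots> = A ^ DIM('a) * A powr (- b) * ball_powr_integral TYPE('a) b"
    unfolding eq ball_powr_integral_def using A by simp
  also have "A ^ DIM('a) * A powr (- b) = A powr (real DIM('a) - b)"
    using A by (simp add: powr_realpow[symmetric] powr_add[symmetric])
  finally show "(LINT \<xi>|lborel. indicator (cball 0 A) \<xi> * norm (\<xi>::'a) powr (- b)) = A powr (real DIM('a) - b) * ball_powr_integral TYPE('a) b" .
qed

text \<open>The normalizing constant of the transform is at most 1 and is dropped.\<close>

lemma norm_lowpass_le: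
  fixes f :: "'a::euclidean_space \<Rightarrow> complex"
  shows "norm (lowpass f A x) \<le> (LINT \<xi>|lborel. norm (truncate A f \<xi>))"
proof -
  have "(2 * pi) powr (- real DIM('a) / 2) \<le> (2 * pi) powr 0"
    using pi_gt3 by (intro powr_mono) auto
  then have "(2 * pi) powr (- real DIM('a) / 2) \<le> 1" using pi_gt_zero by simp
  then have "norm (lowpass f A x) \<le> 1 * norm (fourier_integral (truncate A f) (- x))"
    unfolding lowpass_def fourier_L1_eq norm_mult by (intro mult_right_mono) auto
  then show ?thesis using norm_fourier_integral_le[of "truncate A f" "- x"] by simp
qed

lemma powr_le_1_plus:
  fixes r b :: real
  assumes "0 \<le> r" "0 \<le> b" "b \<le> 1"
  shows "r powr b \<le> 1 + r"
proof (cases "r \<le> 1")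
  case True
  then have "r powr b \<le> 1" using assms by (intro powr_le1) auto
  then show ?thesis using assms by simp
next
  case False
  then have "r powr b \<le> r powr 1" using assms by (intro powr_mono) auto
  then show ?thesis using assms by simp
qed

lemma integrable_norm_powr_L2:
  fixes f :: "'a::euclidean_space \<Rightarrow> complex"
  assumes f: "f \<in> L2" and T: "integrable lborel (\<lambda>\<xi>. norm \<xi> * (norm (f \<xi>))\<^sup>2)" and b: "0 \<le> b" "b \<le> 1"
  shows "integrable lborel (\<lambda>\<xi>. norm \<xi> powr b * (norm (f \<xi>))\<^sup>2)"
proof (rule Bochner_Integration.integrable_bound)
  note f[THEN L2_measurable, measurable]
  show "integrable lborel (\<lambda>\<xi>. (norm (f \<xi>))\<^sup>2 + norm \<xi> * (norm (f \<xi>))\<^sup>2)" using T f by (simp add: L2_integrable)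
  show "(\<lambda>\<xi>. norm \<xi> powr b * (norm (f \<xi>))\<^sup>2) \<in> borel_measurable lborel" by measurable
  show "AE \<xi> in lborel. norm (norm \<xi> powr b * (norm (f \<xi>))\<^sup>2) \<le> norm ((norm (f \<xi>))\<^sup>2 + norm \<xi> * (norm (f \<xi>))\<^sup>2)"
  proof (rule AE_I2)
    fix \<xi> :: 'a
    have "norm \<xi> powr b * (norm (f \<xi>))\<^sup>2 \<le> (1 + norm \<xi>) * (norm (f \<xi>))\<^sup>2"
      using powr_le_1_plus[of "norm \<xi>" b] b by (intro mult_right_mono) auto
    also have "\<dots> = (norm (f \<xi>))\<^sup>2 + norm \<xi> * (norm (f \<xi>))\<^sup>2" by (simp add: algebra_simps)
    finally show "norm (norm \<xi> powr b * (norm (f \<xi>))\<^sup>2) \<le> norm ((norm (f \<xi>))\<^sup>2 + norm \<xi> * (norm (f \<xi>))\<^sup>2)" by simp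
  qed
qed

text \<open>Cauchy-Schwarz after splitting off |\<xi>|^(-b/2), whose square is integrable on the
  ball since b < 1 \<le> d; the other factor is the moment of order \<open>b\<close>.\<close>

lemma lowpass_bound:
  fixes f :: "'a::euclidean_space \<Rightarrow> complex"
  assumes f: "f \<in> L2" and T: "integrable lborel (\<lambda>\<xi>. norm \<xi> * (norm (f \<xi>))\<^sup>2)" 
    and b: "0 \<le> b" "b < 1" and A: "A > 0"
  shows "norm (lowpass f A x) \<le> sqrt (ball_powr_integral TYPE('a) b * (LINT \<xi>|lborel. norm \<xi> powr b * (norm (f \<xi>))\<^sup>2))
     * A powr ((real DIM('a) - b) / 2)"
proof -
  note f[THEN L2_measurable, measurable]
  have bd: "b < real DIM('a)" using b(2) DIM_positive[where 'a='a] by (simp add: less_le_trans[of b 1] Suc_leI)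
  define p where "p \<xi> = complex_of_real (indicator (cball 0 A) \<xi> * norm \<xi> powr (- (b / 2)))" for \<xi> :: 'a
  define w where "w \<xi> = complex_of_real (norm \<xi> powr (b / 2)) * f \<xi>" for \<xi>
  have p2: "(norm (p \<xi>))\<^sup>2 = indicator (cball 0 A) \<xi> * norm \<xi> powr (- b)" for \<xi>
    by (auto simp: p_def indicator_def power2_eq_square powr_add[symmetric] simp flip: of_real_mult)
  have w2: "(norm (w \<xi>))\<^sup>2 = norm \<xi> powr b * (norm (f \<xi>))\<^sup>2" for \<xi>
    by (simp add: w_def norm_mult power_mult_distrib power2_eq_square powr_add[symmetric])
  have pL: "p \<in> L2"
  proof (rule L2I)
    show "integrable lborel (\<lambda>x. (norm (p x))\<^sup>2)" unfolding p2 by (rule integrable_norm_powr_ball(1)[OF b(1) bd A])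
  qed (unfold p_def, measurable)
  have wL: "w \<in> L2"
  proof (rule L2I)
    show "integrable lborel (\<lambda>x. (norm (w x))\<^sup>2)" unfolding w2 using b by (intro integrable_norm_powr_L2 f T) auto
  qed (unfold w_def, measurable)
  have "norm (lowpass f A x) \<le> (LINT \<xi>|lborel. norm (truncate A f \<xi>))" by (rule norm_lowpass_le)
  also have "\<dots> = (LINT \<xi>|lborel. norm (p \<xi>) * norm (w \<xi>))"
  proof (intro integral_cong_AE)
    \<comment> \<open>At \<xi> = 0 the product of the two powers is 0 instead of 1, so equality
      holds only almost everywhere.\<close>
    show "AE \<xi> in lborel. norm (truncate A f \<xi>) = norm (p \<xi>) * norm (w \<xi>)"
      using AE_lborel_singleton[of 0]
      by eventually_elim (auto simp: p_def w_def norm_mult norm_inverse indicator_def powr_minus)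
  qed (use pL wL in \<open>auto intro!: L2_measurable[OF L2_truncate[OF f]] borel_measurable_times borel_measurable_norm dest: L2_measurable\<close>)
  also have "\<dots> \<le> L2_norm p * L2_norm w" by (rule L2_Cauchy_Schwarz_norm[OF pL wL])
  also have "\<dots> = sqrt (A powr (real DIM('a) - b) * ball_powr_integral TYPE('a) b) * sqrt (LINT \<xi>|lborel. norm \<xi> powr b * (norm (f \<xi>))\<^sup>2)"
    unfolding L2_norm_def p2 w2 integrable_norm_powr_ball(2)[OF b(1) bd A] ..
  also have "\<dots> = sqrt (ball_powr_integral TYPE('a) b * (LINT \<xi>|lborel. norm \<xi> powr b * (norm (f \<xi>))\<^sup>2)) * A powr ((real DIM('a) - b) / 2)"
    using A by (simp add: real_sqrt_mult powr_half_sqrt[symmetric] powr_powr)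
  finally show ?thesis .
qed

lemma ball_powr_integral_nonneg: "ball_powr_integral TYPE('a::euclidean_space) b \<ge> 0"
  unfolding ball_powr_integral_def by (intro integral_nonneg_AE) auto

text \<open>\<open>chemin_xu\<close> with \<gamma> = (d - b) / 2 taken from
  \<open>lowpass_bound\<close>; \<kappa> is chosen so that the weight it produces is |\<xi>| itself.
  For b = 0 the moment is the mass and the exponent is 2 + 2/d; b > 0 reaches larger exponents at
  the price of a moment of order \<open>b\<close>. A positive bound \<open>M\<close> stands for the
  moment because \<open>chemin_xu\<close> requires a positive constant.\<close>

lemma gagliardo_nirenberg:
  assumes b: "0 \<le> b" "b < 1"
  defines "\<kappa> \<equiv> 1 / (real DIM('a::euclidean_space) - b)"
  shows "\<exists>C>0. \<forall>(u :: 'a \<Rightarrow> complex) f M. u \<in> L2 \<longrightarrow> is_fourier_L2 u f \<longrightarrow> integrable lborel (\<lambda>\<xi>. norm \<xi> * (norm (f \<xi>))\<^sup>2) \<longrightarrow>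
     (LINT \<xi>|lborel. norm \<xi> powr b * (norm (f \<xi>))\<^sup>2) \<le> M \<longrightarrow> M > 0 \<longrightarrow>
     integrable lborel (\<lambda>x. norm (u x) powr (2 + 2 * \<kappa>)) \<and>
     (LINT x|lborel. norm (u x) powr (2 + 2 * \<kappa>)) \<le> C * M powr \<kappa> * (LINT \<xi>|lborel. norm \<xi> * (norm (f \<xi>))\<^sup>2)"
proof -
  have bd: "b < real DIM('a)" using b(2) DIM_positive[where 'a='a] by (simp add: less_le_trans[of b 1] Suc_leI)
  have \<kappa>: "\<kappa> > 0" using bd by (simp add: \<kappa>_def)
  \<comment> \<open>The summand 1 makes the constant positive, given only that the ball integral is
    nonnegative.\<close>
  define J where "J = ball_powr_integral TYPE('a) b + 1"
  have J: "J > 0" unfolding J_def using ball_powr_integral_nonneg[where 'a='a, of b] by simp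
  define s where "s = 2 + 2 * \<kappa>"
  have s: "s > 2" using \<kappa> by (simp add: s_def)
  define C where "C = 4 * s / (s - 2) * (2 powr (s - 2) * J powr \<kappa>)"
  have C: "C > 0" using s J by (simp add: C_def)
  show ?thesis
  proof (intro exI[of _ C] conjI C allI impI)
    fix u f :: "'a \<Rightarrow> complex" and M :: real
    assume u: "u \<in> L2" "is_fourier_L2 u f" and T: "integrable lborel (\<lambda>\<xi>. norm \<xi> * (norm (f \<xi>))\<^sup>2)"
      and M: "(LINT \<xi>|lborel. norm \<xi> powr b * (norm (f \<xi>))\<^sup>2) \<le> M" "M > 0"
    have f: "f \<in> L2" using u(2) by (rule is_fourier_L2_L2)
    note u(1)[THEN L2_measurable, measurable] f[THEN L2_measurable, measurable]
    define K where "K = sqrt (J * M)"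
    have K: "K > 0" using J M by (simp add: K_def)
    have "(\<integral>\<^sup>+x. ennreal (norm (u x) powr s) \<partial>lborel)
      \<le> ennreal (4 * s / (s - 2) * (2 * K) powr (s - 2)) * (\<integral>\<^sup>+\<xi>. ennreal (norm \<xi> powr ((real DIM('a) - b) / 2 * (s - 2)) * (norm (f \<xi>))\<^sup>2) \<partial>lborel)"
    proof (rule chemin_xu[OF u K _ s])
      show "(real DIM('a) - b) / 2 > 0" using bd by simp
      fix A :: real and x :: 'a assume A: "A > 0"
      have "norm (lowpass f A x) \<le> sqrt (ball_powr_integral TYPE('a) b * (LINT \<xi>|lborel. norm \<xi> powr b * (norm (f \<xi>))\<^sup>2)) * A powr ((real DIM('a) - b) / 2)"
        by (rule lowpass_bound[OF f T b A])
      also have "\<dots> \<le> K * A powr ((real DIM('a) - b) / 2)"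
        unfolding K_def using M J ball_powr_integral_nonneg[where 'a='a, of b]
        by (intro mult_right_mono real_sqrt_le_mono mult_mono) (auto simp: J_def intro!: integral_nonneg_AE)
      finally show "norm (lowpass f A x) \<le> K * A powr ((real DIM('a) - b) / 2)" .
    qed
    also have "(real DIM('a) - b) / 2 * (s - 2) = 1" using bd by (simp add: s_def \<kappa>_def)
    also have "(\<integral>\<^sup>+\<xi>. ennreal (norm \<xi> powr 1 * (norm (f \<xi>))\<^sup>2) \<partial>lborel) = ennreal (LINT \<xi>|lborel. norm \<xi> * (norm (f \<xi>))\<^sup>2)"
      using T by (simp add: nn_integral_eq_integral)
    also have "4 * s / (s - 2) * (2 * K) powr (s - 2) = C * M powr \<kappa>"
    proof -
      have "(2 * K) powr (s - 2) = 2 powr (s - 2) * K powr (s - 2)" using K by (simp add: powr_mult)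
      also have "K powr (s - 2) = (J * M) powr \<kappa>"
        using J M unfolding K_def s_def by (simp add: powr_half_sqrt[symmetric] powr_powr)
      also have "\<dots> = J powr \<kappa> * M powr \<kappa>" using J M by (simp add: powr_mult)
      finally show ?thesis by (simp add: C_def)
    qed
    also have "ennreal (C * M powr \<kappa>) * ennreal (LINT \<xi>|lborel. norm \<xi> * (norm (f \<xi>))\<^sup>2) = ennreal (C * M powr \<kappa> * (LINT \<xi>|lborel. norm \<xi> * (norm (f \<xi>))\<^sup>2))"
      using C by (subst ennreal_mult) (auto intro!: integral_nonneg_AE)
    finally have le: "(\<integral>\<^sup>+x. ennreal (norm (u x) powr s) \<partial>lborel) \<le> ennreal (C * M powr \<kappa> * (LINT \<xi>|lborel. norm \<xi> * (norm (f \<xi>))\<^sup>2))" .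
    show i: "integrable lborel (\<lambda>x. norm (u x) powr (2 + 2 * \<kappa>))"
      using le unfolding s_def by (intro integrableI_nonneg) (auto intro: le_less_trans)
    have eq: "ennreal (LINT x|lborel. norm (u x) powr s) = (\<integral>\<^sup>+x. ennreal (norm (u x) powr s) \<partial>lborel)"
      using i unfolding s_def by (intro nn_integral_eq_integral[symmetric]) auto
    have "0 \<le> C * M powr \<kappa> * (LINT \<xi>|lborel. norm \<xi> * (norm (f \<xi>))\<^sup>2)"
      using C by (intro mult_nonneg_nonneg integral_nonneg_AE) auto
    with le[folded eq] show "(LINT x|lborel. norm (u x) powr (2 + 2 * \<kappa>)) \<le> C * M powr \<kappa> * (LINT \<xi>|lborel. norm \<xi> * (norm (f \<xi>))\<^sup>2)"
      unfolding s_def by (simp only: ennreal_le_iff)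
  qed
qed

section \<open>The energy\<close>

text \<open>For t \<le> \<delta> the first term alone dominates, beyond \<delta> the second. The
  choice of \<delta> decides which end receives the small coefficient.\<close>

lemma powr_young:
  fixes \<alpha> \<beta> \<gamma> :: real
  assumes "\<alpha> < \<beta>" "\<beta> < \<gamma>" "\<delta> > 0" "t \<ge> 0"
  shows "t powr \<beta> \<le> \<delta> powr (\<beta> - \<alpha>) * t powr \<alpha> + \<delta> powr (\<beta> - \<gamma>) * t powr \<gamma>"
proof (cases "t = 0")
  case False
  then have t: "t > 0" using assms by simp
  show ?thesis
  proof (cases "t \<le> \<delta>")
    case True
    have "t powr \<beta> = t powr (\<beta> - \<alpha>) * t powr \<alpha>" using t by (simp add: powr_add[symmetric])
    also have "\<dots> \<le> \<delta> powr (\<beta> - \<alpha>) * t powr \<alpha>"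
      using assms True t by (intro mult_right_mono powr_mono2) auto
    also have "\<dots> \<le> \<delta> powr (\<beta> - \<alpha>) * t powr \<alpha> + \<delta> powr (\<beta> - \<gamma>) * t powr \<gamma>" by simp
    finally show ?thesis .
  next
    case False
    have "t powr \<beta> = t powr (\<beta> - \<gamma>) * t powr \<gamma>" using t by (simp add: powr_add[symmetric])
    also have "\<dots> \<le> \<delta> powr (\<beta> - \<gamma>) * t powr \<gamma>"
      using assms False t by (intro mult_right_mono powr_mono2') auto
    also have "\<dots> \<le> \<delta> powr (\<beta> - \<alpha>) * t powr \<alpha> + \<delta> powr (\<beta> - \<gamma>) * t powr \<gamma>" by simp
    finally show ?thesis .
  qed
qed simp

lemma powr_young_low:
  fixes \<alpha> \<beta> \<gamma> :: real
  assumes "\<alpha> < \<beta>" "\<beta> < \<gamma>" "\<epsilon> > 0"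
  obtains C where "C > 0" "\<And>t. t \<ge> 0 \<Longrightarrow> t powr \<beta> \<le> \<epsilon> * t powr \<alpha> + C * t powr \<gamma>"
proof -
  define \<delta> where "\<delta> = \<epsilon> powr (1 / (\<beta> - \<alpha>))"
  have "\<delta> > 0" "\<delta> powr (\<beta> - \<alpha>) = \<epsilon>" using assms by (auto simp: \<delta>_def powr_powr)
  then show ?thesis using that[of "\<delta> powr (\<beta> - \<gamma>)"] powr_young[OF assms(1,2), of \<delta>] by auto
qed

lemma powr_young_high:
  fixes \<alpha> \<beta> \<gamma> :: real
  assumes "\<alpha> < \<beta>" "\<beta> < \<gamma>" "\<epsilon> > 0"
  obtains C where "C > 0" "\<And>t. t \<ge> 0 \<Longrightarrow> t powr \<beta> \<le> C * t powr \<alpha> + \<epsilon> * t powr \<gamma>"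
proof -
  define \<delta> where "\<delta> = \<epsilon> powr (1 / (\<beta> - \<gamma>))"
  have "\<delta> > 0" "\<delta> powr (\<beta> - \<gamma>) = \<epsilon>" using assms by (auto simp: \<delta>_def powr_powr)
  then show ?thesis using that[of "\<delta> powr (\<beta> - \<alpha>)"] powr_young[OF assms(1,2), of \<delta>] by auto
qed

lemma norm_powr_2: "norm x powr 2 = (norm x)\<^sup>2"
  by simp

text \<open>Carrying the transform along as a second argument avoids the choice made by \<^const>\<open>fourier_L2\<close>.\<close>

definition half_pair :: "('a::euclidean_space \<Rightarrow> complex) \<Rightarrow> ('a \<Rightarrow> complex) \<Rightarrow> bool" where
  "half_pair u f \<longleftrightarrow> u \<in> L2 \<and> is_fourier_L2 u f \<and> integrable lborel (\<lambda>\<xi>. norm \<xi> * (norm (f \<xi>))\<^sup>2)"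

text \<open>The squared homogeneous seminorm of order 1/2 of the function with transform
  \<open>f\<close>.\<close>

definition half_energy :: "('a::euclidean_space \<Rightarrow> complex) \<Rightarrow> real" where
  "half_energy f = (LINT \<xi>|lborel. norm \<xi> * (norm (f \<xi>))\<^sup>2)"

definition power_integral :: "real \<Rightarrow> ('a::euclidean_space \<Rightarrow> complex) \<Rightarrow> real" where
  "power_integral r u = (LINT x|lborel. norm (u x) powr r)"

lemma half_pairD:
  assumes "half_pair u f"
  shows "u \<in> L2" "is_fourier_L2 u f" "f \<in> L2" "integrable lborel (\<lambda>\<xi>. norm \<xi> * (norm (f \<xi>))\<^sup>2)" "L2_norm f = L2_norm u"
    "u \<in> borel_measurable borel" "f \<in> borel_measurable borel"
  using assms is_fourier_L2_norm[of u f] by (auto simp: half_pair_def dest: is_fourier_L2_L2 L2_measurable)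

lemma half_energy_nonneg [simp]: "half_energy f \<ge> 0"
  unfolding half_energy_def by (intro integral_nonneg_AE) auto

lemma power_integral_nonneg [simp]: "power_integral r u \<ge> 0"
  unfolding power_integral_def by (intro integral_nonneg_AE) auto

lemma half_integrable_bound:
  fixes f g :: "'a::euclidean_space \<Rightarrow> complex"
  assumes "integrable lborel (\<lambda>\<xi>. norm \<xi> * (norm (f \<xi>))\<^sup>2)" "g \<in> borel_measurable borel" "\<And>\<xi>. norm (g \<xi>) \<le> norm (f \<xi>)"
  shows "integrable lborel (\<lambda>\<xi>. norm \<xi> * (norm (g \<xi>))\<^sup>2)" "half_energy g \<le> half_energy f"
proof -
  note assms(2)[measurable]
  have le: "norm \<xi> * (norm (g \<xi>))\<^sup>2 \<le> norm \<xi> * (norm (f \<xi>))\<^sup>2" for \<xi>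
    using assms(3) by (intro mult_left_mono power_mono) auto
  show i: "integrable lborel (\<lambda>\<xi>. norm \<xi> * (norm (g \<xi>))\<^sup>2)"
    by (rule Bochner_Integration.integrable_bound[OF assms(1)]) (use le in auto)
  show "half_energy g \<le> half_energy f"
    unfolding half_energy_def using le by (intro integral_mono i assms) auto
qed

lemma half_integrable_diff:
  fixes f g :: "'a::euclidean_space \<Rightarrow> complex"
  assumes f: "f \<in> L2" "integrable lborel (\<lambda>\<xi>. norm \<xi> * (norm (f \<xi>))\<^sup>2)"
    and g: "g \<in> L2" "integrable lborel (\<lambda>\<xi>. norm \<xi> * (norm (g \<xi>))\<^sup>2)"
  shows "integrable lborel (\<lambda>\<xi>. norm \<xi> * (norm (f \<xi> - g \<xi>))\<^sup>2)" "half_energy (\<lambda>\<xi>. f \<xi> - g \<xi>) \<le> 2 * half_energy f + 2 * half_energy g"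
proof -
  note f(1)[THEN L2_measurable, measurable] g(1)[THEN L2_measurable, measurable]
  have le: "norm \<xi> * (norm (f \<xi> - g \<xi>))\<^sup>2 \<le> 2 * (norm \<xi> * (norm (f \<xi>))\<^sup>2) + 2 * (norm \<xi> * (norm (g \<xi>))\<^sup>2)" for \<xi>
    using mult_left_mono[OF norm_add_squared_le[of "f \<xi>" "- g \<xi>"], of "norm \<xi>"] by (simp add: algebra_simps)
  have i2: "integrable lborel (\<lambda>\<xi>. 2 * (norm \<xi> * (norm (f \<xi>))\<^sup>2) + 2 * (norm \<xi> * (norm (g \<xi>))\<^sup>2))"
    using f g by simp
  show i: "integrable lborel (\<lambda>\<xi>. norm \<xi> * (norm (f \<xi> - g \<xi>))\<^sup>2)"
    by (rule Bochner_Integration.integrable_bound[OF i2]) (use le in auto)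
  have "half_energy (\<lambda>\<xi>. f \<xi> - g \<xi>) \<le> (LINT \<xi>|lborel. 2 * (norm \<xi> * (norm (f \<xi>))\<^sup>2) + 2 * (norm \<xi> * (norm (g \<xi>))\<^sup>2))"
    unfolding half_energy_def using le by (intro integral_mono i i2) auto
  also have "\<dots> = 2 * half_energy f + 2 * half_energy g"
    unfolding half_energy_def using f g by simp
  finally show "half_energy (\<lambda>\<xi>. f \<xi> - g \<xi>) \<le> 2 * half_energy f + 2 * half_energy g" .
qed

lemma half_pair_diff:
  assumes "half_pair u f" "half_pair w g"
  shows "half_pair (\<lambda>x. u x - w x) (\<lambda>\<xi>. f \<xi> - g \<xi>)"
  using half_pairD[OF assms(1)] half_pairD[OF assms(2)] unfolding half_pair_def
  by (auto intro: is_fourier_L2_diff half_integrable_diff)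

lemma half_pair_lowpass:
  assumes "half_pair u f"
  shows "half_pair (lowpass f A) (truncate A f)"
  unfolding half_pair_def
proof (intro conjI is_fourier_L2_lowpass half_pairD(3)[OF assms])
  show "integrable lborel (\<lambda>\<xi>. norm \<xi> * (norm (truncate A f \<xi>))\<^sup>2)"
    by (rule half_integrable_bound(1)[OF half_pairD(4)[OF assms] L2_measurable[OF L2_truncate[OF half_pairD(3)[OF assms]]]])
      (auto simp: indicator_def)
qed

lemma half_pair_translate:
  assumes "half_pair u f"
  shows "half_pair (\<lambda>x. u (x + y)) (\<lambda>\<xi>. cis (\<xi> \<bullet> y) * f \<xi>)"
  using half_pairD[OF assms] unfolding half_pair_def
  by (auto intro!: is_fourier_L2_translate simp: norm_mult)

text \<open>Lets a translation move a point where the low-frequency part is large to the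
  origin.\<close>

lemma lowpass_translate:
  "lowpass (\<lambda>\<xi>. cis (\<xi> \<bullet> y) * f \<xi>) A 0 = lowpass f A y"
proof -
  have "cis (- (- 0 \<bullet> \<xi>)) * truncate A (\<lambda>\<xi>. cis (\<xi> \<bullet> y) * f \<xi>) \<xi> = cis (- (- y \<bullet> \<xi>)) * truncate A f \<xi>" for \<xi>
    by (simp add: inner_commute)
  then show ?thesis unfolding lowpass_def fourier_L1_def by presburger
qed

text \<open>The weight (1 + |\<xi>|^2)^(1/2) lies between |\<xi>| and 1 + |\<xi>|, and any two
  transforms of \<open>u\<close> agree almost everywhere.\<close>

lemma sobolev_half_iff: "u \<in> sobolev (1 / 2) \<longleftrightarrow> (\<exists>f. half_pair u f)"
proof
  assume u: "u \<in> sobolev (1 / 2)"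
  then have uL: "u \<in> L2" and i: "integrable lborel (\<lambda>\<xi>. (1 + (norm \<xi>)\<^sup>2) powr (1 / 2) * (norm (fourier_L2 u \<xi>))\<^sup>2)"
    by (auto simp: sobolev_def)
  have F: "is_fourier_L2 u (fourier_L2 u)" by (rule is_fourier_L2_fourier_L2[OF uL])
  note is_fourier_L2_L2[OF F, THEN L2_measurable, measurable]
  have "integrable lborel (\<lambda>\<xi>. norm \<xi> * (norm (fourier_L2 u \<xi>))\<^sup>2)"
  proof (rule Bochner_Integration.integrable_bound[OF i])
    show "AE \<xi> in lborel. norm (norm \<xi> * (norm (fourier_L2 u \<xi>))\<^sup>2) \<le> norm ((1 + (norm \<xi>)\<^sup>2) powr (1 / 2) * (norm (fourier_L2 u \<xi>))\<^sup>2)"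
    proof (rule AE_I2)
      fix \<xi> :: 'a
      have "norm \<xi> \<le> sqrt (1 + (norm \<xi>)\<^sup>2)" by (rule real_le_rsqrt) simp
      then have "norm \<xi> * (norm (fourier_L2 u \<xi>))\<^sup>2 \<le> (1 + (norm \<xi>)\<^sup>2) powr (1 / 2) * (norm (fourier_L2 u \<xi>))\<^sup>2"
        by (intro mult_right_mono) (auto simp: powr_half_sqrt)
      then show "norm (norm \<xi> * (norm (fourier_L2 u \<xi>))\<^sup>2) \<le> norm ((1 + (norm \<xi>)\<^sup>2) powr (1 / 2) * (norm (fourier_L2 u \<xi>))\<^sup>2)" by simp
    qed
  qed measurable
  then show "\<exists>f. half_pair u f" using uL F by (auto simp: half_pair_def)
next
  assume "\<exists>f. half_pair u f"
  then obtain f where f: "half_pair u f" by blast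
  note D = half_pairD[OF f]
  note D(6,7)[measurable]
  have F: "is_fourier_L2 u (fourier_L2 u)" by (rule is_fourier_L2_fourier_L2[OF D(1)])
  note is_fourier_L2_L2[OF F, THEN L2_measurable, measurable]
  have ae: "AE \<xi> in lborel. f \<xi> = fourier_L2 u \<xi>" by (rule is_fourier_L2_unique[OF D(1,2) F])
  have i: "integrable lborel (\<lambda>\<xi>. (norm (f \<xi>))\<^sup>2 + norm \<xi> * (norm (f \<xi>))\<^sup>2)" using D by (simp add: L2_integrable)
  have "integrable lborel (\<lambda>\<xi>. (1 + (norm \<xi>)\<^sup>2) powr (1 / 2) * (norm (fourier_L2 u \<xi>))\<^sup>2)"
  proof (rule Bochner_Integration.integrable_bound[OF i])
    show "AE \<xi> in lborel. norm ((1 + (norm \<xi>)\<^sup>2) powr (1 / 2) * (norm (fourier_L2 u \<xi>))\<^sup>2) \<le> norm ((norm (f \<xi>))\<^sup>2 + norm \<xi> * (norm (f \<xi>))\<^sup>2)"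
      using ae
    proof eventually_elim
      fix \<xi> :: 'a assume eq: "f \<xi> = fourier_L2 u \<xi>"
      have "sqrt (1 + (norm \<xi>)\<^sup>2) \<le> 1 + norm \<xi>" by (rule real_le_lsqrt) (auto simp: power2_sum)
      then have "(1 + (norm \<xi>)\<^sup>2) powr (1 / 2) * (norm (f \<xi>))\<^sup>2 \<le> (1 + norm \<xi>) * (norm (f \<xi>))\<^sup>2"
        by (intro mult_right_mono) (auto simp: powr_half_sqrt)
      then show "norm ((1 + (norm \<xi>)\<^sup>2) powr (1 / 2) * (norm (fourier_L2 u \<xi>))\<^sup>2) \<le> norm ((norm (f \<xi>))\<^sup>2 + norm \<xi> * (norm (f \<xi>))\<^sup>2)"
        by (simp add: eq algebra_simps)
    qed
  qed measurable
  then show "u \<in> sobolev (1 / 2)" using D by (simp add: sobolev_def)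
qed

lemma mass_sphere_iff: "u \<in> mass_sphere \<rho> \<longleftrightarrow> (\<exists>f. half_pair u f) \<and> L2_norm u = \<rho>"
  by (simp add: mass_sphere_def sobolev_half_iff)

section \<open>Estimates and scaling for the boosted energy\<close>

text \<open>The upper bound on \<open>p\<close> is mass subcriticality: with the mass kept fixed,
  dilation by c scales the kinetic term by 1/c and the integral of |u|^r by c^(-d (r - 2) / 2), and
  these agree at r = 2 + 2/d.\<close>

locale boosted_half_wave =
  fixes v :: "'a::euclidean_space" and q p :: real
  assumes v: "norm v < 1" and q: "1 < q" and qp: "q < p" and p: "p < 1 + 2 / real DIM('a)"
begin

abbreviation "E \<equiv> energy v q p"

definition kin :: "('a \<Rightarrow> complex) \<Rightarrow> real" where
  "kin f = (LINT \<xi>|lborel. (norm \<xi> - v \<bullet> \<xi>) * (norm (f \<xi>))\<^sup>2)"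

text \<open>Because |v| < 1, the boosted kinetic term is comparable to \<open>half_energy\<close>,
  which is how it is estimated throughout.\<close>

lemma symbol_bounds: "(1 - norm v) * norm \<xi> \<le> norm \<xi> - v \<bullet> \<xi>" "norm \<xi> - v \<bullet> \<xi> \<le> 2 * norm \<xi>" "0 \<le> norm \<xi> - v \<bullet> \<xi>"
proof -
  have a: "\<bar>v \<bullet> \<xi>\<bar> \<le> norm v * norm \<xi>" by (rule Cauchy_Schwarz_ineq2)
  then show 1: "(1 - norm v) * norm \<xi> \<le> norm \<xi> - v \<bullet> \<xi>" by (simp add: algebra_simps)
  have "norm v * norm \<xi> \<le> 1 * norm \<xi>" using v by (intro mult_right_mono) auto
  then show "norm \<xi> - v \<bullet> \<xi> \<le> 2 * norm \<xi>" using a by simp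
  have "0 \<le> (1 - norm v) * norm \<xi>" using v by simp
  then show "0 \<le> norm \<xi> - v \<bullet> \<xi>" using 1 by linarith
qed

lemma kin_integrable:
  assumes "f \<in> borel_measurable borel" "integrable lborel (\<lambda>\<xi>. norm \<xi> * (norm (f \<xi>))\<^sup>2)"
  shows "integrable lborel (\<lambda>\<xi>. (norm \<xi> - v \<bullet> \<xi>) * (norm (f \<xi>))\<^sup>2)"
proof (rule Bochner_Integration.integrable_bound)
  note assms(1)[measurable]
  show "integrable lborel (\<lambda>\<xi>. 2 * (norm \<xi> * (norm (f \<xi>))\<^sup>2))" using assms by simp
  show "AE \<xi> in lborel. norm ((norm \<xi> - v \<bullet> \<xi>) * (norm (f \<xi>))\<^sup>2) \<le> norm (2 * (norm \<xi> * (norm (f \<xi>))\<^sup>2))"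
  proof (rule AE_I2)
    fix \<xi> :: 'a
    show "norm ((norm \<xi> - v \<bullet> \<xi>) * (norm (f \<xi>))\<^sup>2) \<le> norm (2 * (norm \<xi> * (norm (f \<xi>))\<^sup>2))"
      using mult_right_mono[OF symbol_bounds(2)[of \<xi>], of "(norm (f \<xi>))\<^sup>2"] symbol_bounds(3)[of \<xi>]
      by (simp add: mult.assoc)
  qed
  show "(\<lambda>\<xi>. (norm \<xi> - v \<bullet> \<xi>) * (norm (f \<xi>))\<^sup>2) \<in> borel_measurable lborel" by measurable
qed

lemma kin_ge:
  assumes "half_pair u f"
  shows "(1 - norm v) * half_energy f \<le> kin f"
proof -
  note D = half_pairD[OF assms]
  have "(1 - norm v) * half_energy f = (LINT \<xi>|lborel. (1 - norm v) * (norm \<xi> * (norm (f \<xi>))\<^sup>2))"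
    unfolding half_energy_def by simp
  also have "\<dots> \<le> kin f"
    unfolding kin_def
  proof (intro integral_mono kin_integrable D)
    fix \<xi> :: 'a
    show "(1 - norm v) * (norm \<xi> * (norm (f \<xi>))\<^sup>2) \<le> (norm \<xi> - v \<bullet> \<xi>) * (norm (f \<xi>))\<^sup>2"
      using mult_right_mono[OF symbol_bounds(1)[of \<xi>], of "(norm (f \<xi>))\<^sup>2"] by (simp add: mult.assoc)
  qed (use D in simp)
  finally show ?thesis .
qed

lemma kin_nonneg: "0 \<le> kin f"
  unfolding kin_def using symbol_bounds(3) by (intro integral_nonneg_AE) auto

lemma half_energy_pos:
  fixes u f :: "'a \<Rightarrow> complex"
  assumes "half_pair u f" "L2_norm u > 0"
  shows "half_energy f > 0"
proof (rule ccontr)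
  note D = half_pairD[OF assms(1)]
  assume "\<not> half_energy f > 0"
  then have "half_energy f = 0" using half_energy_nonneg[of f] by linarith
  then have "AE \<xi> in lborel. norm \<xi> * (norm (f \<xi>))\<^sup>2 = 0"
    using integral_nonneg_eq_0_iff_AE[OF D(4)] by (simp add: half_energy_def)
  then have "AE \<xi> in lborel. f \<xi> = 0" using AE_lborel_singleton[of 0] by eventually_elim simp
  then have "L2_norm f = L2_norm (\<lambda>\<xi>::'a. 0)" by (rule L2_norm_cong_AE) (use D in auto)
  then show False using D assms by simp
qed

lemma kin_pos: "half_pair u f \<Longrightarrow> L2_norm u > 0 \<Longrightarrow> kin f > 0"
  using kin_ge[of u f] mult_pos_pos[OF _ half_energy_pos[of u f], of "1 - norm v"] v by simp

lemma energy_eq: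
  assumes "half_pair u f"
  shows "E u = kin f / 2 + power_integral (q + 1) u / (q + 1) - power_integral (p + 1) u / (p + 1)"
proof -
  note D = half_pairD[OF assms]
  have F: "is_fourier_L2 u (fourier_L2 u)" by (rule is_fourier_L2_fourier_L2[OF D(1)])
  note is_fourier_L2_L2[OF F, THEN L2_measurable, measurable] D(7)[measurable]
  have ae: "AE \<xi> in lborel. f \<xi> = fourier_L2 u \<xi>" by (rule is_fourier_L2_unique[OF D(1,2) F])
  have "kinetic v u = kin f"
    unfolding kinetic_def kin_def using ae by (intro integral_cong_AE) auto
  then show ?thesis by (simp add: energy_def power_integral_def)
qed

lemma exponents: "2 < q + 1" "q + 1 < p + 1" "p + 1 < (2 + 2 / real DIM('a))" "2 < p + 1" "q + 1 < (2 + 2 / real DIM('a))"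
  using q qp p by auto

lemma endpoint_bound:
  obtains C where "C > 0"
    "\<And>(u :: 'a \<Rightarrow> complex) f m. half_pair u f \<Longrightarrow> (L2_norm u)\<^sup>2 \<le> m \<Longrightarrow> m > 0 \<Longrightarrow>
      integrable lborel (\<lambda>x. norm (u x) powr (2 + 2 / real DIM('a))) \<and> power_integral (2 + 2 / real DIM('a)) u \<le> C * m powr (1 / real DIM('a)) * half_energy f"
proof -
  obtain C where C: "C > 0" "\<And>(u :: 'a \<Rightarrow> complex) f M. u \<in> L2 \<Longrightarrow> is_fourier_L2 u f \<Longrightarrow> integrable lborel (\<lambda>\<xi>. norm \<xi> * (norm (f \<xi>))\<^sup>2) \<Longrightarrow>
     (LINT \<xi>|lborel. norm \<xi> powr 0 * (norm (f \<xi>))\<^sup>2) \<le> M \<Longrightarrow> M > 0 \<Longrightarrow>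
     integrable lborel (\<lambda>x. norm (u x) powr (2 + 2 * (1 / (real DIM('a) - 0)))) \<and>
     (LINT x|lborel. norm (u x) powr (2 + 2 * (1 / (real DIM('a) - 0)))) \<le> C * M powr (1 / (real DIM('a) - 0)) * (LINT \<xi>|lborel. norm \<xi> * (norm (f \<xi>))\<^sup>2)"
    using gagliardo_nirenberg[where 'a='a, of 0] by auto
  show ?thesis
  proof (rule that[OF C(1)])
    fix u f :: "'a \<Rightarrow> complex" and m :: real
    assume P: "half_pair u f" and m: "(L2_norm u)\<^sup>2 \<le> m" "m > 0"
    note D = half_pairD[OF P]
    \<comment> \<open>Pointwise only an inequality is available, because
      \<open>0 powr 0 = 0\<close>; it goes in the direction required.\<close>
    have "(LINT \<xi>|lborel. norm \<xi> powr 0 * (norm (f \<xi>))\<^sup>2) \<le> (LINT \<xi>|lborel. (norm (f \<xi>))\<^sup>2)"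
      by (intro integral_mono integrable_norm_powr_L2 D L2_integrable) auto
    also have "\<dots> \<le> m" using m D by (simp add: L2_norm_squared[symmetric])
    finally show "integrable lborel (\<lambda>x. norm (u x) powr (2 + 2 / real DIM('a))) \<and> power_integral (2 + 2 / real DIM('a)) u \<le> C * m powr (1 / real DIM('a)) * half_energy f"
      using C(2)[OF D(1,2,4) _ m(2)] by (simp add: power_integral_def half_energy_def)
  qed
qed

lemma power_integrable:
  assumes P: "half_pair (u :: 'a \<Rightarrow> complex) f" and r: "2 < r" "r \<le> (2 + 2 / real DIM('a))"
  shows "integrable lborel (\<lambda>x. norm (u x) powr r)"
proof -
  note D = half_pairD[OF P]
  note D(6)[measurable]
  have i: "integrable lborel (\<lambda>x. norm (u x) powr (2 + 2 / real DIM('a)))"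
  proof -
    obtain C where C: "C > 0" "\<And>(u :: 'a \<Rightarrow> complex) f m. half_pair u f \<Longrightarrow> (L2_norm u)\<^sup>2 \<le> m \<Longrightarrow> m > 0 \<Longrightarrow>
        integrable lborel (\<lambda>x. norm (u x) powr (2 + 2 / real DIM('a))) \<and>
        power_integral (2 + 2 / real DIM('a)) u \<le> C * m powr (1 / real DIM('a)) * half_energy f"
      using endpoint_bound by blast
    have "(L2_norm u)\<^sup>2 + 1 > 0" by (simp add: add_nonneg_pos)
    from C(2)[OF P _ this] show ?thesis by (auto dest: conjunct1)
  qed
  show ?thesis
  proof (cases "r = (2 + 2 / real DIM('a))")
    case False
    then have r2: "r < (2 + 2 / real DIM('a))" using r by simp
    obtain C where C: "C > 0" "\<And>t. t \<ge> 0 \<Longrightarrow> t powr r \<le> 1 * t powr 2 + C * t powr (2 + 2 / real DIM('a))"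
      using powr_young_low[OF r(1) r2, of 1] by auto
    have "integrable lborel (\<lambda>x. (norm (u x))\<^sup>2 + C * norm (u x) powr (2 + 2 / real DIM('a)))"
      using i D by (simp add: L2_integrable)
    then show ?thesis
    proof (rule Bochner_Integration.integrable_bound)
      show "AE x in lborel. norm (norm (u x) powr r) \<le> norm ((norm (u x))\<^sup>2 + C * norm (u x) powr (2 + 2 / real DIM('a)))"
        using C(2)[OF norm_ge_zero] C(1) by (intro AE_I2) (simp add: norm_powr_2)
    qed measurable
  qed (use i in simp)
qed

text \<open>An exponent strictly between 2 and 2 + 2/d leaves the coefficient of the kinetic energy
  at one's disposal, the cost being charged to the mass.\<close>

lemma power_interpolation:
  assumes r: "2 < r" "r < (2 + 2 / real DIM('a))" and m: "m > 0" and e: "\<epsilon> > 0"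
  obtains C where "C > 0"
    "\<And>(u :: 'a \<Rightarrow> complex) f. half_pair u f \<Longrightarrow> (L2_norm u)\<^sup>2 \<le> m \<Longrightarrow> power_integral r u \<le> C * (L2_norm u)\<^sup>2 + \<epsilon> * half_energy f"
proof -
  obtain C1 where C1: "C1 > 0" "\<And>(u :: 'a \<Rightarrow> complex) f m. half_pair u f \<Longrightarrow> (L2_norm u)\<^sup>2 \<le> m \<Longrightarrow> m > 0 \<Longrightarrow>
      integrable lborel (\<lambda>x. norm (u x) powr (2 + 2 / real DIM('a))) \<and> power_integral (2 + 2 / real DIM('a)) u \<le> C1 * m powr (1 / real DIM('a)) * half_energy f"
    using endpoint_bound by blast
  define K where "K = C1 * m powr (1 / real DIM('a))"
  have K: "K > 0" using C1 m by (simp add: K_def)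
  obtain C where C: "C > 0" "\<And>t. t \<ge> 0 \<Longrightarrow> t powr r \<le> C * t powr 2 + (\<epsilon> / K) * t powr (2 + 2 / real DIM('a))"
    using powr_young_high[OF r, of "\<epsilon> / K"] e K by auto
  show ?thesis
  proof (rule that[OF C(1)])
    fix u f :: "'a \<Rightarrow> complex"
    assume P: "half_pair u f" and um: "(L2_norm u)\<^sup>2 \<le> m"
    note D = half_pairD[OF P]
    have i: "integrable lborel (\<lambda>x. norm (u x) powr (2 + 2 / real DIM('a)))" and le: "power_integral (2 + 2 / real DIM('a)) u \<le> K * half_energy f"
      using C1(2)[OF P um m] by (auto simp: K_def)
    have "power_integral r u \<le> (LINT x|lborel. C * (norm (u x))\<^sup>2 + (\<epsilon> / K) * norm (u x) powr (2 + 2 / real DIM('a)))"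
      unfolding power_integral_def
      using C(2)[OF norm_ge_zero] i D power_integrable[OF P r(1)] r
      by (intro integral_mono) (auto simp: norm_powr_2 L2_integrable)
    also have "\<dots> = C * (L2_norm u)\<^sup>2 + (\<epsilon> / K) * power_integral (2 + 2 / real DIM('a)) u"
      unfolding power_integral_def L2_norm_squared using i D by (simp add: L2_integrable)
    also have "(\<epsilon> / K) * power_integral (2 + 2 / real DIM('a)) u \<le> (\<epsilon> / K) * (K * half_energy f)"
      using e K le by (intro mult_left_mono) auto
    also have "\<dots> = \<epsilon> * half_energy f" using K by simp
    finally show "power_integral r u \<le> C * (L2_norm u)\<^sup>2 + \<epsilon> * half_energy f" by simp
  qed
qed

text \<open>With the factor (p + 1) / (q + 1) in Young's inequality, the defocusing term is
  cancelled exactly and one higher power remains. Its exponent \<open>s\<close> is left free: 2 +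
  2/d serves for small masses, a larger one for functions of negative energy.\<close>

lemma power_young:
  assumes s: "p + 1 < s" 
  obtains C where "C > 0"
    "\<And>(u :: 'a \<Rightarrow> complex) f. half_pair u f \<Longrightarrow> integrable lborel (\<lambda>x. norm (u x) powr s) \<Longrightarrow>
       E u \<ge> kin f / 2 - C * power_integral s u"
proof -
  obtain C where C: "C > 0" "\<And>t. t \<ge> 0 \<Longrightarrow> t powr (p + 1) \<le> (p + 1) / (q + 1) * t powr (q + 1) + C * t powr s"
    using powr_young_low[OF exponents(2) s, of "(p + 1) / (q + 1)"] q qp by auto
  show ?thesis
  proof (rule that[of "C / (p + 1)"])
    show "C / (p + 1) > 0" using C q qp by simp
    fix u f :: "'a \<Rightarrow> complex"
    assume P: "half_pair u f" and i: "integrable lborel (\<lambda>x. norm (u x) powr s)"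
    have "power_integral (p + 1) u \<le> (LINT x|lborel. (p + 1) / (q + 1) * norm (u x) powr (q + 1) + C * norm (u x) powr s)"
      unfolding power_integral_def
      using C(2)[OF norm_ge_zero] i power_integrable[OF P] exponents
      by (intro integral_mono Bochner_Integration.integrable_add integrable_mult_right) auto
    also have "\<dots> = (p + 1) / (q + 1) * power_integral (q + 1) u + C * power_integral s u"
      unfolding power_integral_def using i power_integrable[OF P] exponents
      by (subst Bochner_Integration.integral_add) auto
    finally have "power_integral (p + 1) u / (p + 1) \<le> ((p + 1) / (q + 1) * power_integral (q + 1) u + C * power_integral s u) / (p + 1)"
      using q qp by (intro divide_right_mono) auto
    also have "\<dots> = power_integral (q + 1) u / (q + 1) + C / (p + 1) * power_integral s u"
    proof -
      have "p + 1 > 0" "q + 1 > 0" using q qp by auto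
      then show ?thesis by (simp add: field_simps)
    qed
    finally show "E u \<ge> kin f / 2 - C / (p + 1) * power_integral s u" 
      unfolding energy_eq[OF P] by linarith
  qed
qed

lemma small_mass:
  obtains \<rho> where "\<rho> > 0" "\<And>(u :: 'a \<Rightarrow> complex) f. half_pair u f \<Longrightarrow> 0 < L2_norm u \<Longrightarrow> L2_norm u \<le> \<rho> \<Longrightarrow> E u > 0"
proof -
  obtain C1 where C1: "C1 > 0" "\<And>(u :: 'a \<Rightarrow> complex) f m. half_pair u f \<Longrightarrow> (L2_norm u)\<^sup>2 \<le> m \<Longrightarrow> m > 0 \<Longrightarrow>
      integrable lborel (\<lambda>x. norm (u x) powr (2 + 2 / real DIM('a))) \<and> power_integral (2 + 2 / real DIM('a)) u \<le> C1 * m powr (1 / real DIM('a)) * half_energy f"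
    using endpoint_bound by blast
  obtain C where C: "C > 0" "\<And>(u :: 'a \<Rightarrow> complex) f. half_pair u f \<Longrightarrow> integrable lborel (\<lambda>x. norm (u x) powr (2 + 2 / real DIM('a))) \<Longrightarrow>
       E u \<ge> kin f / 2 - C * power_integral (2 + 2 / real DIM('a)) u"
    using power_young[OF exponents(3)] by blast
  \<comment> \<open>This makes the remaining potential term at most a quarter of the kinetic energy,
    of which one half is available; \<open>m\<close> is the mass at which the endpoint constant
    equals \<open>C1 * \<theta>\<close>.\<close>
  define \<theta> where "\<theta> = (1 - norm v) / (4 * C * C1)"
  have \<theta>: "\<theta> > 0" using v C C1 by (simp add: \<theta>_def)
  define m where "m = \<theta> powr (real DIM('a))"
  have m: "m > 0" "m powr (1 / real DIM('a)) = \<theta>" using \<theta> by (auto simp: m_def powr_powr)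
  show ?thesis
  proof (rule that[of "sqrt m"])
    show "sqrt m > 0" using m by simp
    fix u f :: "'a \<Rightarrow> complex"
    assume P: "half_pair u f" and u: "0 < L2_norm u" "L2_norm u \<le> sqrt m"
    have "(L2_norm u)\<^sup>2 \<le> (sqrt m)\<^sup>2" using u by (intro power_mono) auto
    then have um: "(L2_norm u)\<^sup>2 \<le> m" using m by simp
    have i: "integrable lborel (\<lambda>x. norm (u x) powr (2 + 2 / real DIM('a)))" and le: "power_integral (2 + 2 / real DIM('a)) u \<le> C1 * \<theta> * half_energy f"
      using C1(2)[OF P um m(1)] m(2) by auto
    have "C * power_integral (2 + 2 / real DIM('a)) u \<le> C * (C1 * \<theta> * half_energy f)" using C le by (intro mult_left_mono) auto
    also have "\<dots> = (1 - norm v) * half_energy f / 4" using C C1 by (simp add: \<theta>_def)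
    also have "\<dots> \<le> kin f / 4" using kin_ge[OF P] by simp
    finally show "E u > 0" using C(2)[OF P i] kin_pos[OF P u(1)] by linarith
  qed
qed

text \<open>Amplitude and dilation are treated together, since the mass-preserving scaling combines
  them. The kinetic factor has one power of \<open>c\<close> less because the symbol is homogeneous
  of degree one.\<close>

lemma half_pair_dilate:
  fixes u f :: "'a \<Rightarrow> complex"
  assumes P: "half_pair u f" and t: "t > 0" and c: "c > 0"
  defines "w \<equiv> \<lambda>x. of_real t * u ((1 / c) *\<^sub>R x)" and "g \<equiv> \<lambda>\<xi>. of_real (t * c ^ DIM('a)) * f (c *\<^sub>R \<xi>)"
  shows "half_pair w g" "(L2_norm w)\<^sup>2 = t\<^sup>2 * c ^ DIM('a) * (L2_norm u)\<^sup>2"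
    "kin g = t\<^sup>2 * c ^ DIM('a) / c * kin f" "power_integral r w = t powr r * c ^ DIM('a) * power_integral r u"
proof -
  note D = half_pairD[OF P]
  note D(6,7)[measurable]
  have ud: "(\<lambda>x. u ((1 / c) *\<^sub>R x)) \<in> L2" using L2_affine[OF D(1), of "1/c" 0] c by simp
  have g2: "norm (g \<xi>) = t * c ^ DIM('a) * norm (f (c *\<^sub>R \<xi>))" for \<xi>
    using t c by (simp add: g_def norm_mult norm_power)
  have "is_fourier_L2 w (\<lambda>\<xi>. of_real t * (of_real (c ^ DIM('a)) * f (c *\<^sub>R \<xi>)))"
    unfolding w_def by (intro is_fourier_L2_cmult ud is_fourier_L2_dilate D c)
  then have F: "is_fourier_L2 w g" by (simp add: g_def mult.assoc)
  have "integrable lborel (\<lambda>\<xi>. (t * c ^ DIM('a))\<^sup>2 / c * (norm (0 + c *\<^sub>R \<xi>) * (norm (f (0 + c *\<^sub>R \<xi>)))\<^sup>2))"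
    using c by (intro integrable_mult_right integrable_affine[OF D(4)]) auto
  moreover have "(t * c ^ DIM('a))\<^sup>2 / c * (norm (0 + c *\<^sub>R \<xi>) * (norm (f (0 + c *\<^sub>R \<xi>)))\<^sup>2) = norm \<xi> * (norm (g \<xi>))\<^sup>2" for \<xi>
    using c by (simp add: g2 power_mult_distrib)
  ultimately have "integrable lborel (\<lambda>\<xi>. norm \<xi> * (norm (g \<xi>))\<^sup>2)" by (simp only:)
  then show "half_pair w g"
    unfolding half_pair_def using F ud by (auto simp: w_def)
  show "(L2_norm w)\<^sup>2 = t\<^sup>2 * c ^ DIM('a) * (L2_norm u)\<^sup>2"
    using L2_norm_dilate[of "1 / c" u] c t by (simp add: w_def L2_norm_cmult power_mult_distrib power_one_over)
  have "kin f = \<bar>c\<bar> ^ DIM('a) *\<^sub>R (LINT \<xi>|lborel. (norm (0 + c *\<^sub>R \<xi>) - v \<bullet> (0 + c *\<^sub>R \<xi>)) * (norm (f (0 + c *\<^sub>R \<xi>)))\<^sup>2)"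
    unfolding kin_def using c by (intro integral_affine) auto
  also have "(LINT \<xi>|lborel. (norm (0 + c *\<^sub>R \<xi>) - v \<bullet> (0 + c *\<^sub>R \<xi>)) * (norm (f (0 + c *\<^sub>R \<xi>)))\<^sup>2) 
     = (LINT \<xi>|lborel. c / (t * c ^ DIM('a))\<^sup>2 * ((norm \<xi> - v \<bullet> \<xi>) * (norm (g \<xi>))\<^sup>2))"
    using c t by (intro Bochner_Integration.integral_cong refl) (simp add: g2 power_mult_distrib field_simps)
  also have "\<dots> = c / (t * c ^ DIM('a))\<^sup>2 * kin g" unfolding kin_def by simp
  finally show "kin g = t\<^sup>2 * c ^ DIM('a) / c * kin f"
    using c t by (simp add: field_simps power2_eq_square)
  have "power_integral r w = \<bar>c\<bar> ^ DIM('a) *\<^sub>R (LINT x|lborel. norm (w (0 + c *\<^sub>R x)) powr r)"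
    unfolding power_integral_def using c by (intro integral_affine) auto
  also have "(LINT x|lborel. norm (w (0 + c *\<^sub>R x)) powr r) = (LINT x|lborel. t powr r * norm (u x) powr r)"
    using c t by (intro Bochner_Integration.integral_cong refl) (simp add: w_def norm_mult powr_mult)
  also have "\<dots> = t powr r * power_integral r u" unfolding power_integral_def by simp
  finally show "power_integral r w = t powr r * c ^ DIM('a) * power_integral r u" using c by simp
qed

end

section \<open>Compactness\<close>

lemma norm_add_powr_le:
  fixes a b :: "'b::real_normed_vector"
  assumes "r > 0"
  shows "norm (a + b) powr r \<le> 2 powr r * (norm a powr r + norm b powr r)"
proof -
  have "norm (a + b) powr r \<le> (2 * max (norm a) (norm b)) powr r"
    using assms norm_triangle_ineq[of a b] by (intro powr_mono2) auto
  also have "\<dots> = 2 powr r * max (norm a) (norm b) powr r" by (simp add: powr_mult)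
  also have "\<dots> \<le> 2 powr r * (norm a powr r + norm b powr r)"
    by (intro mult_left_mono) (auto simp: max_def)
  finally show ?thesis .
qed

text \<open>Convexity applied to x + y = (1 - t) (x / (1 - t)) + t (y / t). As t tends to 0 the
  coefficient of the first power tends to 1, the second one paying for it.\<close>

lemma convex_powr_add:
  fixes x y t r :: real
  assumes r: "r \<ge> 1" and t: "0 < t" "t < 1" and xy: "x \<ge> 0" "y \<ge> 0"
  shows "(x + y) powr r \<le> (1 - t) powr (1 - r) * x powr r + t powr (1 - r) * y powr r"
proof -
  have ge1: "a powr (1 - r) \<ge> 1" if "0 < a" "a < 1" for a :: real
  proof -
    have "a powr (r - 1) \<le> 1" using that r by (intro powr_le1) auto
    moreover have "a powr (1 - r) = inverse (a powr (r - 1))" using powr_minus[of a "r - 1"] by simp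
    ultimately show ?thesis using that by (simp add: one_le_inverse_iff)
  qed
  consider "x = 0" | "y = 0" | "x > 0" "y > 0" using xy by linarith
  then show ?thesis
  proof cases
    case 1
    then show ?thesis using ge1[of t] t mult_right_mono[of 1 "t powr (1 - r)" "y powr r"] by simp
  next
    case 2
    then show ?thesis using ge1[of "1 - t"] t mult_right_mono[of 1 "(1 - t) powr (1 - r)" "x powr r"] by simp
  next
    case 3
    have "((1 - t) * (x / (1 - t)) + t * (y / t)) powr r \<le> (1 - t) * (x / (1 - t)) powr r + t * (y / t) powr r"
      using convex_onD[OF powr_convex[OF r], of t "x / (1 - t)" "y / t"] t 3 by simp
    moreover have "(1 - t) * (x / (1 - t)) powr r = (1 - t) powr (1 - r) * x powr r"
      using t xy by (simp add: powr_divide powr_diff)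
    moreover have "t * (y / t) powr r = t powr (1 - r) * y powr r"
      using t xy by (simp add: powr_divide powr_diff)
    ultimately show ?thesis using t by simp
  qed
qed

text \<open>Both directions come from \<open>convex_powr_add\<close> with a small \<open>t\<close>:
  the upper bound from the sum b + a, the lower one from writing b = (a + b) - a.\<close>

lemma brezis_lieb_pointwise:
  fixes r \<epsilon> :: real
  assumes r: "r > 1" and e: "\<epsilon> > 0"
  obtains C where "C > 0" "\<And>a b :: complex. \<bar>norm (a + b) powr r - norm a powr r - norm b powr r\<bar> \<le> \<epsilon> * norm b powr r + C * norm a powr r"
proof -
  have "((\<lambda>t::real. (1 - t) powr (1 - r)) \<longlongrightarrow> (1 - 0) powr (1 - r)) (at_right 0)"
    by (intro tendsto_intros) auto
  then have "\<forall>\<^sub>F t in at_right (0::real). (1 - t) powr (1 - r) < 1 + \<epsilon>"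
    using e by (intro order_tendstoD) auto
  moreover have "\<forall>\<^sub>F t in at_right (0::real). t \<in> {0<..<1}" by (rule eventually_at_right_real) simp
  ultimately have "\<forall>\<^sub>F t in at_right (0::real). (1 - t) powr (1 - r) < 1 + \<epsilon> \<and> t \<in> {0<..<1}"
    by (rule eventually_conj)
  then obtain t :: real where t: "(1 - t) powr (1 - r) < 1 + \<epsilon>" "0 < t" "t < 1"
    using eventually_happens'[OF trivial_limit_at_right_real] by fastforce
  define S where "S = t powr (1 - r)"
  have S: "S > 0" using t by (simp add: S_def)
  have up: "norm (x + y) powr r \<le> (1 + \<epsilon>) * norm x powr r + S * norm y powr r" for x y :: complex
  proof -
    have "norm (x + y) powr r \<le> (norm x + norm y) powr r"
      using r by (intro powr_mono2 norm_triangle_ineq) auto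
    also have "\<dots> \<le> (1 - t) powr (1 - r) * norm x powr r + S * norm y powr r"
      unfolding S_def using r t by (intro convex_powr_add) auto
    also have "\<dots> \<le> (1 + \<epsilon>) * norm x powr r + S * norm y powr r"
      using t by (intro add_mono mult_right_mono) auto
    finally show ?thesis .
  qed
  show ?thesis
  proof (rule that[of "S + 1"])
    fix a b :: complex
    have 1: "norm (a + b) powr r \<le> (1 + \<epsilon>) * norm b powr r + S * norm a powr r" using up[of b a] by (simp add: add.commute)
    have "norm b powr r \<le> (1 + \<epsilon>) * norm (a + b) powr r + S * norm a powr r" using up[of "a + b" "- a"] by simp
    then have "norm b powr r / (1 + \<epsilon>) \<le> ((1 + \<epsilon>) * norm (a + b) powr r + S * norm a powr r) / (1 + \<epsilon>)"
      using e by (intro divide_right_mono) auto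
    also have "\<dots> = norm (a + b) powr r + S * norm a powr r / (1 + \<epsilon>)" using e by (simp add: add_divide_distrib)
    also have "S * norm a powr r / (1 + \<epsilon>) \<le> S * norm a powr r" using e S by (simp add: divide_le_eq mult_left_mono algebra_simps)
    finally have 2: "norm b powr r / (1 + \<epsilon>) \<le> norm (a + b) powr r + S * norm a powr r" by simp
    have "1 - \<epsilon> \<le> 1 / (1 + \<epsilon>)" using e by (simp add: field_simps)
    from mult_right_mono[OF this, of "norm b powr r"] have 3: "norm b powr r - \<epsilon> * norm b powr r \<le> norm b powr r / (1 + \<epsilon>)"
      by (simp add: algebra_simps)
    have "norm a powr r \<ge> 0" "(S + 1) * norm a powr r = S * norm a powr r + norm a powr r"
      "(1 + \<epsilon>) * norm b powr r = norm b powr r + \<epsilon> * norm b powr r"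
      by (simp_all add: algebra_simps)
    then show "\<bar>norm (a + b) powr r - norm a powr r - norm b powr r\<bar> \<le> \<epsilon> * norm b powr r + (S + 1) * norm a powr r"
      using 1 2 3 by linarith
  qed (use S in simp)
qed

context boosted_half_wave
begin

section \<open>Bounds from below: coercivity and nonvanishing\<close>

text \<open>The interpolation coefficient is chosen so that the focusing term absorbs one half of
  the lower bound (1 - |v|) / 2 for the kinetic part.\<close>

lemma energy_coercive:
  assumes B: "B > 0"
  obtains C where "C > 0" "\<And>(u :: 'a \<Rightarrow> complex) f. half_pair u f \<Longrightarrow> L2_norm u \<le> B \<Longrightarrow> E u \<ge> (1 - norm v) / 4 * half_energy f - C"
proof -
  have pp: "p + 1 > 0" "q + 1 > 0" using q qp by auto
  have "(1 - norm v) / 4 * (p + 1) > 0" using v pp by simp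
  from power_interpolation[OF exponents(4,3) _ this, of "B\<^sup>2"] B
  obtain C where C: "C > 0" "\<And>(u :: 'a \<Rightarrow> complex) f. half_pair u f \<Longrightarrow> (L2_norm u)\<^sup>2 \<le> B\<^sup>2 \<Longrightarrow> power_integral (p + 1) u \<le> C * (L2_norm u)\<^sup>2 + (1 - norm v) / 4 * (p + 1) * half_energy f"
    by auto
  show ?thesis
  proof (rule that[of "C * B\<^sup>2 / (p + 1)"])
    show "C * B\<^sup>2 / (p + 1) > 0" using C B pp by simp
    fix u f :: "'a \<Rightarrow> complex" assume P: "half_pair u f" and u: "L2_norm u \<le> B"
    have u2: "(L2_norm u)\<^sup>2 \<le> B\<^sup>2" using u by (intro power_mono) auto
    have "power_integral (p + 1) u \<le> C * B\<^sup>2 + (1 - norm v) / 4 * (p + 1) * half_energy f"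
      using C(2)[OF P u2] mult_left_mono[OF u2, of C] C(1) by linarith
    then have "power_integral (p + 1) u / (p + 1) \<le> (C * B\<^sup>2 + (1 - norm v) / 4 * (p + 1) * half_energy f) / (p + 1)"
      using pp by (intro divide_right_mono) auto
    also have "\<dots> = C * B\<^sup>2 / (p + 1) + (1 - norm v) / 4 * half_energy f"
      using pp by (simp add: field_simps)
    finally have 1: "power_integral (p + 1) u / (p + 1) \<le> C * B\<^sup>2 / (p + 1) + (1 - norm v) / 4 * half_energy f" .
    have 2: "power_integral (q + 1) u / (q + 1) \<ge> 0" using pp by simp
    have "2 * ((1 - norm v) / 4 * half_energy f) \<le> kin f / 2" using kin_ge[OF P] by (simp add: mult.commute[of "half_energy f"])
    then show "E u \<ge> (1 - norm v) / 4 * half_energy f - C * B\<^sup>2 / (p + 1)"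
      unfolding energy_eq[OF P] using 1 2 by linarith
  qed
qed

text \<open>The weight \<open>|\<xi>|\<close> to the power \<open>1/2\<close> yields an exponent \<open>s > 2 + 2/d\<close> for which the bound on the potential energy
  is of higher than first order in the kinetic energy.\<close>

lemma power_lower_bound:
  assumes B: "B > 0"
  obtains c where "c > 0" "\<And>(u :: 'a \<Rightarrow> complex) f. half_pair u f \<Longrightarrow> L2_norm u \<le> B \<Longrightarrow> E u < 0 \<Longrightarrow> power_integral (p + 1) u \<ge> c"
proof -
  have pp: "p + 1 > 0" "q + 1 > 0" using q qp by auto
  have dpos: "real DIM('a) \<ge> 1" using DIM_positive[where 'a='a] by (simp add: Suc_leI)
  define \<kappa> where "\<kappa> = 1 / (real DIM('a) - 1 / 2)"
  have \<kappa>: "\<kappa> > 0" unfolding \<kappa>_def using dpos by (intro divide_pos_pos) linarith+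
  define s where "s = 2 + 2 * \<kappa>"
  have "1 / real DIM('a) < \<kappa>" unfolding \<kappa>_def using dpos by (intro divide_strict_left_mono mult_pos_pos) linarith+
  then have s: "p + 1 < s" using exponents(3) by (simp add: s_def)
  obtain C2 where C2: "C2 > 0" "\<And>(u :: 'a \<Rightarrow> complex) f M. u \<in> L2 \<Longrightarrow> is_fourier_L2 u f \<Longrightarrow> integrable lborel (\<lambda>\<xi>. norm \<xi> * (norm (f \<xi>))\<^sup>2) \<Longrightarrow>
     (LINT \<xi>|lborel. norm \<xi> powr (1/2) * (norm (f \<xi>))\<^sup>2) \<le> M \<Longrightarrow> M > 0 \<Longrightarrow>
     integrable lborel (\<lambda>x. norm (u x) powr s) \<and>
     (LINT x|lborel. norm (u x) powr s) \<le> C2 * M powr \<kappa> * (LINT \<xi>|lborel. norm \<xi> * (norm (f \<xi>))\<^sup>2)"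
    using gagliardo_nirenberg[where 'a='a, of "1/2"] unfolding s_def \<kappa>_def by auto
  obtain C where C: "C > 0" "\<And>(u :: 'a \<Rightarrow> complex) f. half_pair u f \<Longrightarrow> integrable lborel (\<lambda>x. norm (u x) powr s) \<Longrightarrow>
       E u \<ge> kin f / 2 - C * power_integral s u"
    using power_young[OF s] by blast
  \<comment> \<open>As long as the moment of order 1/2 is at most this \<open>M\<close>, the
    remaining potential term is at most the kinetic one, and the energy is nonnegative.\<close>
  define M where "M = ((1 - norm v) / (2 * C * C2)) powr (1 / \<kappa>)"
  have M: "M > 0" "C * (C2 * M powr \<kappa>) = (1 - norm v) / 2"
    using v C C2 \<kappa> by (auto simp: M_def powr_powr)
  \<comment> \<open>The moment is interpolated between mass and kinetic energy. With this \<epsilon>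
    and \<open>D0\<close> below, each contributes at most M / 2 while \<open>half_energy f\<close>
    is below \<open>D0\<close>.\<close>
  define \<epsilon> where "\<epsilon> = M / (2 * B\<^sup>2)"
  have e: "\<epsilon> > 0" "\<epsilon> * B\<^sup>2 = M / 2" using M B by (auto simp: \<epsilon>_def)
  obtain K where K: "K > 0" "\<And>t. t \<ge> 0 \<Longrightarrow> t powr (1/2) \<le> \<epsilon> * t powr 0 + K * t powr 1"
    using powr_young_low[of 0 "1/2" 1, OF _ _ e(1)] by auto
  define D0 where "D0 = M / (2 * K)"
  have D0: "D0 > 0" using M K by (simp add: D0_def)
  show ?thesis
  proof (rule that[of "(p + 1) * ((1 - norm v) * D0 / 2)"])
    show "(p + 1) * ((1 - norm v) * D0 / 2) > 0" using pp v D0 by simp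
    fix u f :: "'a \<Rightarrow> complex" assume P: "half_pair u f" and u: "L2_norm u \<le> B" and neg: "E u < 0"
    note D = half_pairD[OF P]
    have u2: "(L2_norm u)\<^sup>2 \<le> B\<^sup>2" using u by (intro power_mono) auto
    have "half_energy f \<ge> D0"
    proof (rule ccontr)
      assume "\<not> half_energy f \<ge> D0"
      then have lt: "half_energy f < D0" by simp
      have "(LINT \<xi>|lborel. norm \<xi> powr (1/2) * (norm (f \<xi>))\<^sup>2) \<le> (LINT \<xi>|lborel. \<epsilon> * (norm (f \<xi>))\<^sup>2 + K * (norm \<xi> * (norm (f \<xi>))\<^sup>2))"
      proof (intro integral_mono integrable_norm_powr_L2 D)
        fix \<xi> :: 'a
        have "norm \<xi> powr (1/2) \<le> \<epsilon> + K * norm \<xi>" using K(2)[of "norm \<xi>"] e(1) by (cases "\<xi> = 0") auto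
        from mult_right_mono[OF this, of "(norm (f \<xi>))\<^sup>2"]
        show "norm \<xi> powr (1/2) * (norm (f \<xi>))\<^sup>2 \<le> \<epsilon> * (norm (f \<xi>))\<^sup>2 + K * (norm \<xi> * (norm (f \<xi>))\<^sup>2)"
          by (simp add: algebra_simps)
      qed (use D in \<open>auto simp: L2_integrable\<close>)
      also have "\<dots> = \<epsilon> * (L2_norm f)\<^sup>2 + K * half_energy f"
        unfolding L2_norm_squared half_energy_def using D by (simp add: L2_integrable)
      also have "\<dots> \<le> \<epsilon> * B\<^sup>2 + K * D0"
        using e K u2 lt D(5) by (intro add_mono mult_left_mono) auto
      also have "\<dots> = M" using e K by (simp add: D0_def)
      finally have Mb: "(LINT \<xi>|lborel. norm \<xi> powr (1/2) * (norm (f \<xi>))\<^sup>2) \<le> M" .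
      have i: "integrable lborel (\<lambda>x. norm (u x) powr s)" and le: "power_integral s u \<le> C2 * M powr \<kappa> * half_energy f"
        using C2(2)[OF D(1,2,4) Mb M(1)] by (auto simp: power_integral_def half_energy_def)
      have "C * power_integral s u \<le> C * (C2 * M powr \<kappa> * half_energy f)" using C le by (intro mult_left_mono) auto
      also have "\<dots> = (1 - norm v) / 2 * half_energy f" using M(2) by (simp add: mult.assoc[symmetric])
      also have "\<dots> \<le> kin f / 2" using kin_ge[OF P] by simp
      finally show False using C(2)[OF P i] neg by simp
    qed
    \<comment> \<open>Negative energy means that the focusing term outweighs the kinetic one, which
      is now bounded away from zero.\<close>
    then have "(1 - norm v) * D0 / 2 \<le> (1 - norm v) * half_energy f / 2" using v by simp
    also have "\<dots> \<le> kin f / 2" using kin_ge[OF P] by simp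
    also have "\<dots> \<le> power_integral (p + 1) u / (p + 1)"
      using neg divide_nonneg_pos[OF power_integral_nonneg pp(2), of "q + 1" u] unfolding energy_eq[OF P] by linarith
    finally show "(p + 1) * ((1 - norm v) * D0 / 2) \<le> power_integral (p + 1) u"
      using pp by (simp add: field_simps)
  qed
qed

text \<open>On the frequencies that remain, 1 \<le> |\<xi>| / A. Hence the error in mass is
  uniformly small over families of bounded kinetic energy.\<close>

lemma lowpass_remainder:
  fixes u f :: "'a \<Rightarrow> complex"
  assumes P: "half_pair u f" and A: "A > 0"
  shows "(L2_norm (\<lambda>x. u x - lowpass f A x))\<^sup>2 \<le> half_energy f / A"
    "half_energy (\<lambda>\<xi>. f \<xi> - truncate A f \<xi>) \<le> half_energy f"
    "L2_norm (\<lambda>x. u x - lowpass f A x) \<le> L2_norm u"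
    "L2_norm (lowpass f A) \<le> L2_norm u"
proof -
  note D = half_pairD[OF P]
  note D(6,7)[measurable]
  have Q: "half_pair (\<lambda>x. u x - lowpass f A x) (\<lambda>\<xi>. f \<xi> - truncate A f \<xi>)"
    by (rule half_pair_diff[OF P half_pair_lowpass[OF P]])
  note DQ = half_pairD[OF Q]
  have le: "norm (f \<xi> - truncate A f \<xi>) \<le> norm (f \<xi>)" for \<xi> by (simp add: indicator_def)
  show "half_energy (\<lambda>\<xi>. f \<xi> - truncate A f \<xi>) \<le> half_energy f"
    by (rule half_integrable_bound(2)[OF D(4) DQ(7) le])
  show "L2_norm (\<lambda>x. u x - lowpass f A x) \<le> L2_norm u"
    using L2_norm_le_norm[OF D(3) DQ(7) le] DQ(5) D(5) by simp
  have "norm (truncate A f \<xi>) \<le> norm (f \<xi>)" for \<xi> by (simp add: indicator_def)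
  from L2_norm_le_norm[OF D(3) half_pairD(7)[OF half_pair_lowpass[OF P]] this]
  show "L2_norm (lowpass f A) \<le> L2_norm u"
    using half_pairD(5)[OF half_pair_lowpass[OF P], of A] D(5) by simp
  have "(L2_norm (\<lambda>x. u x - lowpass f A x))\<^sup>2 = (LINT \<xi>|lborel. (norm (f \<xi> - truncate A f \<xi>))\<^sup>2)"
    using DQ(5) by (simp add: L2_norm_squared[symmetric])
  also have "\<dots> \<le> (LINT \<xi>|lborel. (1 / A) * (norm \<xi> * (norm (f \<xi>))\<^sup>2))"
  proof (intro integral_mono L2_integrable DQ)
    fix \<xi> :: 'a
    show "(norm (f \<xi> - truncate A f \<xi>))\<^sup>2 \<le> (1 / A) * (norm \<xi> * (norm (f \<xi>))\<^sup>2)"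
    proof (cases "norm \<xi> \<le> A")
      case False
      then have "A * (norm (f \<xi>))\<^sup>2 \<le> norm \<xi> * (norm (f \<xi>))\<^sup>2" by (intro mult_right_mono) auto
      then show ?thesis using A False by (simp add: field_simps)
    qed (use A in simp)
  qed (use D in simp)
  also have "\<dots> = half_energy f / A" unfolding half_energy_def by simp
  finally show "(L2_norm (\<lambda>x. u x - lowpass f A x))\<^sup>2 \<le> half_energy f / A" .
qed

text \<open>High frequencies contribute little to the power integral once \<open>A\<close> is large.
  If the low part were below \<eta> everywhere, its power would be bounded by a small multiple of
  the mass, and the two parts could not reach \<open>c\<close> together.\<close>

lemma nonvanishing:
  assumes B: "B > 0" and D0: "D0 > 0" and c: "c > 0"
  obtains A \<eta> where "A > 0" "\<eta> > 0"
    "\<And>(u :: 'a \<Rightarrow> complex) f. half_pair u f \<Longrightarrow> L2_norm u \<le> B \<Longrightarrow> half_energy f \<le> D0 \<Longrightarrow> power_integral (p + 1) u \<ge> c \<Longrightarrow>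
      \<exists>x. norm (lowpass f A x) \<ge> \<eta>"
proof -
  define r where "r = p + 1"
  have r: "2 < r" "r < 2 + 2 / real DIM('a)" "r > 0" using exponents by (auto simp: r_def)
  \<comment> \<open>The factor 2^r comes from splitting the power of a sum. With \<epsilon> and
    \<open>A\<close> each of the two error terms of the high part equals c / (4 2^r), and \<eta>
    gives the same bound for the low part: three quarters of \<open>c\<close> in all.\<close>
  define \<epsilon> where "\<epsilon> = c / (4 * 2 powr r * D0)"
  have e: "\<epsilon> > 0" using c D0 by (simp add: \<epsilon>_def)
  obtain C where C: "C > 0" "\<And>(u :: 'a \<Rightarrow> complex) f. half_pair u f \<Longrightarrow> (L2_norm u)\<^sup>2 \<le> B\<^sup>2 \<Longrightarrow> power_integral r u \<le> C * (L2_norm u)\<^sup>2 + \<epsilon> * half_energy f"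
    using power_interpolation[OF r(1,2) _ e, of "B\<^sup>2"] B by auto
  define A where "A = 4 * 2 powr r * C * D0 / c"
  have A: "A > 0" using C D0 c by (simp add: A_def)
  define \<eta> where "\<eta> = (c / (4 * 2 powr r * B\<^sup>2)) powr (1 / (r - 2))"
  have \<eta>: "\<eta> > 0" "\<eta> powr (r - 2) = c / (4 * 2 powr r * B\<^sup>2)" using c B r by (auto simp: \<eta>_def powr_powr)
  show ?thesis
  proof (rule that[OF A \<eta>(1)])
    fix u f :: "'a \<Rightarrow> complex"
    assume P: "half_pair u f" and u: "L2_norm u \<le> B" and fD: "half_energy f \<le> D0" and uc: "power_integral (p + 1) u \<ge> c"
    define l where "l = lowpass f A"
    define h where "h = (\<lambda>x. u x - lowpass f A x)"
    have Pl: "half_pair l (truncate A f)" unfolding l_def by (rule half_pair_lowpass[OF P])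
    have Ph: "half_pair h (\<lambda>\<xi>. f \<xi> - truncate A f \<xi>)" unfolding h_def by (rule half_pair_diff[OF P half_pair_lowpass[OF P]])
    note R = lowpass_remainder[OF P A, folded h_def l_def]
    have ir: "integrable lborel (\<lambda>x. norm (u x) powr r)" "integrable lborel (\<lambda>x. norm (l x) powr r)" "integrable lborel (\<lambda>x. norm (h x) powr r)"
      using power_integrable[OF P] power_integrable[OF Pl] power_integrable[OF Ph] r by auto
    have "(L2_norm h)\<^sup>2 \<le> B\<^sup>2" using R(3) u by (intro power_mono) auto
    then have "power_integral r h \<le> C * (L2_norm h)\<^sup>2 + \<epsilon> * half_energy (\<lambda>\<xi>. f \<xi> - truncate A f \<xi>)" by (rule C(2)[OF Ph])
    also have "\<dots> \<le> C * (D0 / A) + \<epsilon> * D0"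
    proof (intro add_mono mult_left_mono)
      show "(L2_norm h)\<^sup>2 \<le> D0 / A" using R(1) fD A by (meson divide_right_mono less_imp_le order_trans)
    qed (use C e R(2) fD in auto)
    also have "\<dots> = c / (2 * 2 powr r)" using C D0 c by (simp add: A_def \<epsilon>_def)
    finally have hh: "power_integral r h \<le> c / (2 * 2 powr r)" .
    show "\<exists>x. norm (lowpass f A x) \<ge> \<eta>"
    proof (rule ccontr)
      assume "\<not> (\<exists>x. norm (lowpass f A x) \<ge> \<eta>)"
      then have lt: "norm (l x) < \<eta>" for x by (auto simp: l_def not_le)
      have "power_integral r l \<le> (LINT x|lborel. \<eta> powr (r - 2) * (norm (l x))\<^sup>2)"
        unfolding power_integral_def
      proof (intro integral_mono ir)
        fix x
        have "norm (l x) powr r = norm (l x) powr (r - 2) * (norm (l x))\<^sup>2"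
          using powr_add[of "norm (l x)" "r - 2" 2] r by (cases "l x = 0") auto
        also have "\<dots> \<le> \<eta> powr (r - 2) * (norm (l x))\<^sup>2"
          using lt[of x] r by (intro mult_right_mono powr_mono2) auto
        finally show "norm (l x) powr r \<le> \<eta> powr (r - 2) * (norm (l x))\<^sup>2" .
      qed (use half_pairD(1)[OF Pl] in \<open>simp add: L2_integrable\<close>)
      also have "\<dots> = \<eta> powr (r - 2) * (L2_norm l)\<^sup>2" by (simp add: L2_norm_squared)
      also have "\<dots> \<le> \<eta> powr (r - 2) * B\<^sup>2"
        using R(4) u by (intro mult_left_mono power_mono) auto
      also have "\<dots> = c / (4 * 2 powr r)" using \<eta> B by simp
      finally have ll: "power_integral r l \<le> c / (4 * 2 powr r)" .
      have "power_integral r u \<le> (LINT x|lborel. 2 powr r * (norm (l x) powr r + norm (h x) powr r))"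
        unfolding power_integral_def using ir norm_add_powr_le[OF r(3), of "l x" "h x" for x]
        by (intro integral_mono) (auto simp: l_def h_def)
      also have "\<dots> = 2 powr r * (power_integral r l + power_integral r h)"
        unfolding power_integral_def using ir by simp
      also have "\<dots> \<le> 2 powr r * (c / (4 * 2 powr r) + c / (2 * 2 powr r))" using ll hh by (intro mult_left_mono) auto
      also have "\<dots> = c * 3 / 4" by (simp add: field_simps)
      also have "\<dots> < c" using c by simp
      finally show False using uc by (simp add: r_def)
    qed
  qed
qed

text \<open>Low-frequency parts converge pointwise and are uniformly bounded, so dominated
  convergence applies on a ball. The remainders have squared norm at most K / A, uniformly in the
  index.\<close>

lemma rellich:
  fixes w \<phi> :: "nat \<Rightarrow> 'a \<Rightarrow> complex"
  assumes P: "\<And>n. half_pair (w n) (\<phi> n)" and B: "\<And>n. L2_norm (w n) \<le> B" and K: "\<And>n. half_energy (\<phi> n) \<le> K"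
    and l: "\<And>A x. A > 0 \<Longrightarrow> (\<lambda>n. lowpass (\<phi> n) A x) \<longlonglongrightarrow> 0"
  shows "(\<lambda>n. LINT x|lborel. indicator (cball 0 R) x * (norm (w n x))\<^sup>2) \<longlonglongrightarrow> 0"
proof (rule LIMSEQ_I)
  fix e :: real assume e: "e > 0"
  have K0: "K \<ge> 0" using K[of 0] half_energy_nonneg[of "\<phi> 0"] by linarith
  have B0: "B \<ge> 0" using B[of 0] L2_norm_nonneg[of "w 0"] by linarith
  \<comment> \<open>Chosen so that twice the remainder stays below e / 2; \<open>K + 1\<close>
    replaces \<open>K\<close> to keep \<open>A\<close> positive.\<close>
  define A where "A = 4 * (K + 1) / e"
  have A: "A > 0" using K0 e by (simp add: A_def)
  have KA: "2 * (K / A) < e / 2"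
  proof -
    have "K / A = e * (K / (4 * (K + 1)))" using e K0 by (simp add: A_def)
    also have "\<dots> < e * (1 / 4)" using e K0 by (intro mult_strict_left_mono) (auto simp: field_simps)
    finally show ?thesis by linarith
  qed
  note wm = half_pairD(6)[OF P] and lm = half_pairD(6)[OF half_pair_lowpass[OF P]]
  note wm[measurable] lm[measurable]
  \<comment> \<open>The bound of \<open>lowpass_bound\<close> with b = 0, where the moment is
    controlled by the mass alone.\<close>
  define S where "S = sqrt (ball_powr_integral TYPE('a) 0 * B\<^sup>2) * A powr ((real DIM('a) - 0) / 2)"
  have S: "norm (lowpass (\<phi> n) A x) \<le> S" for n x
  proof -
    note D = half_pairD[OF P[of n]]
    have "(LINT \<xi>|lborel. norm \<xi> powr 0 * (norm (\<phi> n \<xi>))\<^sup>2) \<le> (LINT \<xi>|lborel. (norm (\<phi> n \<xi>))\<^sup>2)"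
      by (intro integral_mono integrable_norm_powr_L2 D L2_integrable) auto
    also have "\<dots> \<le> B\<^sup>2" using B[of n] D(5) by (simp add: L2_norm_squared[symmetric] power_mono)
    finally show ?thesis
      unfolding S_def using ball_powr_integral_nonneg[where 'a='a, of 0] 
      by (intro order_trans[OF lowpass_bound[OF D(3,4) order_refl zero_less_one A, of x]] mult_right_mono real_sqrt_le_mono mult_left_mono) auto
  qed
  note iB = integrable_indicator_cball[of "0::'a" R]
  have il: "integrable lborel (\<lambda>x. indicator (cball 0 R) x * (norm (lowpass (\<phi> n) A x))\<^sup>2)" for n
    by (rule Bochner_Integration.integrable_bound[OF L2_integrable[OF half_pairD(1)[OF half_pair_lowpass[OF P]], of n A]])
      (auto simp: indicator_def)
  have iw: "integrable lborel (\<lambda>x. indicator (cball 0 R) x * (norm (w n x))\<^sup>2)" for n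
    by (rule Bochner_Integration.integrable_bound[OF L2_integrable[OF half_pairD(1)[OF P], of n]])
      (auto simp: indicator_def)
  have "(\<lambda>n. LINT x|lborel. indicator (cball 0 R) x * (norm (lowpass (\<phi> n) A x))\<^sup>2) \<longlonglongrightarrow> (LINT x|(lborel :: 'a measure). 0)"
  proof (rule integral_dominated_convergence[where w="\<lambda>x. S\<^sup>2 * indicator (cball 0 R) x"])
    show "AE x in lborel. (\<lambda>n. indicator (cball 0 R) x * (norm (lowpass (\<phi> n) A x))\<^sup>2) \<longlonglongrightarrow> 0"
    proof (rule AE_I2)
      fix x :: 'a
      have "(\<lambda>n. indicator (cball 0 R) x * (norm (lowpass (\<phi> n) A x))\<^sup>2) \<longlonglongrightarrow> indicator (cball 0 R) x * (norm (0::complex))\<^sup>2"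
        by (intro tendsto_intros l A)
      then show "(\<lambda>n. indicator (cball 0 R) x * (norm (lowpass (\<phi> n) A x))\<^sup>2) \<longlonglongrightarrow> 0" by simp
    qed
    show "AE x in lborel. norm (indicator (cball 0 R) x * (norm (lowpass (\<phi> n) A x))\<^sup>2) \<le> S\<^sup>2 * indicator (cball 0 R) x" for n
      using S[of n] by (intro AE_I2) (auto simp: indicator_def intro!: power_mono)
  qed (use iB in auto)
  then have lim: "(\<lambda>n. LINT x|lborel. indicator (cball 0 R) x * (norm (lowpass (\<phi> n) A x))\<^sup>2) \<longlonglongrightarrow> 0" by simp
  obtain N where N: "\<And>n. n \<ge> N \<Longrightarrow> norm ((LINT x|lborel. indicator (cball 0 R) x * (norm (lowpass (\<phi> n) A x))\<^sup>2) - 0) < e / 4"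
    using LIMSEQ_D[OF lim, of "e/4"] e by auto
  show "\<exists>N. \<forall>n\<ge>N. norm ((LINT x|lborel. indicator (cball 0 R) x * (norm (w n x))\<^sup>2) - 0) < e"
  proof (intro exI[of _ N] allI impI)
    fix n assume n: "N \<le> n"
    define h where "h = (\<lambda>x. w n x - lowpass (\<phi> n) A x)"
    have hL: "h \<in> L2" unfolding h_def using half_pairD(1)[OF P] half_pairD(1)[OF half_pair_lowpass[OF P]] by (intro L2_diff) auto
    have "(LINT x|lborel. indicator (cball 0 R) x * (norm (w n x))\<^sup>2) \<le>
       (LINT x|lborel. 2 * (indicator (cball 0 R) x * (norm (lowpass (\<phi> n) A x))\<^sup>2) + 2 * (norm (h x))\<^sup>2)"
    proof (intro integral_mono iw Bochner_Integration.integrable_add integrable_mult_right il L2_integrable hL)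
      fix x
      show "indicator (cball 0 R) x * (norm (w n x))\<^sup>2 \<le> 2 * (indicator (cball 0 R) x * (norm (lowpass (\<phi> n) A x))\<^sup>2) + 2 * (norm (h x))\<^sup>2"
        using norm_add_squared_le[of "lowpass (\<phi> n) A x" "h x"] by (auto simp: h_def indicator_def)
    qed
    also have "\<dots> = 2 * (LINT x|lborel. indicator (cball 0 R) x * (norm (lowpass (\<phi> n) A x))\<^sup>2) + 2 * (L2_norm h)\<^sup>2"
      unfolding L2_norm_squared using il L2_integrable[OF hL] by simp
    also have "\<dots> < 2 * (e / 4) + e / 2"
    proof (intro add_strict_mono)
      have "2 * (L2_norm h)\<^sup>2 \<le> 2 * (half_energy (\<phi> n) / A)" unfolding h_def using lowpass_remainder(1)[OF P A] by (intro mult_left_mono) auto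
      also have "\<dots> \<le> 2 * (K / A)" using K A by (simp add: divide_right_mono)
      also have "\<dots> < e / 2" by (rule KA)
      finally show "2 * (L2_norm h)\<^sup>2 < e / 2" .
    qed (use N[OF n] in auto)
    finally have "(LINT x|lborel. indicator (cball 0 R) x * (norm (w n x))\<^sup>2) < e" by simp
    moreover have "0 \<le> (LINT x|lborel. indicator (cball 0 R) x * (norm (w n x))\<^sup>2)" by (intro integral_nonneg_AE) auto
    ultimately show "norm ((LINT x|lborel. indicator (cball 0 R) x * (norm (w n x))\<^sup>2) - 0) < e" by simp
  qed
qed

text \<open>Strong convergence on balls replaces the almost everywhere convergence of the usual formulation: the
  pointwise inequality is applied with \<open>u\<close> as the small term outside a large ball, and with \<open>w\<close> inside it.\<close>

lemma brezis_lieb: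
  fixes u f :: "'a \<Rightarrow> complex" and w \<phi> :: "nat \<Rightarrow> 'a \<Rightarrow> complex"
  assumes r: "2 < r" "r < 2 + 2 / real DIM('a)"
    and P: "half_pair u f" and Pw: "\<And>n. half_pair (w n) (\<phi> n)" and Ps: "\<And>n. half_pair (\<lambda>x. u x + w n x) (\<psi> n)"
    and B: "\<And>n. L2_norm (w n) \<le> B" and K: "\<And>n. half_energy (\<phi> n) \<le> K"
    and loc: "\<And>R. (\<lambda>n. LINT x|lborel. indicator (cball 0 R) x * (norm (w n x))\<^sup>2) \<longlonglongrightarrow> 0"
  shows "(\<lambda>n. power_integral r (\<lambda>x. u x + w n x) - power_integral r (w n)) \<longlonglongrightarrow> power_integral r u"
proof (rule LIMSEQ_I)
  fix e :: real assume e: "e > 0"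
  have K0: "K \<ge> 0" using K[of 0] half_energy_nonneg[of "\<phi> 0"] by linarith
  have B0: "B \<ge> 0" using B[of 0] L2_norm_nonneg[of "w 0"] by linarith
  define m where "m = B\<^sup>2 + 1"
  have m: "m > 0" by (simp add: m_def add_nonneg_pos)
  have wm: "(L2_norm (w n))\<^sup>2 \<le> m" for n using B[of n] by (simp add: m_def power_mono add_increasing2)
  obtain C0 where C0: "C0 > 0" "\<And>(u :: 'a \<Rightarrow> complex) f. half_pair u f \<Longrightarrow> (L2_norm u)\<^sup>2 \<le> m \<Longrightarrow> power_integral r u \<le> C0 * (L2_norm u)\<^sup>2 + 1 * half_energy f"
    using power_interpolation[OF r m zero_less_one] by blast
  define W where "W = C0 * m + K"
  have W: "power_integral r (w n) \<le> W" for n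
    unfolding W_def using C0(2)[OF Pw wm, of n] mult_left_mono[OF wm[of n], of C0] C0(1) K[of n] by linarith
  obtain C1 where C1: "C1 > 0" "\<And>(u :: 'a \<Rightarrow> complex) f m. half_pair u f \<Longrightarrow> (L2_norm u)\<^sup>2 \<le> m \<Longrightarrow> m > 0 \<Longrightarrow>
      integrable lborel (\<lambda>x. norm (u x) powr (2 + 2 / real DIM('a))) \<and> power_integral (2 + 2 / real DIM('a)) u \<le> C1 * m powr (1 / real DIM('a)) * half_energy f"
    using endpoint_bound by blast
  define s where "s = 2 + 2 / real DIM('a)"
  define K1 where "K1 = C1 * m powr (1 / real DIM('a)) * K"
  have K1: "K1 \<ge> 0" using C1 K0 by (simp add: K1_def)
  have ws: "integrable lborel (\<lambda>x. norm (w n x) powr s)" "power_integral s (w n) \<le> K1" for n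
  proof -
    show "integrable lborel (\<lambda>x. norm (w n x) powr s)" using C1(2)[OF Pw wm m] by (simp add: s_def)
    have "power_integral s (w n) \<le> C1 * m powr (1 / real DIM('a)) * half_energy (\<phi> n)" using C1(2)[OF Pw wm m] by (simp add: s_def)
    also have "\<dots> \<le> K1" unfolding K1_def using C1 K by (intro mult_left_mono) auto
    finally show "power_integral s (w n) \<le> K1" .
  qed
  define U where "U = power_integral r u"
  have U: "U \<ge> 0" by (simp add: U_def)
  have W0: "W \<ge> 0" using C0 m K0 by (simp add: W_def)
  \<comment> \<open>The error proportional to the full power integrals of \<open>w n\<close> and
    \<open>u\<close> then costs at most e / 4; the tail of \<open>u\<close> and the part of
    \<open>w n\<close> inside the ball cost as much each.\<close>
  define \<epsilon> where "\<epsilon> = e / (4 * (W + U + 1))"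
  have \<epsilon>: "\<epsilon> > 0" using e W0 U by (simp add: \<epsilon>_def)
  have \<epsilon>W: "\<epsilon> * (W + U) \<le> e / 4"
  proof -
    have "\<epsilon> * (W + U) \<le> \<epsilon> * (W + U + 1)" using \<epsilon> by (intro mult_left_mono) auto
    also have "\<dots> = e / 4" using W0 U by (simp add: \<epsilon>_def field_simps)
    finally show ?thesis .
  qed
  obtain C where C: "C > 0" "\<And>a b :: complex. \<bar>norm (a + b) powr r - norm a powr r - norm b powr r\<bar> \<le> \<epsilon> * norm b powr r + C * norm a powr r"
    using brezis_lieb_pointwise[of r \<epsilon>] r \<epsilon> by auto
  note um = half_pairD(6)[OF P] and wmeas = half_pairD(6)[OF Pw]
  note um[measurable] wmeas[measurable]
  have iu: "integrable lborel (\<lambda>x. norm (u x) powr r)" using power_integrable[OF P] r by simp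
  have iw: "integrable lborel (\<lambda>x. norm (w n x) powr r)" for n using power_integrable[OF Pw] r by simp
  have iuw: "integrable lborel (\<lambda>x. norm (u x + w n x) powr r)" for n using power_integrable[OF Ps] r by simp
  have "((\<lambda>R. LINT x|lborel. (1 - indicator (cball 0 R) x) * norm (u x) powr r) \<longlongrightarrow> (LINT x|(lborel :: 'a measure). 0)) at_top"
  proof (rule integral_dominated_convergence_at_top[where w="\<lambda>x. norm (u x) powr r"])
    show "AE x in lborel. ((\<lambda>R. (1 - indicator (cball 0 R) x) * norm (u x) powr r) \<longlongrightarrow> 0) at_top"
    proof (rule AE_I2)
      fix x
      show "((\<lambda>R. (1 - indicator (cball 0 R) x) * norm (u x) powr r) \<longlongrightarrow> 0) at_top"
        by (rule tendsto_eventually, rule eventually_mono[OF eventually_ge_at_top[of "norm x"]]) auto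
    qed
    show "\<forall>\<^sub>F R in at_top. AE x in lborel. norm ((1 - indicator (cball 0 R) x) * norm (u x) powr r) \<le> norm (u x) powr r"
      by (intro always_eventually allI AE_I2) (auto simp: indicator_def)
  qed (use iu in auto)
  then have "((\<lambda>R. LINT x|lborel. (1 - indicator (cball 0 R) x) * norm (u x) powr r) \<longlongrightarrow> 0) at_top" by simp
  from order_tendstoD(2)[OF this, of "e / (4 * C)"] obtain R where
    R: "(LINT x|lborel. (1 - indicator (cball 0 R) x) * norm (u x) powr r) < e / (4 * C)"
    using e C(1) by (auto simp: eventually_at_top_linorder)
  \<comment> \<open>On the ball the power r is interpolated between the square, whose integral tends
    to 0, and the endpoint power, whose integral is only bounded and therefore receives the small
    coefficient \<delta>.\<close>
  define \<delta> where "\<delta> = e / (8 * C * (K1 + 1))"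
  have \<delta>: "\<delta> > 0" using e C K1 by (simp add: \<delta>_def)
  obtain C3 where C3: "C3 > 0" "\<And>t. t \<ge> 0 \<Longrightarrow> t powr r \<le> C3 * t powr 2 + \<delta> * t powr s"
    using powr_young_high[of 2 r s \<delta>] r \<delta> unfolding s_def by auto
  have "e / (8 * C * C3) > 0" using e C C3 by simp
  from LIMSEQ_D[OF loc[of R] this] obtain N where
    N: "\<And>n. n \<ge> N \<Longrightarrow> norm ((LINT x|lborel. indicator (cball 0 R) x * (norm (w n x))\<^sup>2) - 0) < e / (8 * C * C3)" by blast
  have iw2: "integrable lborel (\<lambda>x. indicator (cball 0 R) x * (norm (w n x))\<^sup>2)" for n
    by (rule Bochner_Integration.integrable_bound[OF L2_integrable[OF half_pairD(1)[OF Pw], of n]])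
      (auto simp: indicator_def)
  have iwB: "integrable lborel (\<lambda>x. indicator (cball 0 R) x * norm (w n x) powr r)" for n
    by (rule Bochner_Integration.integrable_bound[OF iw[of n]]) (auto simp: indicator_def)
  have iuB: "integrable lborel (\<lambda>x. (1 - indicator (cball 0 R) x) * norm (u x) powr r)"
    by (rule Bochner_Integration.integrable_bound[OF iu]) (auto simp: indicator_def)
  show "\<exists>N. \<forall>n\<ge>N. norm (power_integral r (\<lambda>x. u x + w n x) - power_integral r (w n) - power_integral r u) < e"
  proof (intro exI[of _ N] allI impI)
    fix n assume n: "N \<le> n"
    have "(LINT x|lborel. indicator (cball 0 R) x * norm (w n x) powr r) \<le> (LINT x|lborel. C3 * (indicator (cball 0 R) x * (norm (w n x))\<^sup>2) + \<delta> * norm (w n x) powr s)"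
    proof (intro integral_mono iwB Bochner_Integration.integrable_add integrable_mult_right iw2 ws)
      fix x
      show "indicator (cball 0 R) x * norm (w n x) powr r \<le> C3 * (indicator (cball 0 R) x * (norm (w n x))\<^sup>2) + \<delta> * norm (w n x) powr s"
        using C3(2)[of "norm (w n x)"] \<delta> by (auto simp: indicator_def)
    qed
    also have "\<dots> = C3 * (LINT x|lborel. indicator (cball 0 R) x * (norm (w n x))\<^sup>2) + \<delta> * power_integral s (w n)"
      unfolding power_integral_def using iw2 ws by simp
    also have "\<dots> \<le> C3 * (e / (8 * C * C3)) + \<delta> * (K1 + 1)"
      using N[OF n] ws(2)[of n] C3 \<delta> by (intro add_mono mult_left_mono) auto
    also have "\<dots> = e / (4 * C)"
    proof -
      have "C3 * (e / (8 * C * C3)) = e / (8 * C)" using C3(1) by simp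
      moreover have "\<delta> * (K1 + 1) = e / (8 * C)" using K1 by (simp add: \<delta>_def)
      ultimately show ?thesis by simp
    qed
    finally have wB: "(LINT x|lborel. indicator (cball 0 R) x * norm (w n x) powr r) \<le> e / (4 * C)" .
    have "norm (power_integral r (\<lambda>x. u x + w n x) - power_integral r (w n) - power_integral r u) =
       norm (LINT x|lborel. norm (u x + w n x) powr r - norm (w n x) powr r - norm (u x) powr r)"
      unfolding power_integral_def using iu iw iuw by simp
    also have "\<dots> \<le> (LINT x|lborel. \<epsilon> * (norm (w n x) powr r + norm (u x) powr r) + C * ((1 - indicator (cball 0 R) x) * norm (u x) powr r)
       + C * (indicator (cball 0 R) x * norm (w n x) powr r))"
    proof (rule Bochner_Integration.integral_norm_bound_integral)
      fix x
      show "norm (norm (u x + w n x) powr r - norm (w n x) powr r - norm (u x) powr r) \<le> 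
        \<epsilon> * (norm (w n x) powr r + norm (u x) powr r) + C * ((1 - indicator (cball 0 R) x) * norm (u x) powr r)
         + C * (indicator (cball 0 R) x * norm (w n x) powr r)"
      proof (cases "x \<in> cball 0 R")
        case True
        have "0 \<le> \<epsilon> * norm (w n x) powr r" using \<epsilon> by simp
        then show ?thesis using C(2)[of "w n x" "u x"] True by (simp add: add.commute distrib_left)
      next
        case False
        have "0 \<le> \<epsilon> * norm (u x) powr r" using \<epsilon> by simp
        then show ?thesis using C(2)[of "u x" "w n x"] False by (simp add: distrib_left)
      qed
    qed (use iu iw iuw iuB iwB in auto)
    also have "\<dots> = \<epsilon> * (power_integral r (w n) + U) + C * (LINT x|lborel. (1 - indicator (cball 0 R) x) * norm (u x) powr r)
       + C * (LINT x|lborel. indicator (cball 0 R) x * norm (w n x) powr r)"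
      unfolding U_def power_integral_def using iu iw iuB iwB by simp
    also have "\<dots> < e / 4 + C * (e / (4 * C)) + C * (e / (4 * C)) + e / 4"
    proof -
      have "\<epsilon> * (power_integral r (w n) + U) \<le> \<epsilon> * (W + U)" using W \<epsilon> by (intro mult_left_mono) auto
      moreover have "C * (LINT x|lborel. (1 - indicator (cball 0 R) x) * norm (u x) powr r) \<le> C * (e / (4 * C))"
        using R C by (intro mult_left_mono) auto
      moreover have "C * (LINT x|lborel. indicator (cball 0 R) x * norm (w n x) powr r) \<le> C * (e / (4 * C))"
        using wB C by (intro mult_left_mono) auto
      ultimately show ?thesis using \<epsilon>W e by linarith
    qed
    also have "\<dots> = e" using C by (simp add: field_simps)
    finally show "norm (power_integral r (\<lambda>x. u x + w n x) - power_integral r (w n) - power_integral r u) < e" .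
  qed
qed

text \<open>Weak compactness is applied to sqrt(1 + |\<xi>|) f, so that dividing the limit by the
  weight gives finite kinetic energy. It also admits test functions that grow like the weight times
  an element of L^2, as the kinetic cross term demands.\<close>

lemma half_weak_limit:
  fixes u f :: "nat \<Rightarrow> 'a \<Rightarrow> complex"
  assumes P: "\<And>n. half_pair (u n) (f n)" and B: "\<And>n. L2_norm (u n) \<le> B" and K: "\<And>n. half_energy (f n) \<le> K"
  obtains r w g where "strict_mono r" "half_pair w g"
    "\<And>h. h \<in> L2 \<Longrightarrow> (\<lambda>n. LINT \<xi>|lborel. f (r n) \<xi> * (of_real (sqrt (1 + norm \<xi>)) * h \<xi>)) \<longlonglongrightarrow> (LINT \<xi>|lborel. g \<xi> * (of_real (sqrt (1 + norm \<xi>)) * h \<xi>))"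
proof -
  define \<sigma> where "\<sigma> \<xi> = complex_of_real (sqrt (1 + norm \<xi>))" for \<xi> :: 'a
  have \<sigma>0: "\<sigma> \<xi> \<noteq> 0" for \<xi> by (simp add: \<sigma>_def add_nonneg_eq_0_iff)
  have \<sigma>n: "(norm (\<sigma> \<xi>))\<^sup>2 = 1 + norm \<xi>" "1 \<le> norm (\<sigma> \<xi>)" for \<xi> by (simp_all add: \<sigma>_def)
  have [measurable]: "\<sigma> \<in> borel_measurable borel" unfolding \<sigma>_def by measurable
  define F where "F n \<xi> = \<sigma> \<xi> * f n \<xi>" for n \<xi>
  have B0: "B \<ge> 0" using B[of 0] L2_norm_nonneg[of "u 0"] by linarith
  have K0: "K \<ge> 0" using K[of 0] half_energy_nonneg[of "f 0"] by linarith
  have F2: "(norm (F n \<xi>))\<^sup>2 = (norm (f n \<xi>))\<^sup>2 + norm \<xi> * (norm (f n \<xi>))\<^sup>2" for n \<xi>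
    by (simp add: F_def norm_mult power_mult_distrib \<sigma>n algebra_simps)
  have F: "F n \<in> L2" "L2_norm (F n) \<le> sqrt (B\<^sup>2 + K)" for n
  proof -
    note D = half_pairD[OF P[of n]]
    note D(7)[measurable]
    show "F n \<in> L2"
    proof (rule L2I)
      show "integrable lborel (\<lambda>x. (norm (F n x))\<^sup>2)" unfolding F2 using D by (simp add: L2_integrable)
    qed (unfold F_def, measurable)
    have "(LINT x|lborel. (norm (F n x))\<^sup>2) = (L2_norm (f n))\<^sup>2 + half_energy (f n)"
      unfolding F2 half_energy_def L2_norm_squared using D by (simp add: L2_integrable)
    also have "\<dots> \<le> B\<^sup>2 + K" using B[of n] K[of n] D(5) by (intro add_mono power_mono) auto
    finally show "L2_norm (F n) \<le> sqrt (B\<^sup>2 + K)" unfolding L2_norm_def by (rule real_sqrt_le_mono)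
  qed
  obtain G r where r: "strict_mono r" and G: "G \<in> L2"
    and lim: "\<And>h. h \<in> L2 \<Longrightarrow> (\<lambda>n. LINT x|lborel. F (r n) x * h x) \<longlonglongrightarrow> (LINT x|lborel. G x * h x)"
    by (rule L2_weakly_compact[of F "sqrt (B\<^sup>2 + K)", OF F]) (rule that)
  note G[THEN L2_measurable, measurable]
  define g where "g \<xi> = G \<xi> / \<sigma> \<xi>" for \<xi>
  have [measurable]: "g \<in> borel_measurable borel" unfolding g_def by measurable
  have Gg: "G \<xi> = \<sigma> \<xi> * g \<xi>" for \<xi> using \<sigma>0 by (simp add: g_def)
  have gG: "norm (g \<xi>) \<le> norm (G \<xi>)" for \<xi>
    unfolding Gg norm_mult using mult_right_mono[OF \<sigma>n(2)[of \<xi>], of "norm (g \<xi>)"] by simp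
  have g: "g \<in> L2" by (rule L2_bound[OF G _ gG]) measurable
  obtain w where w: "w \<in> L2" "is_fourier_L2 w g" by (rule is_fourier_L2_surj[OF g])
  have "integrable lborel (\<lambda>\<xi>. norm \<xi> * (norm (g \<xi>))\<^sup>2)"
  proof (rule Bochner_Integration.integrable_bound[OF L2_integrable[OF G]])
    have "norm \<xi> * (norm (g \<xi>))\<^sup>2 \<le> (norm (G \<xi>))\<^sup>2" for \<xi>
      by (simp add: Gg norm_mult power_mult_distrib \<sigma>n distrib_right)
    then show "AE \<xi> in lborel. norm (norm \<xi> * (norm (g \<xi>))\<^sup>2) \<le> norm ((norm (G \<xi>))\<^sup>2)" by simp
  qed measurable
  then have "half_pair w g" using w by (simp add: half_pair_def)
  moreover have "(\<lambda>n. LINT \<xi>|lborel. f (r n) \<xi> * (\<sigma> \<xi> * h \<xi>)) \<longlonglongrightarrow> (LINT \<xi>|lborel. g \<xi> * (\<sigma> \<xi> * h \<xi>))" if "h \<in> L2" for h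
    using lim[OF that] by (simp add: F_def Gg mult_ac)
  ultimately show ?thesis using that r unfolding \<sigma>_def by blast
qed

text \<open>Polarization, with the cross term written as a pairing of \<open>f\<close> with a
  function of \<open>g\<close> alone, so that weak convergence can be applied to it.\<close>

lemma kin_diff:
  fixes f g :: "'a \<Rightarrow> complex"
  assumes P: "half_pair u f" and Q: "half_pair w g"
  shows "kin (\<lambda>\<xi>. f \<xi> - g \<xi>) = kin f + kin g - 2 * Re (LINT \<xi>|lborel. f \<xi> * (of_real (norm \<xi> - v \<bullet> \<xi>) * cnj (g \<xi>)))"
proof -
  note D = half_pairD[OF P] and D' = half_pairD[OF Q]
  note D(7)[measurable] D'(7)[measurable]
  have i1: "integrable lborel (\<lambda>\<xi>. (norm \<xi> - v \<bullet> \<xi>) * (norm (f \<xi>))\<^sup>2)" "integrable lborel (\<lambda>\<xi>. (norm \<xi> - v \<bullet> \<xi>) * (norm (g \<xi>))\<^sup>2)"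
    using D D' by (auto intro: kin_integrable)
  have i2: "integrable lborel (\<lambda>\<xi>. f \<xi> * (of_real (norm \<xi> - v \<bullet> \<xi>) * cnj (g \<xi>)))"
  proof (rule Bochner_Integration.integrable_bound[OF Bochner_Integration.integrable_add[OF i1]])
    show "AE \<xi> in lborel. norm (f \<xi> * (of_real (norm \<xi> - v \<bullet> \<xi>) * cnj (g \<xi>))) \<le> norm ((norm \<xi> - v \<bullet> \<xi>) * (norm (f \<xi>))\<^sup>2 + (norm \<xi> - v \<bullet> \<xi>) * (norm (g \<xi>))\<^sup>2)"
    proof (rule AE_I2)
      fix \<xi> :: 'a
      have "norm (f \<xi>) * norm (g \<xi>) \<le> (norm (f \<xi>))\<^sup>2 + (norm (g \<xi>))\<^sup>2"
        using sum_squares_bound[of "norm (f \<xi>)" "norm (g \<xi>)"] mult_nonneg_nonneg[of "norm (f \<xi>)" "norm (g \<xi>)"]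
        by (simp del: mult_nonneg_nonneg)
      from mult_left_mono[OF this symbol_bounds(3)[of \<xi>]]
      have "(norm \<xi> - v \<bullet> \<xi>) * (norm (f \<xi>) * norm (g \<xi>)) \<le> (norm \<xi> - v \<bullet> \<xi>) * (norm (f \<xi>))\<^sup>2 + (norm \<xi> - v \<bullet> \<xi>) * (norm (g \<xi>))\<^sup>2"
        by (simp add: distrib_left)
      moreover have "norm (f \<xi> * (of_real (norm \<xi> - v \<bullet> \<xi>) * cnj (g \<xi>))) = (norm \<xi> - v \<bullet> \<xi>) * (norm (f \<xi>) * norm (g \<xi>))"
        unfolding norm_mult norm_of_real complex_mod_cnj using symbol_bounds(3)[of \<xi>] by (simp add: abs_of_nonneg)
      ultimately show "norm (f \<xi> * (of_real (norm \<xi> - v \<bullet> \<xi>) * cnj (g \<xi>))) \<le> norm ((norm \<xi> - v \<bullet> \<xi>) * (norm (f \<xi>))\<^sup>2 + (norm \<xi> - v \<bullet> \<xi>) * (norm (g \<xi>))\<^sup>2)"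
        by (metis abs_ge_self order_trans real_norm_def)
    qed
  qed measurable
  have "(norm \<xi> - v \<bullet> \<xi>) * (norm (f \<xi> - g \<xi>))\<^sup>2 = (norm \<xi> - v \<bullet> \<xi>) * (norm (f \<xi>))\<^sup>2 + (norm \<xi> - v \<bullet> \<xi>) * (norm (g \<xi>))\<^sup>2
     - 2 * Re (f \<xi> * (of_real (norm \<xi> - v \<bullet> \<xi>) * cnj (g \<xi>)))" for \<xi>
    unfolding cmod_power2 by (simp add: power2_eq_square algebra_simps)
  then have "kin (\<lambda>\<xi>. f \<xi> - g \<xi>) = (LINT \<xi>|lborel. (norm \<xi> - v \<bullet> \<xi>) * (norm (f \<xi>))\<^sup>2 + (norm \<xi> - v \<bullet> \<xi>) * (norm (g \<xi>))\<^sup>2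
     - 2 * Re (f \<xi> * (of_real (norm \<xi> - v \<bullet> \<xi>) * cnj (g \<xi>))))"
    unfolding kin_def by presburger
  also have "\<dots> = kin f + kin g - 2 * (LINT \<xi>|lborel. Re (f \<xi> * (of_real (norm \<xi> - v \<bullet> \<xi>) * cnj (g \<xi>))))"
  proof -
    define X where "X \<xi> = Re (f \<xi> * (of_real (norm \<xi> - v \<bullet> \<xi>) * cnj (g \<xi>)))" for \<xi>
    have "integrable lborel X" using integrable_Re[OF i2] by (simp only: X_def[abs_def])
    then show ?thesis unfolding kin_def X_def[symmetric] using i1 by simp
  qed
  also have "(LINT \<xi>|lborel. Re (f \<xi> * (of_real (norm \<xi> - v \<bullet> \<xi>) * cnj (g \<xi>)))) = Re (LINT \<xi>|lborel. f \<xi> * (of_real (norm \<xi> - v \<bullet> \<xi>) * cnj (g \<xi>)))"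
    by (rule integral_Re[OF i2])
  finally show ?thesis .
qed

text \<open>Replacing \<open>w(x)\<close> by \<open>w(x / \<mu>)\<close> multiplies the mass and the two potential terms by \<open>\<mu>\<^sup>d\<close>, but the kinetic term only by
  the smaller factor \<open>\<mu>\<close> to the power \<open>d - 1\<close>.\<close>

lemma energy_dilate:
  fixes w g :: "'a \<Rightarrow> complex"
  assumes P: "half_pair w g" and \<rho>: "0 < L2_norm w" "L2_norm w \<le> \<rho>"
    and lower: "\<And>(w :: 'a \<Rightarrow> complex) g. half_pair w g \<Longrightarrow> L2_norm w = \<rho> \<Longrightarrow> c \<le> E w"
  shows "(L2_norm w)\<^sup>2 / \<rho>\<^sup>2 * c \<le> E w" "L2_norm w < \<rho> \<Longrightarrow> (L2_norm w)\<^sup>2 / \<rho>\<^sup>2 * c < E w"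
proof -
  define \<mu> where "\<mu> = (\<rho>\<^sup>2 / (L2_norm w)\<^sup>2) powr (1 / real DIM('a))"
  have \<rho>0: "\<rho> > 0" using \<rho> by simp
  have base: "\<rho>\<^sup>2 / (L2_norm w)\<^sup>2 \<ge> 1" using \<rho> by (simp add: power_mono)
  have \<mu>1: "\<mu> \<ge> 1" unfolding \<mu>_def by (rule ge_one_powr_ge_zero[OF base]) simp
  then have \<mu>0: "\<mu> > 0" by linarith
  have "\<mu> ^ DIM('a) = \<mu> powr real DIM('a)" using \<mu>0 by (rule powr_realpow[symmetric])
  also have "\<dots> = \<rho>\<^sup>2 / (L2_norm w)\<^sup>2" unfolding \<mu>_def powr_powr using base by simp
  finally have \<mu>: "\<mu> > 0" "\<mu> ^ DIM('a) = \<rho>\<^sup>2 / (L2_norm w)\<^sup>2" "\<mu> \<ge> 1" using \<mu>0 \<mu>1 by auto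
  define w' where "w' x = complex_of_real 1 * w ((1 / \<mu>) *\<^sub>R x)" for x
  define g' where "g' \<xi> = complex_of_real (1 * \<mu> ^ DIM('a)) * g (\<mu> *\<^sub>R \<xi>)" for \<xi>
  note D = half_pair_dilate[OF P zero_less_one \<mu>(1), folded w'_def g'_def]
  have "(L2_norm w')\<^sup>2 = \<rho>\<^sup>2" using D(2) \<rho> by (simp add: \<mu>(2))
  then have "L2_norm w' = \<rho>" using \<rho>0 by (simp add: power2_eq_iff_nonneg)
  from lower[OF D(1) this] have "c \<le> E w'" .
  also have "E w' = \<mu> ^ DIM('a) * (E w - (1 - 1 / \<mu>) * kin g / 2)"
    unfolding energy_eq[OF D(1)] energy_eq[OF P] D(3,4) by (simp add: algebra_simps diff_divide_distrib)
  finally have "c \<le> \<rho>\<^sup>2 / (L2_norm w)\<^sup>2 * (E w - (1 - 1 / \<mu>) * kin g / 2)" using \<mu> by simp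
  from mult_left_mono[OF this, of "(L2_norm w)\<^sup>2 / \<rho>\<^sup>2"]
  have le: "(L2_norm w)\<^sup>2 / \<rho>\<^sup>2 * c \<le> E w - (1 - 1 / \<mu>) * kin g / 2" using \<rho> \<rho>0 by simp
  have "(1 - 1 / \<mu>) * kin g / 2 \<ge> 0" using \<mu> kin_nonneg by simp
  then show "(L2_norm w)\<^sup>2 / \<rho>\<^sup>2 * c \<le> E w" using le by linarith
  assume lt: "L2_norm w < \<rho>"
  have "\<mu> \<noteq> 1"
  proof
    assume "\<mu> = 1"
    then have "\<rho>\<^sup>2 = (L2_norm w)\<^sup>2" using \<mu>(2) \<rho> by simp
    then show False using lt \<rho> \<rho>0 by (simp add: power2_eq_iff_nonneg)
  qed
  then have "(1 - 1 / \<mu>) * kin g / 2 > 0" using \<mu> kin_pos[OF P \<rho>(1)] by simp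
  then show "(L2_norm w)\<^sup>2 / \<rho>\<^sup>2 * c < E w" using le by linarith
qed

text \<open>Covers remainders of mass zero, which no dilation brings to a positive mass.\<close>

lemma energy_nonneg_of_mass_0:
  fixes w g :: "'a \<Rightarrow> complex"
  assumes P: "half_pair w g" and "L2_norm w = 0"
  shows "0 \<le> E w"
proof -
  note D = half_pairD[OF P]
  note D(6)[measurable]
  have "AE x in lborel. w x = 0" by (rule L2_norm_eq_0_AE[OF D(1) assms(2)])
  then have "power_integral (p + 1) w = (LINT x|(lborel :: 'a measure). 0)"
    unfolding power_integral_def by (intro integral_cong_AE) auto
  then show ?thesis
    unfolding energy_eq[OF P] using kin_nonneg[of g] q by simp
qed

section \<open>Existence of minimizers\<close>

text \<open>With \<open>w\<close> the weak limit and \<open>W\<^sub>n = U\<^sub>n - w\<close>, the energy splits as \<open>E(U\<^sub>n) = E(w) + E(W\<^sub>n) + o(1)\<close>. As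
  \<open>E(W\<^sub>n) \<ge> (\<parallel>W\<^sub>n\<parallel>\<^sup>2 / \<rho>\<^sup>2) c\<close>, this leaves \<open>E(w) \<le> (\<parallel>w\<parallel>\<^sup>2 / \<rho>\<^sup>2) c\<close>, which is impossible if \<open>\<parallel>w\<parallel> < \<rho>\<close>.\<close>

lemma weak_limit_minimizes:
  fixes u f :: "nat \<Rightarrow> 'a \<Rightarrow> complex"
  assumes P: "\<And>n. half_pair (u n) (f n)" and B: "\<And>n. L2_norm (u n) \<le> B" and K: "\<And>n. half_energy (f n) \<le> K"
    and \<rho>: "\<rho> > 0" "(\<lambda>n. L2_norm (u n)) \<longlonglongrightarrow> \<rho>"
    and lower: "\<And>(w :: 'a \<Rightarrow> complex) g. half_pair w g \<Longrightarrow> L2_norm w = \<rho> \<Longrightarrow> c \<le> E w"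
    and E: "\<And>e. e > 0 \<Longrightarrow> \<forall>\<^sub>F n in sequentially. E (u n) \<le> c + e"
    and A: "A0 > 0" "\<eta> > 0" "\<And>n. norm (lowpass (f n) A0 0) \<ge> \<eta>"
  shows "\<exists>w g. half_pair w g \<and> L2_norm w = \<rho> \<and> E w \<le> c"
proof -
  obtain r w g where r: "strict_mono r" and Pw: "half_pair w g"
    and weak: "\<And>h. h \<in> L2 \<Longrightarrow> (\<lambda>n. LINT \<xi>|lborel. f (r n) \<xi> * (of_real (sqrt (1 + norm \<xi>)) * h \<xi>)) \<longlonglongrightarrow> (LINT \<xi>|lborel. g \<xi> * (of_real (sqrt (1 + norm \<xi>)) * h \<xi>))"
    by (rule half_weak_limit[OF P B K]) (rule that)
  define U F where "U n = u (r n)" and "F n = f (r n)" for n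
  have PU: "half_pair (U n) (F n)" for n using P by (simp add: U_def F_def)
  define W \<Phi> where "W n x = U n x - w x" and "\<Phi> n \<xi> = F n \<xi> - g \<xi>" for n x \<xi>
  have PW: "half_pair (W n) (\<Phi> n)" for n unfolding W_def[abs_def] \<Phi>_def[abs_def] by (rule half_pair_diff[OF PU Pw])
  note Dg = half_pairD[OF Pw]
  note Dg(7)[measurable]
  have DF: "F n \<in> L2" for n using half_pairD(3)[OF PU] .
  have \<sigma>: "sqrt (1 + norm \<xi>) \<ge> 1" "sqrt (1 + norm \<xi>) \<noteq> 0" for \<xi> :: 'a
    by (simp_all add: add_nonneg_eq_0_iff)
  \<comment> \<open>The admissible test functions, described by what is left after division by the
    weight.\<close>
  have conv: "(\<lambda>n. LINT \<xi>|lborel. F n \<xi> * \<phi> \<xi>) \<longlonglongrightarrow> (LINT \<xi>|lborel. g \<xi> * \<phi> \<xi>)"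
    if "(\<lambda>\<xi>. \<phi> \<xi> / of_real (sqrt (1 + norm \<xi>))) \<in> L2" for \<phi>
  proof -
    have "of_real (sqrt (1 + norm \<xi>)) * (\<phi> \<xi> / of_real (sqrt (1 + norm \<xi>))) = \<phi> \<xi>" for \<xi>
      using \<sigma>(2)[of \<xi>] by simp
    then show ?thesis using weak[OF that] by (simp add: F_def)
  qed
  have conv_g: "(\<lambda>n. LINT \<xi>|lborel. F n \<xi> * cnj (g \<xi>)) \<longlonglongrightarrow> (LINT \<xi>|lborel. g \<xi> * cnj (g \<xi>))"
  proof (rule conv, rule L2_bound[OF Dg(3)])
    fix \<xi>
    show "norm (cnj (g \<xi>) / of_real (sqrt (1 + norm \<xi>))) \<le> norm (g \<xi>)"
      using \<sigma>(1)[of \<xi>] frac_le[of "norm (g \<xi>)" "norm (g \<xi>)" 1 "sqrt (1 + norm \<xi>)"] by (simp add: norm_divide)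
  qed measurable
  \<comment> \<open>The symbol times \<open>g\<close> need not be in L^2. Divided by the weight it
    is at most 2 sqrt(1 + |\<xi>|) |g|, which is in L^2 because \<open>g\<close> has finite kinetic
    energy.\<close>
  have conv_a: "(\<lambda>n. LINT \<xi>|lborel. F n \<xi> * (of_real (norm \<xi> - v \<bullet> \<xi>) * cnj (g \<xi>))) \<longlonglongrightarrow> (LINT \<xi>|lborel. g \<xi> * (of_real (norm \<xi> - v \<bullet> \<xi>) * cnj (g \<xi>)))"
  proof (rule conv, rule L2_bound[where w="\<lambda>\<xi>. of_real (2 * sqrt (1 + norm \<xi>)) * g \<xi>"])
    show "(\<lambda>\<xi>. complex_of_real (2 * sqrt (1 + norm \<xi>)) * g \<xi>) \<in> L2"
    proof (rule L2I)
      have "(norm (complex_of_real (2 * sqrt (1 + norm \<xi>)) * g \<xi>))\<^sup>2 = 4 * (norm (g \<xi>))\<^sup>2 + 4 * (norm \<xi> * (norm (g \<xi>))\<^sup>2)" for \<xi>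
        unfolding norm_mult norm_of_real power_mult_distrib power2_abs by (simp add: power_mult_distrib algebra_simps)
      then show "integrable lborel (\<lambda>\<xi>. (norm (complex_of_real (2 * sqrt (1 + norm \<xi>)) * g \<xi>))\<^sup>2)"
        using Dg by (simp add: L2_integrable)
    qed measurable
    fix \<xi>
    have "norm (complex_of_real (norm \<xi> - v \<bullet> \<xi>) * cnj (g \<xi>) / of_real (sqrt (1 + norm \<xi>))) = (norm \<xi> - v \<bullet> \<xi>) / sqrt (1 + norm \<xi>) * norm (g \<xi>)"
      unfolding norm_divide norm_mult norm_of_real using symbol_bounds(3)[of \<xi>] \<sigma>(1)[of \<xi>] by (simp add: abs_of_nonneg)
    also have "\<dots> \<le> 2 * sqrt (1 + norm \<xi>) * norm (g \<xi>)"
    proof (rule mult_right_mono)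
      have "norm \<xi> - v \<bullet> \<xi> \<le> 2 * (1 + norm \<xi>)" using symbol_bounds(2)[of \<xi>] by simp
      also have "\<dots> = 2 * sqrt (1 + norm \<xi>) * sqrt (1 + norm \<xi>)" by (simp add: mult.assoc)
      finally show "(norm \<xi> - v \<bullet> \<xi>) / sqrt (1 + norm \<xi>) \<le> 2 * sqrt (1 + norm \<xi>)"
        using \<sigma>(1)[of \<xi>] less_le_trans[OF zero_less_one \<sigma>(1)[of \<xi>]] by (simp only: pos_divide_le_eq)
    qed simp
    also have "\<dots> = norm (complex_of_real (2 * sqrt (1 + norm \<xi>)) * g \<xi>)"
      unfolding norm_mult norm_of_real using \<sigma>(1)[of \<xi>] by simp
    finally show "norm (complex_of_real (norm \<xi> - v \<bullet> \<xi>) * cnj (g \<xi>) / of_real (sqrt (1 + norm \<xi>))) \<le> norm (complex_of_real (2 * sqrt (1 + norm \<xi>)) * g \<xi>)" .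
  qed measurable
  \<comment> \<open>At a fixed point the low-frequency part is a pairing with a bounded function
    supported in a ball, so weak convergence suffices.\<close>
  have conv_l: "(\<lambda>n. lowpass (F n) A x) \<longlonglongrightarrow> lowpass g A x" for A x
  proof -
    define \<phi> where "\<phi> \<xi> = cis (- (- x \<bullet> \<xi>)) * indicator (cball 0 A) \<xi>" for \<xi> :: 'a
    have "(\<lambda>n. LINT \<xi>|lborel. F n \<xi> * \<phi> \<xi>) \<longlonglongrightarrow> (LINT \<xi>|lborel. g \<xi> * \<phi> \<xi>)"
    proof (rule conv, rule L2_bound)
      show "(\<lambda>\<xi>::'a. indicator (cball 0 A) \<xi> :: complex) \<in> L2" by (rule L2_indicator_cball)
      fix \<xi> :: 'a
      show "norm (\<phi> \<xi> / of_real (sqrt (1 + norm \<xi>))) \<le> norm (indicator (cball 0 A) \<xi> :: complex)"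
        using \<sigma>(1)[of \<xi>] frac_le[of "norm (indicator (cball 0 A) \<xi> :: complex)" "norm (indicator (cball 0 A) \<xi> :: complex)" 1 "sqrt (1 + norm \<xi>)"]
        by (simp add: \<phi>_def norm_divide norm_mult)
    qed (unfold \<phi>_def, measurable)
    then have "(\<lambda>n. of_real ((2 * pi) powr (- real DIM('a) / 2)) * (LINT \<xi>|lborel. F n \<xi> * \<phi> \<xi>)) \<longlonglongrightarrow> of_real ((2 * pi) powr (- real DIM('a) / 2)) * (LINT \<xi>|lborel. g \<xi> * \<phi> \<xi>)"
      by (intro tendsto_intros)
    moreover have "of_real ((2 * pi) powr (- real DIM('a) / 2)) * (LINT \<xi>|lborel. h \<xi> * \<phi> \<xi>) = lowpass h A x" for h
      unfolding lowpass_def fourier_L1_def \<phi>_def by (simp add: mult_ac)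
    ultimately show ?thesis by (simp only:)
  qed
  have low0: "(\<lambda>n. lowpass (\<Phi> n) A x) \<longlonglongrightarrow> 0" for A x
  proof -
    have "lowpass (\<Phi> n) A x = lowpass (F n) A x - lowpass g A x" for n
      unfolding lowpass_def \<Phi>_def
      using fourier_L1_diff[OF L2_cball_integrable[OF DF] L2_cball_integrable[OF Dg(3)], of A n A "- x"]
      by (simp add: right_diff_distrib)
    then show ?thesis using conv_l[of A x] by (simp add: LIM_zero)
  qed
  have g2: "(LINT \<xi>|lborel. g \<xi> * cnj (g \<xi>)) = of_real ((L2_norm w)\<^sup>2)"
  proof -
    have "(LINT \<xi>|lborel. g \<xi> * cnj (g \<xi>)) = (LINT \<xi>|lborel. complex_of_real ((norm (g \<xi>))\<^sup>2))"
      by (simp add: complex_norm_square del: of_real_power)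
    also have "\<dots> = of_real ((L2_norm g)\<^sup>2)" unfolding L2_norm_squared by (rule integral_complex_of_real)
    finally show ?thesis by (simp add: Dg(5))
  qed
  have ga: "(LINT \<xi>|lborel. g \<xi> * (of_real (norm \<xi> - v \<bullet> \<xi>) * cnj (g \<xi>))) = of_real (kin g)"
  proof -
    have "g \<xi> * (of_real (norm \<xi> - v \<bullet> \<xi>) * cnj (g \<xi>)) = complex_of_real ((norm \<xi> - v \<bullet> \<xi>) * (norm (g \<xi>))\<^sup>2)" for \<xi>
      unfolding of_real_mult complex_norm_square by (simp add: mult_ac)
    then show ?thesis unfolding kin_def by (simp only: integral_complex_of_real)
  qed
  have normU: "(\<lambda>n. L2_norm (U n)) \<longlonglongrightarrow> \<rho>"
    using LIMSEQ_subseq_LIMSEQ[OF \<rho>(2) r] by (simp add: U_def o_def)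
  have massW: "(\<lambda>n. (L2_norm (W n))\<^sup>2) \<longlonglongrightarrow> \<rho>\<^sup>2 - (L2_norm w)\<^sup>2"
  proof -
    have eq: "(L2_norm (W n))\<^sup>2 = (L2_norm (U n))\<^sup>2 + (L2_norm w)\<^sup>2 - 2 * Re (LINT \<xi>|lborel. F n \<xi> * cnj (g \<xi>))" for n
      using L2_norm_diff_squared[OF DF[of n] Dg(3)] half_pairD(5)[OF PW[of n]] half_pairD(5)[OF PU[of n]] Dg(5)
      unfolding \<Phi>_def[abs_def] by simp
    have "(\<lambda>n. (L2_norm (W n))\<^sup>2) \<longlonglongrightarrow> \<rho>\<^sup>2 + (L2_norm w)\<^sup>2 - 2 * Re (of_real ((L2_norm w)\<^sup>2))"
      unfolding eq by (intro tendsto_intros normU conv_g[unfolded g2])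
    then show ?thesis by (simp del: of_real_power)
  qed
  have kinW: "(\<lambda>n. kin (F n) - kin (\<Phi> n)) \<longlonglongrightarrow> kin g"
  proof -
    have eq: "kin (F n) - kin (\<Phi> n) = 2 * Re (LINT \<xi>|lborel. F n \<xi> * (of_real (norm \<xi> - v \<bullet> \<xi>) * cnj (g \<xi>))) - kin g" for n
      using kin_diff[OF PU[of n] Pw] unfolding \<Phi>_def[abs_def] by simp
    have "(\<lambda>n. kin (F n) - kin (\<Phi> n)) \<longlonglongrightarrow> 2 * Re (of_real (kin g)) - kin g"
      unfolding eq by (intro tendsto_intros conv_a[unfolded ga])
    then show ?thesis by simp
  qed
  have WB: "L2_norm (W n) \<le> B + L2_norm w" for n
    using L2_norm_triangle_diff[OF half_pairD(1)[OF PU] Dg(1), of n] B[of "r n"] unfolding W_def[abs_def] U_def by simp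
  have WK: "half_energy (\<Phi> n) \<le> 2 * K + 2 * half_energy g" for n
    using half_integrable_diff(2)[OF DF half_pairD(4)[OF PU] Dg(3,4), of n] K[of "r n"] unfolding \<Phi>_def[abs_def] F_def by simp
  have Ps: "half_pair (\<lambda>x. w x + W n x) (F n)" for n using PU[of n] by (simp add: W_def)
  have loc: "(\<lambda>n. LINT x|lborel. indicator (cball 0 R) x * (norm (W n x))\<^sup>2) \<longlonglongrightarrow> 0" for R
    by (rule rellich[OF PW WB WK low0])
  have BL: "(\<lambda>n. power_integral s (U n) - power_integral s (W n)) \<longlonglongrightarrow> power_integral s w"
    if "2 < s" "s < 2 + 2 / real DIM('a)" for s
    using brezis_lieb[OF that Pw PW Ps WB WK loc] by (simp add: W_def[abs_def])
  have "(\<lambda>n. (kin (F n) - kin (\<Phi> n)) / 2 + (power_integral (q + 1) (U n) - power_integral (q + 1) (W n)) / (q + 1)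
      - (power_integral (p + 1) (U n) - power_integral (p + 1) (W n)) / (p + 1)) \<longlonglongrightarrow>
      kin g / 2 + power_integral (q + 1) w / (q + 1) - power_integral (p + 1) w / (p + 1)"
    using q qp exponents by (intro tendsto_intros kinW BL) auto
  also have "(\<lambda>n. (kin (F n) - kin (\<Phi> n)) / 2 + (power_integral (q + 1) (U n) - power_integral (q + 1) (W n)) / (q + 1)
      - (power_integral (p + 1) (U n) - power_integral (p + 1) (W n)) / (p + 1)) = (\<lambda>n. E (U n) - E (W n))"
    unfolding energy_eq[OF PU] energy_eq[OF PW] diff_divide_distrib by (rule ext) linarith
  also have "kin g / 2 + power_integral (q + 1) w / (q + 1) - power_integral (p + 1) w / (p + 1) = E w"
    by (rule energy_eq[OF Pw, symmetric])
  finally have EL: "(\<lambda>n. E (U n) - E (W n)) \<longlonglongrightarrow> E w" .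
  \<comment> \<open>The lower bound for the low-frequency part at the origin survives the limit and
    excludes the zero function.\<close>
  have w0: "L2_norm w > 0"
  proof (rule ccontr)
    assume "\<not> L2_norm w > 0"
    then have "L2_norm g = 0" using Dg(5) L2_norm_nonneg[of w] by linarith
    then have "AE \<xi> in lborel. g \<xi> = 0" by (rule L2_norm_eq_0_AE[OF Dg(3)])
    then have "(LINT \<xi>|lborel. norm (truncate A0 g \<xi>)) = (LINT \<xi>|(lborel::'a measure). 0)"
      using L2_measurable[OF L2_truncate[OF Dg(3)]] by (intro integral_cong_AE) (auto intro!: borel_measurable_norm)
    then have "norm (lowpass g A0 0) \<le> 0" using norm_lowpass_le[of g A0 0] by simp
    moreover have "\<eta> \<le> norm (lowpass g A0 0)"
      by (rule tendsto_lowerbound[OF tendsto_norm[OF conv_l]]) (use A(3) in \<open>auto simp: F_def\<close>)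
    ultimately show False using A(2) by simp
  qed
  have le: "(L2_norm w)\<^sup>2 \<le> \<rho>\<^sup>2"
    using tendsto_lowerbound[OF massW, of 0] by simp
  \<comment> \<open>Since \<open>w\<close> carries mass, the remainders eventually have mass below
    \<rho>^2, and the dilation bound is available for them.\<close>
  have evW: "\<forall>\<^sub>F n in sequentially. (L2_norm (W n))\<^sup>2 / \<rho>\<^sup>2 * c \<le> E (W n)"
  proof -
    have "\<forall>\<^sub>F n in sequentially. (L2_norm (W n))\<^sup>2 < \<rho>\<^sup>2"
      using w0 by (intro order_tendstoD(2)[OF massW]) simp
    then show ?thesis
    proof eventually_elim
      fix n assume "(L2_norm (W n))\<^sup>2 < \<rho>\<^sup>2"
      then have lt: "L2_norm (W n) < \<rho>" using \<rho>(1) by (simp add: power2_less_imp_less)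
      show "(L2_norm (W n))\<^sup>2 / \<rho>\<^sup>2 * c \<le> E (W n)"
      proof (cases "L2_norm (W n) = 0")
        case True
        then show ?thesis using energy_nonneg_of_mass_0[OF PW True] by simp
      next
        case False
        then have "0 < L2_norm (W n)" using L2_norm_nonneg[of "W n"] by linarith
        from energy_dilate(1)[OF PW this less_imp_le[OF lt] lower] show ?thesis .
      qed
    qed
  qed
  have final: "E w \<le> (L2_norm w)\<^sup>2 / \<rho>\<^sup>2 * c"
  proof (rule field_le_epsilon)
    fix e :: real assume "e > 0"
    have "\<forall>\<^sub>F n in sequentially. E (U n) \<le> c + e"
      using eventually_subseq[OF r E[OF \<open>e > 0\<close>]] by (simp add: U_def)
    with evW have ev: "\<forall>\<^sub>F n in sequentially. E (U n) - E (W n) \<le> c + e - (L2_norm (W n))\<^sup>2 / \<rho>\<^sup>2 * c"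
      by eventually_elim simp
    have "(\<lambda>n. c + e - (L2_norm (W n))\<^sup>2 / \<rho>\<^sup>2 * c) \<longlonglongrightarrow> c + e - (\<rho>\<^sup>2 - (L2_norm w)\<^sup>2) / \<rho>\<^sup>2 * c"
      using \<rho>(1) by (intro tendsto_intros massW) auto
    from tendsto_le[OF sequentially_bot this EL ev]
    show "E w \<le> (L2_norm w)\<^sup>2 / \<rho>\<^sup>2 * c + e" using \<rho>(1) by (simp add: diff_divide_distrib left_diff_distrib)
  qed
  have le': "L2_norm w \<le> \<rho>" using power2_le_imp_le[OF le] \<rho>(1) by simp
  have "L2_norm w = \<rho>"
  proof (rule ccontr)
    assume "L2_norm w \<noteq> \<rho>"
    then have "L2_norm w < \<rho>" using le' by simp
    from energy_dilate(2)[OF Pw w0 le' lower this] show False using final by simp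
  qed
  then show ?thesis using Pw final \<rho>(1) by auto
qed

lemma kin_cong_norm: "(\<And>\<xi>. norm (f \<xi>) = norm (g \<xi>)) \<Longrightarrow> kin f = kin g"
  by (simp add: kin_def)

text \<open>Negative energies supply what \<open>weak_limit_minimizes\<close> asks for: coercivity
  bounds the kinetic energies, and the lower bound on the focusing term provides points where the
  low-frequency parts are large.\<close>

lemma minimizer_exists:
  fixes u f :: "nat \<Rightarrow> 'a \<Rightarrow> complex"
  assumes P: "\<And>n. half_pair (u n) (f n)" and neg: "\<And>n. E (u n) < 0"
    and \<rho>: "\<rho> > 0" "(\<lambda>n. L2_norm (u n)) \<longlonglongrightarrow> \<rho>"
    and lower: "\<And>(w :: 'a \<Rightarrow> complex) g. half_pair w g \<Longrightarrow> L2_norm w = \<rho> \<Longrightarrow> c \<le> E w"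
    and E: "\<And>e. e > 0 \<Longrightarrow> \<forall>\<^sub>F n in sequentially. E (u n) \<le> c + e"
  shows "\<exists>w g. half_pair w g \<and> L2_norm w = \<rho> \<and> E w \<le> c"
proof -
  have "Bseq (\<lambda>n. L2_norm (u n))" by (rule convergent_imp_Bseq) (use \<rho> in \<open>auto simp: convergent_def\<close>)
  then obtain B where B: "B > 0" "\<And>n. L2_norm (u n) \<le> B" by (auto simp: Bseq_def)
  obtain C where C: "C > 0" "\<And>(u :: 'a \<Rightarrow> complex) f. half_pair u f \<Longrightarrow> L2_norm u \<le> B \<Longrightarrow> E u \<ge> (1 - norm v) / 4 * half_energy f - C"
    using energy_coercive[OF B(1)] by blast
  define K where "K = 4 * C / (1 - norm v)"
  have K0: "K > 0" using C v by (simp add: K_def)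
  have K: "half_energy (f n) \<le> K" for n
  proof -
    have "(1 - norm v) / 4 * half_energy (f n) \<le> C" using C(2)[OF P B(2), of n] neg[of n] by linarith
    then show ?thesis using v by (simp add: K_def field_simps)
  qed
  obtain c0 where c0: "c0 > 0" "\<And>(u :: 'a \<Rightarrow> complex) f. half_pair u f \<Longrightarrow> L2_norm u \<le> B \<Longrightarrow> E u < 0 \<Longrightarrow> power_integral (p + 1) u \<ge> c0"
    using power_lower_bound[OF B(1)] by blast
  obtain A \<eta> where A: "A > 0" "\<eta> > 0"
    "\<And>(u :: 'a \<Rightarrow> complex) f. half_pair u f \<Longrightarrow> L2_norm u \<le> B \<Longrightarrow> half_energy f \<le> K \<Longrightarrow> power_integral (p + 1) u \<ge> c0 \<Longrightarrow>
      \<exists>x. norm (lowpass f A x) \<ge> \<eta>"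
    using nonvanishing[OF B(1) K0 c0(1)] by blast
  have "\<exists>x. norm (lowpass (f n) A x) \<ge> \<eta>" for n
    by (rule A(3)[OF P B(2) K c0(2)[OF P B(2) neg]])
  then obtain x where x: "\<And>n. norm (lowpass (f n) A (x n)) \<ge> \<eta>" by metis
  \<comment> \<open>Recentring at the chosen points. On the Fourier side a translation is a factor
    of modulus one, so masses and energies are unchanged.\<close>
  define U F where "U n y = u n (y + x n)" and "F n \<xi> = cis (\<xi> \<bullet> x n) * f n \<xi>" for n y \<xi>
  have PU: "half_pair (U n) (F n)" for n unfolding U_def[abs_def] F_def[abs_def] by (rule half_pair_translate[OF P])
  have nF: "norm (F n \<xi>) = norm (f n \<xi>)" for n \<xi> by (simp add: F_def norm_mult)
  have nU: "L2_norm (U n) = L2_norm (u n)" for n unfolding U_def[abs_def] by (rule L2_norm_translate)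
  have pU: "power_integral s (U n) = power_integral s (u n)" for s n
    unfolding power_integral_def U_def by (rule integral_translate)
  have EU: "E (U n) = E (u n)" for n
    unfolding energy_eq[OF PU] energy_eq[OF P] pU kin_cong_norm[of "F n" "f n", OF nF] ..
  show ?thesis
  proof (rule weak_limit_minimizes[OF PU _ _ \<rho>(1) _ lower _ A(1,2)])
    show "L2_norm (U n) \<le> B" for n using B by (simp add: nU)
    show "half_energy (F n) \<le> K" for n using K[of n] by (simp add: half_energy_def nF)
    show "(\<lambda>n. L2_norm (U n)) \<longlonglongrightarrow> \<rho>" using \<rho> by (simp add: nU)
    show "\<forall>\<^sub>F n in sequentially. E (U n) \<le> c + e" if "e > 0" for e using E[OF that] by (simp add: EU)
    show "\<eta> \<le> norm (lowpass (F n) A 0)" for n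
      unfolding F_def[abs_def] lowpass_translate by (rule x)
  qed
qed

section \<open>Trial functions\<close>

text \<open>The transform is prescribed as the indicator of the unit ball, which makes the kinetic
  energy finite at once; the amplitude then adjusts the mass.\<close>

lemma half_pair_of_mass:
  assumes "\<rho> > 0"
  obtains u f :: "'a \<Rightarrow> complex" where "half_pair u f" "L2_norm u = \<rho>"
proof -
  define f :: "'a \<Rightarrow> complex" where "f \<xi> = indicator (cball 0 1) \<xi>" for \<xi>
  have [measurable]: "f \<in> borel_measurable borel" unfolding f_def by measurable
  note i = integrable_indicator_cball[of "0::'a" 1]
  have f2: "(norm (f \<xi>))\<^sup>2 = indicator (cball 0 1) \<xi>" for \<xi> by (simp add: f_def indicator_def)
  have f: "f \<in> L2" by (rule L2I) (use i in \<open>simp_all add: f2\<close>)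
  have D: "integrable lborel (\<lambda>\<xi>. norm \<xi> * (norm (f \<xi>))\<^sup>2)"
    by (rule Bochner_Integration.integrable_bound[OF i]) (auto simp: f2 indicator_def)
  obtain u where u: "u \<in> L2" "is_fourier_L2 u f" by (rule is_fourier_L2_surj[OF f])
  have P: "half_pair u f" using u D by (simp add: half_pair_def)
  have "(L2_norm u)\<^sup>2 = (L2_norm f)\<^sup>2" using is_fourier_L2_norm[OF u] by simp
  also have "\<dots> = measure lborel (cball (0::'a) 1)" unfolding L2_norm_squared f2 by simp
  also have "\<dots> > 0" by (simp add: content_cball_pos)
  finally have n: "L2_norm u > 0" by (simp add: order_less_le)
  have t: "\<rho> / L2_norm u > 0" using n assms by simp
  have "(L2_norm (\<lambda>x. complex_of_real (\<rho> / L2_norm u) * u x))\<^sup>2 = \<rho>\<^sup>2"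
    using n by (simp only: L2_norm_cmult) (use assms in \<open>simp add: norm_divide\<close>)
  then have "L2_norm (\<lambda>x. complex_of_real (\<rho> / L2_norm u) * u x) = \<rho>" using assms by (simp add: power2_eq_iff_nonneg)
  moreover have "half_pair (\<lambda>x. complex_of_real (\<rho> / L2_norm u) * u x) (\<lambda>\<xi>. of_real (\<rho> / L2_norm u) * f \<xi>)"
    using half_pair_dilate(1)[OF P t zero_less_one] by simp
  ultimately show ?thesis using that by blast
qed

lemma energy_amplitude:
  fixes u f :: "'a \<Rightarrow> complex"
  assumes P: "half_pair u f" and t: "t > 0"
  shows "half_pair (\<lambda>x. of_real t * u x) (\<lambda>\<xi>. of_real t * f \<xi>)" "L2_norm (\<lambda>x. of_real t * u x) = t * L2_norm u"
    "E (\<lambda>x. of_real t * u x) = t\<^sup>2 * kin f / 2 + t powr (q + 1) * power_integral (q + 1) u / (q + 1) - t powr (p + 1) * power_integral (p + 1) u / (p + 1)"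
proof -
  note H = half_pair_dilate[OF P t zero_less_one]
  show Q: "half_pair (\<lambda>x. of_real t * u x) (\<lambda>\<xi>. of_real t * f \<xi>)" using H(1) by simp
  show "L2_norm (\<lambda>x. of_real t * u x) = t * L2_norm u" using t by (simp add: L2_norm_cmult)
  show "E (\<lambda>x. of_real t * u x) = t\<^sup>2 * kin f / 2 + t powr (q + 1) * power_integral (q + 1) u / (q + 1) - t powr (p + 1) * power_integral (p + 1) u / (p + 1)"
    unfolding energy_eq[OF Q] using H(3) H(4)[of "q + 1"] H(4)[of "p + 1"] by simp
qed

text \<open>At large amplitude the focusing term prevails, p + 1 being the largest of the three
  powers.\<close>

lemma energy_negative_exists:
  obtains u f :: "'a \<Rightarrow> complex" where "half_pair u f" "L2_norm u > 0" "E u < 0"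
proof -
  obtain u f :: "'a \<Rightarrow> complex" where P: "half_pair u f" and u: "L2_norm u = 1" using half_pair_of_mass[OF zero_less_one] by blast
  note D = half_pairD[OF P]
  have pp: "p + 1 > 0" "q + 1 > 0" using q qp by auto
  have "power_integral (p + 1) u \<noteq> 0"
  proof
    assume "power_integral (p + 1) u = 0"
    then have "AE x in lborel. norm (u x) powr (p + 1) = 0"
      using integral_nonneg_eq_0_iff_AE[OF power_integrable[OF P, of "p + 1"]] exponents by (simp add: power_integral_def)
    then have "AE x in lborel. u x = 0" by simp
    then have "L2_norm u = L2_norm (\<lambda>x::'a. 0)" by (rule L2_norm_cong_AE) (use D in auto)
    then show False using u by simp
  qed
  then have p0: "power_integral (p + 1) u > 0" using power_integral_nonneg[of "p + 1" u] by linarith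
  \<comment> \<open>The positive part of the energy of t u, divided by t^(p + 1).\<close>
  define a where "a t = t powr (1 - p) * kin f / 2 + t powr (q - p) * power_integral (q + 1) u / (q + 1)" for t :: real
  have "(a \<longlongrightarrow> 0 * kin f / 2 + 0 * power_integral (q + 1) u / (q + 1)) at_top"
    unfolding a_def using q qp by (intro tendsto_intros tendsto_neg_powr filterlim_ident) auto
  then have "(a \<longlongrightarrow> 0) at_top" by simp
  then have "\<forall>\<^sub>F t in at_top. a t < power_integral (p + 1) u / (p + 1)"
    using p0 pp by (intro order_tendstoD) auto
  then have "\<forall>\<^sub>F t in at_top. a t < power_integral (p + 1) u / (p + 1) \<and> t > 0"
    using eventually_gt_at_top[of 0] by (rule eventually_conj)
  then obtain t where t: "a t < power_integral (p + 1) u / (p + 1)" "t > 0"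
    by (auto simp: eventually_at_top_linorder)
  have "E (\<lambda>x. of_real t * u x) = t powr (p + 1) * (a t - power_integral (p + 1) u / (p + 1))"
  proof -
    have "t powr (p + 1) * t powr (1 - p) = t\<^sup>2" "t powr (p + 1) * t powr (q - p) = t powr (q + 1)"
      using t by (simp_all add: powr_add[symmetric] add.commute)
    then show ?thesis unfolding energy_amplitude(3)[OF P t(2)] a_def by (simp add: algebra_simps)
  qed
  also have "\<dots> < 0" using t by (simp add: mult_less_0_iff)
  finally show ?thesis using that energy_amplitude[OF P t(2)] u t by simp
qed

text \<open>Dilation at fixed mass sends both positive terms to zero; the focusing term has a
  favourable sign and is dropped.\<close>

lemma energy_small_exists:
  assumes \<rho>: "\<rho> > 0" and e: "e > 0"
  obtains u f :: "'a \<Rightarrow> complex" where "half_pair u f" "L2_norm u = \<rho>" "E u < e"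
proof -
  obtain u f :: "'a \<Rightarrow> complex" where P: "half_pair u f" and u: "L2_norm u = \<rho>" using half_pair_of_mass[OF \<rho>] by blast
  have pp: "p + 1 > 0" "q + 1 > 0" using q qp by auto
  let ?d = "real DIM('a)"
  have d: "?d > 0" by simp
  define a where "a t = t powr (-1) * kin f / 2 + t powr (- (?d * (q - 1) / 2)) * power_integral (q + 1) u / (q + 1)" for t :: real
  have "(a \<longlongrightarrow> 0 * kin f / 2 + 0 * power_integral (q + 1) u / (q + 1)) at_top"
    unfolding a_def using q qp d by (intro tendsto_intros tendsto_neg_powr filterlim_ident) auto
  then have "(a \<longlongrightarrow> 0) at_top" by simp
  then have "\<forall>\<^sub>F t in at_top. a t < e" using e by (rule order_tendstoD)
  then have "\<forall>\<^sub>F t in at_top. a t < e \<and> t > 0"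
    using eventually_gt_at_top[of 0] by (rule eventually_conj)
  then obtain c where c: "a c < e" "c > 0"
    by (auto simp: eventually_at_top_linorder)
  \<comment> \<open>The amplitude that compensates the factor c^d in the mass.\<close>
  define t where "t = c powr (- ?d / 2)"
  have t: "t > 0" using c by (simp add: t_def)
  have cd: "c ^ DIM('a) = c powr ?d" using c by (simp add: powr_realpow)
  have t2: "t\<^sup>2 * c ^ DIM('a) = 1"
    using c unfolding cd by (simp add: t_def power2_eq_square powr_add[symmetric])
  have tq: "t powr (q + 1) * c ^ DIM('a) = c powr (- (?d * (q - 1) / 2))"
  proof -
    have "- ?d / 2 * (q + 1) + ?d = - (?d * (q - 1) / 2)" by (simp add: field_simps)
    then show ?thesis unfolding cd t_def powr_powr powr_add[symmetric] by (simp only:)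
  qed
  define w where "w x = of_real t * u ((1 / c) *\<^sub>R x)" for x
  define g where "g \<xi> = of_real (t * c ^ DIM('a)) * f (c *\<^sub>R \<xi>)" for \<xi>
  note H = half_pair_dilate[OF P t c(2), folded w_def g_def]
  have "(L2_norm w)\<^sup>2 = \<rho>\<^sup>2" using H(2) u by (simp add: t2)
  then have "L2_norm w = \<rho>" using \<rho> by (simp add: power2_eq_iff_nonneg)
  moreover have "E w \<le> a c"
  proof -
    have "t powr (p + 1) * c ^ DIM('a) * power_integral (p + 1) u / (p + 1) \<ge> 0" using pp c by simp
    moreover have "1 / c * kin f / 2 = c powr (-1) * kin f / 2" using c by (simp add: powr_minus_divide)
    ultimately show ?thesis unfolding energy_eq[OF H(1)] H(3,4) a_def tq t2 by linarith
  qed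
  ultimately show ?thesis using that H(1) c by fastforce
qed

section \<open>The threshold mass\<close>

lemma min_energy_le: "half_pair u f \<Longrightarrow> L2_norm u = \<rho> \<Longrightarrow> min_energy v q p \<rho> \<le> ereal (E u)"
  unfolding min_energy_def by (rule INF_lower) (auto simp: mass_sphere_iff)

lemma min_energy_eq:
  assumes "half_pair u f" "L2_norm u = \<rho>" "\<And>(w :: 'a \<Rightarrow> complex) g. half_pair w g \<Longrightarrow> L2_norm w = \<rho> \<Longrightarrow> E u \<le> E w"
  shows "min_energy v q p \<rho> = ereal (E u)"
proof (rule antisym[OF min_energy_le[OF assms(1,2)]])
  show "ereal (E u) \<le> min_energy v q p \<rho>"
    unfolding min_energy_def by (rule INF_greatest) (use assms(3) in \<open>auto simp: mass_sphere_iff\<close>)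
qed

lemma mass_threshold:
  "\<exists>\<rho>\<^sub>0::real. \<rho>\<^sub>0 > 0
    \<and> (\<forall>\<rho>\<in>{0<..\<rho>\<^sub>0}. min_energy v q p \<rho> = 0)
    \<and> (\<forall>\<rho>\<in>{\<rho>\<^sub>0<..}. min_energy v q p \<rho> < 0)
    \<and> (\<forall>\<rho>. 0 < \<rho> \<and> \<rho> < \<rho>\<^sub>0 \<longrightarrow>
          \<not> (\<exists>u\<in>mass_sphere \<rho>. ereal (E u) = min_energy v q p \<rho>))
    \<and> (\<forall>\<rho>\<in>{\<rho>\<^sub>0..}. \<exists>u\<in>mass_sphere \<rho>. min_energy v q p \<rho> = ereal (E u))"
proof -
  define N where "N = {\<rho>. 0 < \<rho> \<and> (\<exists>(u :: 'a \<Rightarrow> complex) f. half_pair u f \<and> L2_norm u = \<rho> \<and> E u < 0)}"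
  obtain \<rho>1 where \<rho>1: "\<rho>1 > 0" "\<And>(u :: 'a \<Rightarrow> complex) f. half_pair u f \<Longrightarrow> 0 < L2_norm u \<Longrightarrow> L2_norm u \<le> \<rho>1 \<Longrightarrow> E u > 0"
    by (rule small_mass) (rule that)
  have N_ge: "\<rho>1 \<le> \<rho>" if N: "\<rho> \<in> N" for \<rho>
  proof (rule ccontr)
    assume "\<not> \<rho>1 \<le> \<rho>"
    moreover obtain u f :: "'a \<Rightarrow> complex" where "half_pair u f" "0 < \<rho>" "L2_norm u = \<rho>" "E u < 0"
      using N by (auto simp: N_def)
    ultimately show False using \<rho>1(2)[of u f] by simp
  qed
  obtain u0 f0 :: "'a \<Rightarrow> complex" where "half_pair u0 f0" "L2_norm u0 > 0" "E u0 < 0"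
    by (rule energy_negative_exists)
  then have "L2_norm u0 \<in> N" unfolding N_def by blast
  then have N_ne: "N \<noteq> {}" by blast
  have bdd: "bdd_below N" using N_ge by (rule bdd_belowI)
  define \<rho>0 where "\<rho>0 = Inf N"
  have \<rho>0: "\<rho>0 > 0" using cInf_greatest[OF N_ne, of \<rho>1] N_ge \<rho>1(1) by (simp add: \<rho>0_def)
  have N_up: "\<rho>' \<in> N" if N: "\<rho> \<in> N" "\<rho> < \<rho>'" for \<rho> \<rho>'
  proof (rule ccontr)
    obtain u f :: "'a \<Rightarrow> complex" where u: "0 < \<rho>" "half_pair u f" "L2_norm u = \<rho>" "E u < 0"
      using N(1) by (auto simp: N_def)
    assume "\<rho>' \<notin> N"
    have low: "0 \<le> E w" if w: "half_pair w g" "L2_norm w = \<rho>'" for w g :: "'a \<Rightarrow> complex"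
    proof (rule ccontr)
      assume "\<not> 0 \<le> E w"
      then have "\<rho>' \<in> N" unfolding N_def using w u(1) N(2) by (intro CollectI conjI exI[of _ w] exI[of _ g]) auto
      with \<open>\<rho>' \<notin> N\<close> show False by simp
    qed
    \<comment> \<open>Nonnegativity at the larger mass, used as a lower bound with constant 0, would
      descend to the smaller one.\<close>
    have "(L2_norm u)\<^sup>2 / \<rho>'\<^sup>2 * 0 \<le> E u"
      by (rule energy_dilate(1)[OF u(2) _ _ low]) (use u N(2) in auto)
    then show False using u(4) by simp
  qed
  have N_down: "\<exists>\<rho>'\<in>N. \<rho>' < \<rho>" if N: "\<rho> \<in> N" for \<rho>
  proof -
    obtain u f :: "'a \<Rightarrow> complex" where u: "0 < \<rho>" "half_pair u f" "L2_norm u = \<rho>" "E u < 0"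
      using N by (auto simp: N_def)
    define a where "a t = t\<^sup>2 * kin f / 2 + t powr (q + 1) * power_integral (q + 1) u / (q + 1) - t powr (p + 1) * power_integral (p + 1) u / (p + 1)" for t :: real
    \<comment> \<open>A slightly smaller amplitude keeps the energy negative and lowers the mass, so
      \<open>N\<close> has no least element and does not contain its infimum.\<close>
    have "(a \<longlongrightarrow> a 1) (at_left 1)"
      unfolding a_def using q qp by (intro tendsto_intros) auto
    moreover have "a 1 < 0" using u(4) unfolding energy_eq[OF u(2)] a_def by simp
    ultimately have "\<forall>\<^sub>F t in at_left 1. a t < 0" by (rule order_tendstoD)
    moreover have "\<forall>\<^sub>F t in at_left (1::real). t \<in> {0<..<1}" by (rule eventually_at_left_real) simp
    ultimately have "\<forall>\<^sub>F t in at_left (1::real). a t < 0 \<and> t \<in> {0<..<1}" by (rule eventually_conj)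
    then obtain t where t: "a t < 0" "0 < t" "t < 1"
      using eventually_happens'[OF trivial_limit_at_left_real] by fastforce
    note H = energy_amplitude[OF u(2) t(2)]
    have "t * \<rho> \<in> N" unfolding N_def using H t u
      by (intro CollectI conjI exI[of _ "\<lambda>x. of_real t * u x"] exI[of _ "\<lambda>\<xi>. of_real t * f \<xi>"]) (auto simp: a_def)
    then show ?thesis using t u by (intro bexI[of _ "t * \<rho>"]) auto
  qed
  have N_iff: "\<rho> \<in> N \<longleftrightarrow> \<rho>0 < \<rho>" for \<rho>
  proof
    assume "\<rho> \<in> N"
    then obtain \<rho>' where "\<rho>' \<in> N" "\<rho>' < \<rho>" using N_down by blast
    then show "\<rho>0 < \<rho>" using cInf_lower[OF _ bdd, of \<rho>'] by (simp add: \<rho>0_def)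
  next
    assume "\<rho>0 < \<rho>"
    then obtain \<rho>' where "\<rho>' \<in> N" "\<rho>' < \<rho>" unfolding \<rho>0_def using cInf_lessD[OF N_ne] by blast
    then show "\<rho> \<in> N" by (rule N_up)
  qed
  have nonneg: "0 \<le> E w" if w: "half_pair w g" "L2_norm w = \<rho>" "0 < \<rho>" "\<rho> \<le> \<rho>0" for w g :: "'a \<Rightarrow> complex" and \<rho>
  proof (rule ccontr)
    assume "\<not> 0 \<le> E w"
    then have "\<rho> \<in> N" unfolding N_def using w by (intro CollectI conjI exI[of _ w] exI[of _ g]) auto
    then show False using N_iff w(4) by simp
  qed
  have min0: "min_energy v q p \<rho> = 0" if pos: "0 < \<rho>" "\<rho> \<le> \<rho>0" for \<rho>
  proof (rule antisym)
    show "min_energy v q p \<rho> \<le> 0"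
    proof (rule ereal_le_epsilon2)
      fix e :: real assume "0 < e"
      then obtain u f :: "'a \<Rightarrow> complex" where "half_pair u f" "L2_norm u = \<rho>" "E u < e"
        by (rule energy_small_exists[OF pos(1)]) (rule that)
      then show "min_energy v q p \<rho> \<le> 0 + ereal e"
        using min_energy_le[of u f \<rho>] by (auto intro: order_trans less_imp_le)
    qed
    show "0 \<le> min_energy v q p \<rho>"
      unfolding min_energy_def by (rule INF_greatest) (use nonneg pos in \<open>auto simp: mass_sphere_iff\<close>)
  qed
  have minneg: "min_energy v q p \<rho> < 0" if lt: "\<rho>0 < \<rho>" for \<rho>
  proof -
    obtain u f :: "'a \<Rightarrow> complex" where "half_pair u f" "L2_norm u = \<rho>" "E u < 0"
      using lt N_iff[of \<rho>] by (auto simp: N_def)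
    then show ?thesis using min_energy_le[of u f \<rho>] by (auto intro: le_less_trans)
  qed
  have nomin: "\<not> (\<exists>u\<in>mass_sphere \<rho>. ereal (E u) = min_energy v q p \<rho>)" if pos: "0 < \<rho>" "\<rho> < \<rho>0" for \<rho>
  proof
    assume "\<exists>u\<in>mass_sphere \<rho>. ereal (E u) = min_energy v q p \<rho>"
    then obtain u f :: "'a \<Rightarrow> complex" where u: "half_pair u f" "L2_norm u = \<rho>" "E u = 0"
      using min0[of \<rho>] pos by (auto simp: mass_sphere_iff)
    have "0 \<le> E w" if "half_pair w g" "L2_norm w = \<rho>0" for w g :: "'a \<Rightarrow> complex"
      using nonneg[OF that \<rho>0] by simp
    \<comment> \<open>Energies at the threshold mass are at least 0, and the strict form of the
      dilation estimate makes those at smaller positive masses strictly positive.\<close>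
    then have "(L2_norm u)\<^sup>2 / \<rho>0\<^sup>2 * 0 < E u"
      by (intro energy_dilate(2)[OF u(1)]) (use u pos in auto)
    then show False using u(3) by simp
  qed
  have ex: "\<exists>u\<in>mass_sphere \<rho>. min_energy v q p \<rho> = ereal (E u)" if "\<rho>0 \<le> \<rho>" for \<rho>
  proof -
    have pos: "\<rho> > 0" using that \<rho>0 by simp
    \<comment> \<open>A common form for the two cases: a lower bound on the sphere that is reached,
      namely 0 at the threshold and the real infimum beyond it.\<close>
    have "\<exists>c. (\<forall>(w :: 'a \<Rightarrow> complex) g. half_pair w g \<longrightarrow> L2_norm w = \<rho> \<longrightarrow> c \<le> E w) \<and>
       (\<exists>w g. half_pair w g \<and> L2_norm w = \<rho> \<and> E w \<le> c)"
    proof (cases "\<rho> = \<rho>0")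
      case True
      have "\<rho> + 1 / real (Suc n) \<in> N" for n using N_iff True by simp
      then have "\<forall>n. \<exists>(u :: 'a \<Rightarrow> complex) f. half_pair u f \<and> L2_norm u = \<rho> + 1 / real (Suc n) \<and> E u < 0"
        unfolding N_def by blast
      then obtain u f :: "nat \<Rightarrow> 'a \<Rightarrow> complex" where u: "\<And>n. half_pair (u n) (f n)" "\<And>n. L2_norm (u n) = \<rho> + 1 / real (Suc n)" "\<And>n. E (u n) < 0"
        by metis
      have low: "0 \<le> E w" if "half_pair w g" "L2_norm w = \<rho>" for w g :: "'a \<Rightarrow> complex"
        using nonneg[OF that pos] True by simp
      have "(\<lambda>n. \<rho> + 1 / real (Suc n)) \<longlonglongrightarrow> \<rho> + 0" by (intro tendsto_intros LIMSEQ_Suc[OF lim_1_over_n])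
      then have lim: "(\<lambda>n. L2_norm (u n)) \<longlonglongrightarrow> \<rho>" by (simp add: u(2))
      have "\<exists>w g. half_pair w g \<and> L2_norm w = \<rho> \<and> E w \<le> 0"
        by (rule minimizer_exists[OF u(1,3) pos lim low])
          (use u(3) in \<open>auto intro!: always_eventually intro: less_imp_le order_trans\<close>)
      then show ?thesis using low by blast
    next
      case False
      then have "\<rho> \<in> N" using that N_iff by simp
      then obtain w0 g0 :: "'a \<Rightarrow> complex" where w0: "half_pair w0 g0" "L2_norm w0 = \<rho>" "E w0 < 0" by (auto simp: N_def)
      define S where "S = {E w |w. \<exists>g. half_pair (w :: 'a \<Rightarrow> complex) g \<and> L2_norm w = \<rho>}"
      define c where "c = Inf S"
      obtain C where C: "C > 0" "\<And>(u :: 'a \<Rightarrow> complex) f. half_pair u f \<Longrightarrow> L2_norm u \<le> \<rho> \<Longrightarrow> E u \<ge> (1 - norm v) / 4 * half_energy f - C"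
        using energy_coercive[OF pos] by blast
      have S_ge: "- C \<le> s" if "s \<in> S" for s
      proof -
        obtain w g :: "'a \<Rightarrow> complex" where w: "s = E w" "half_pair w g" "L2_norm w = \<rho>" using \<open>s \<in> S\<close> by (auto simp: S_def)
        have "(1 - norm v) / 4 * half_energy g \<ge> 0" using v by simp
        then show ?thesis using C(2)[OF w(2)] w by simp
      qed
      have S_bdd: "bdd_below S" using S_ge by (rule bdd_belowI)
      have S_in: "E w \<in> S" if "half_pair w g" "L2_norm w = \<rho>" for w g :: "'a \<Rightarrow> complex" using that by (auto simp: S_def)
      have low: "c \<le> E w" if "half_pair w g" "L2_norm w = \<rho>" for w g :: "'a \<Rightarrow> complex"
        unfolding c_def by (rule cInf_lower[OF S_in[OF that] S_bdd])
      have c0: "c < 0" using low[OF w0(1,2)] w0(3) by simp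
      \<comment> \<open>The minimum with 0 keeps every energy of the sequence negative, as
        \<open>minimizer_exists\<close> requires; it is compatible with the infimum because
        \<open>c < 0\<close>.\<close>
      have "\<exists>(u :: 'a \<Rightarrow> complex) f. half_pair u f \<and> L2_norm u = \<rho> \<and> E u < min 0 (c + 1 / real (Suc n))" for n
      proof -
        have "Inf S < min 0 (c + 1 / real (Suc n))" using c0 by (simp add: c_def)
        moreover have "S \<noteq> {}" using S_in[OF w0(1,2)] by auto
        ultimately obtain s where "s \<in> S" "s < min 0 (c + 1 / real (Suc n))" using cInf_lessD by blast
        then show ?thesis by (auto simp: S_def)
      qed
      then obtain u f :: "nat \<Rightarrow> 'a \<Rightarrow> complex" where u: "\<And>n. half_pair (u n) (f n)" "\<And>n. L2_norm (u n) = \<rho>" "\<And>n. E (u n) < min 0 (c + 1 / real (Suc n))"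
        by metis
      have "\<exists>w g. half_pair w g \<and> L2_norm w = \<rho> \<and> E w \<le> c"
      proof (rule minimizer_exists[OF u(1) _ pos _ low])
        show "E (u n) < 0" for n using u(3)[of n] by simp
        show "(\<lambda>n. L2_norm (u n)) \<longlonglongrightarrow> \<rho>" by (simp add: u(2))
        fix e :: real assume "e > 0"
        then have "\<forall>\<^sub>F n in sequentially. 1 / real (Suc n) < e"
          using LIMSEQ_Suc[OF lim_1_over_n] by (intro order_tendstoD(2)) auto
        then show "\<forall>\<^sub>F n in sequentially. E (u n) \<le> c + e"
        proof eventually_elim
          fix n assume "1 / real (Suc n) < e"
          then show "E (u n) \<le> c + e" using u(3)[of n] by simp
        qed
      qed
      then show ?thesis using low by blast
    qed
    then obtain c w g where c: "\<And>(w :: 'a \<Rightarrow> complex) g. half_pair w g \<Longrightarrow> L2_norm w = \<rho> \<Longrightarrow> c \<le> E w"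
      and w: "half_pair w g" "L2_norm w = \<rho>" "E w \<le> c" by blast
    have "min_energy v q p \<rho> = ereal (E w)"
      by (rule min_energy_eq[OF w(1,2)]) (use c w(3) in \<open>blast intro: order_trans\<close>)
    moreover have "w \<in> mass_sphere \<rho>" using w unfolding mass_sphere_iff by blast
    ultimately show ?thesis by blast
  qed
  show ?thesis using \<rho>0 min0 minneg nomin ex by (intro exI[of _ \<rho>0]) auto
qed

end

theorem theorem1p1:
  fixes v :: "real ^ 'd" and q p :: real
  assumes "norm v < 1"
    and "1 < q" and "q < p" and "p < 1 + 2 / real CARD('d)"
  shows "\<exists>\<rho>\<^sub>0::real. \<rho>\<^sub>0 > 0
    \<and> (\<forall>\<rho>\<in>{0<..\<rho>\<^sub>0}. min_energy v q p \<rho> = 0)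
    \<and> (\<forall>\<rho>\<in>{\<rho>\<^sub>0<..}. min_energy v q p \<rho> < 0)
    \<and> (\<forall>\<rho>. 0 < \<rho> \<and> \<rho> < \<rho>\<^sub>0 \<longrightarrow>
          \<not> (\<exists>u\<in>mass_sphere \<rho>. ereal (energy v q p u) = min_energy v q p \<rho>))
    \<and> (\<forall>\<rho>\<in>{\<rho>\<^sub>0..}. \<exists>u\<in>mass_sphere \<rho>. min_energy v q p \<rho> = ereal (energy v q p u))"
proof -
  have "DIM(real ^ 'd) = CARD('d)" by simp
  then interpret boosted_half_wave v q p
    using assms by unfold_locales simp_all
  show ?thesis by (rule mass_threshold)
qed

end
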